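(* In the setting described in the context, let $f_\epsilon:[\mathfrak w_1^-,1+\mathfrak w_1^-]\to\mathbb R$ be given by $$f_\epsilon(x)=\boldsymbol F(1)+a(\epsilon)\int_{\mathfrak w_1^-}^xe^{S(y)/\epsilon}dy+\frac1\epsilon\,e^{-H/\epsilon}\int_{\mathfrak w_1^-}^xe^{S(y)/\epsilon}\int_{\mathfrak w_1^-}^y\overline g_\epsilon(z)\,e^{-S(z)/\epsilon}\,dz\,dy,$$ where $$a(\epsilon)=\frac1{e^{B/\epsilon}-1}\,\frac1\epsilon\,e^{-H/\epsilon}\int_{\mathfrak w_1^-}^{1+\mathfrak w_1^-}\overline g_\epsilon(y)\,e^{-S(y)/\epsilon}\,dy.$$ Then $f_\epsilon$ is $1$-periodic and solves the elliptic problem $\widehat L_\epsilon f_\epsilon=\overline g_\epsilon$ in $\mathbb T$. Moreover, there exists a finite constant $C_0$ such that $$\sup_{0<\epsilon<1}\ \sup_{\theta\in\mathbb T}|f_\epsilon(\theta)|\le C_0\qquad\text{and}\qquad\lim_{\epsilon\to0}\ \sup_{\theta\in\mathscr E}|f_\epsilon(\theta)-f(\theta)|=0,$$ where $f:\mathbb T\to\mathbb R$ is $f=\sum_{1\le i\le\boldsymbol n}\boldsymbol F(i)\,\chi_{\mathscr E_i}$.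
   Context: Model. $\mathbb T=[0,1)$ is the one-dimensional torus; functions on $\mathbb T$ are identified with $1$-periodic functions on $\mathbb R$. $b\in C^2(\mathbb T)$ has a finite zero set not containing $0$, $b'(\theta)\ne0$ whenever $b(\theta)=0$, and $B:=\int_{\mathbb T}b>0$. Let $S(x)=-\int_0^xb(y)dy$, so $S(x+1)=S(x)-B$; $z(x)=z_x$ is the largest point of $[x,\infty)$ at which $\max\{S(y):y\ge x\}$ is attained; $\widehat V(x)=S(x)-S(z_x)$, which is $1$-periodic; $H=-\min_{\mathbb T}\widehat V$; $V=\widehat V+H$. $\pi_\epsilon(x)=\int_x^{x+1}e^{[S(y)-S(x)]/\epsilon}dy$, $m_\epsilon=\pi_\epsilon/\int_0^1\pi_\epsilon$, $\mu_\epsilon(d\theta)=m_\epsilon(\theta)d\theta$. $\widehat L_\epsilon f=e^{H/\epsilon}(bf'+\epsilon f'')$. Landscapes and valleys. $\mathfrak M_k$ (resp. $\mathfrak m_k$), $1\le k\le q$, are the local maxima (resp. minima) of $S$ in $[0,1)$, ordered as $0\le\mathfrak M_1<\mathfrak m_1<\mathfrak M_2<\dots<\mathfrak M_q<\mathfrak m_q<1$, $q\ge1$; $\mathfrak M_{j+mq}=m+\mathfrak M_j$, $m\in\mathbb Z$. Let $\mathfrak L_1<\dots<\mathfrak L_{\boldsymbol m}$ be the local maxima in $[0,1)$ with $z(\mathfrak M_k)=\mathfrak M_k$; the origin is chosen so that $\mathfrak L_1=\mathfrak M_1$; $\mathfrak L_{n+r\boldsymbol m}=r+\mathfrak L_n$,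 $r\in\mathbb Z$. Let $\ell_n=\inf\{x\ge\mathfrak L_n:S(x)=S(\mathfrak L_{n+1})\}$ and $\Lambda_n=[\ell_n,\mathfrak L_{n+1}]$ (landscape). Let $\mathfrak M_{a(n,1)}<\dots<\mathfrak M_{a(n,r_n)}=\mathfrak L_{n+1}$ be the local maxima $\mathfrak M_k\in(\ell_n,\mathfrak L_{n+1}]$ with $S(\mathfrak M_k)=S(\ell_n)$, and $\mathfrak M_{a(n,0)}:=\ell_n$. The valleys of $\Lambda_n$ are the intervals $(\mathfrak M_{a(n,k-1)},\mathfrak M_{a(n,k)})$, $1\le k\le r_n$. Deepest valleys and wells. $\mathscr W_j=(\mathfrak w_j^-,\mathfrak w_j^+)$, $1\le j\le\boldsymbol n$, are all valleys with $\min_{\mathscr W_j}V=0$, and $\mathfrak m_{j,k}$, $1\le k\le\kappa(j)$, the global minima of $V$ on $\mathscr W_j$; they are ordered so that $0<\mathfrak m_{1,1}<\dots<\mathfrak m_{\boldsymbol n,1}<1$, and $\mathscr W_1$ is the left-most among the deepest valleys of its landscape. The well $\mathscr E_j=(e_j^-,e_j^+)\subset\mathscr W_j$ contains all $\mathfrak m_{j,k}$ and satisfies $V(e_j^-)=V(e_j^+)<H$, $V(\theta)<V(e_j^-)$ for $\theta\in\mathscr E_j$; $\mathscr E=\cup_{j=1}^{\boldsymbol n}\mathscr E_j$. Indices are extended periodically: $\mathscr W_{r\boldsymbol n+k}=r+\mathscr W_k$, $\mathscr E_{r\boldsymbol n+k}=r+\mathscr E_k$. Reduced generator. Let $\boldsymbol\pi(j)=\sum_{k=1}^{\kappa(j)}\sqrt{2\pi/S''(\mathfrak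 m_{j,k})}$ and $\boldsymbol\sigma_{j,j+1}=\sum_{\mathfrak M}\sqrt{2\pi/(-S''(\mathfrak M))}$, the sum being over the local maxima $\mathfrak M$ of $S$ with $V(\mathfrak M)=H$ that lie in $(e_j^+,e_{j+1}^-)$ and in the landscape containing $\mathscr W_j$; these quantities are $\boldsymbol n$-periodic in $j$. Put $R(j,j+1)=1/[\boldsymbol\pi(j)\boldsymbol\sigma_{j,j+1}]$; $R(j+1,j)=0$ if $\mathscr W_{j+1}$ is the left-most among the deepest valleys of its landscape, and $R(j+1,j)=1/[\boldsymbol\pi(j+1)\boldsymbol\sigma_{j,j+1}]$ otherwise. For $F:\{1,\dots,\boldsymbol n\}\to\mathbb R$, $(\boldsymbol LF)(j)=\sum_{a=\pm1}R(j,j+a)[F(j+a)-F(j)]$, indices modulo $\boldsymbol n$ (the terms $a=\pm1$ are defined separately even if $j+1\equiv j-1$). Right-hand side. $\boldsymbol F:\{1,\dots,\boldsymbol n\}\to\mathbb R$ is an arbitrary fixed function, $\boldsymbol G=\boldsymbol L\boldsymbol F$, $g=\sum_{1\le i\le\boldsymbol n}\boldsymbol G(i)\chi_{\mathscr E_i}$ ($\chi$ indicator function), $r(\epsilon)=E_{\mu_\epsilon}[g]/\mu_\epsilon(\mathscr E_1)$ and $\overline g_\epsilon=g-r(\epsilon)\chi_{\mathscr E_1}$ (so $\overline g_\epsilon$ has mean zero with respect to $\mu_\epsilon$). *)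

theory Defs
  imports "HOL-Analysis.Analysis"
begin

text \<open>
  Functions on the torus are 1-periodic functions on the real line, and all enumerations
  (local maxima, landscapes, valleys, wells) are indexed by \<^typ>\<open>int\<close> and extended periodically.
\<close>

section \<open>Drift and potential\<close>

definition admissible_drift :: "(real \<Rightarrow> real) \<Rightarrow> bool" where
  "admissible_drift b \<longleftrightarrow>
     (\<forall>x. b (x + 1) = b x) \<and>
     b differentiable_on UNIV \<and> deriv b differentiable_on UNIV \<and>
     continuous_on UNIV (deriv (deriv b)) \<and>
     finite {x \<in> {0..<1}. b x = 0} \<and> b 0 \<noteq> 0 \<and>
     (\<forall>x. b x = 0 \<longrightarrow> deriv b x \<noteq> 0) \<and>
     (LBINT y=0..1. b y) > 0"

definition B :: "(real \<Rightarrow> real) \<Rightarrow> real" where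
  "B b = (LBINT y=0..1. b y)"

text \<open>The interval integral is oriented, so this is also the intended function for negative \<open>x\<close>.\<close>

definition S :: "(real \<Rightarrow> real) \<Rightarrow> real \<Rightarrow> real" where
  "S b x = - (LBINT y=0..x. b y)"

definition zmax :: "(real \<Rightarrow> real) \<Rightarrow> real \<Rightarrow> real" where
  "zmax b x = (GREATEST y. x \<le> y \<and> (\<forall>u\<ge>x. S b u \<le> S b y))"

definition Vhat :: "(real \<Rightarrow> real) \<Rightarrow> real \<Rightarrow> real" where
  "Vhat b x = S b x - S b (zmax b x)"

text \<open>\<^term>\<open>Vhat b\<close> is continuous and 1-periodic, so the infimum is a minimum.\<close>

definition H :: "(real \<Rightarrow> real) \<Rightarrow> real" where
  "H b = - (INF x\<in>{0..<1}. Vhat b x)"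

definition V :: "(real \<Rightarrow> real) \<Rightarrow> real \<Rightarrow> real" where
  "V b x = Vhat b x + H b"

definition loc_max :: "(real \<Rightarrow> real) \<Rightarrow> real \<Rightarrow> bool" where
  "loc_max f x \<longleftrightarrow> eventually (\<lambda>y. f y \<le> f x) (nhds x)"

definition loc_min :: "(real \<Rightarrow> real) \<Rightarrow> real \<Rightarrow> bool" where
  "loc_min f x \<longleftrightarrow> eventually (\<lambda>y. f x \<le> f y) (nhds x)"


section \<open>The stationary measure and the generator\<close>

definition pi_eps :: "(real \<Rightarrow> real) \<Rightarrow> real \<Rightarrow> real \<Rightarrow> real" where
  "pi_eps b \<epsilon> x = (LBINT y=x..x+1. exp ((S b y - S b x) / \<epsilon>))"

definition m_eps :: "(real \<Rightarrow> real) \<Rightarrow> real \<Rightarrow> real \<Rightarrow> real" where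
  "m_eps b \<epsilon> x = pi_eps b \<epsilon> x / (LBINT y=0..1. pi_eps b \<epsilon> y)"

definition mu_eps :: "(real \<Rightarrow> real) \<Rightarrow> real \<Rightarrow> real measure" where
  "mu_eps b \<epsilon> = density (restrict_space lborel {0..<1}) (\<lambda>\<theta>. ennreal (m_eps b \<epsilon> \<theta>))"

definition Lhat :: "(real \<Rightarrow> real) \<Rightarrow> real \<Rightarrow> (real \<Rightarrow> real) \<Rightarrow> real \<Rightarrow> real" where
  "Lhat b \<epsilon> f x = exp (H b / \<epsilon>) * (b x * deriv f x + \<epsilon> * deriv (deriv f) x)"

text \<open>
  Solution of \<open>Lhat f = g\<close> on the torus for a right-hand side \<open>g\<close> with finitely many
  jumps per period: \<open>f\<close> is continuously differentiable everywhere, also across the jumps,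
  and the equation holds classically wherever \<open>g\<close> is continuous. (A second derivative
  cannot exist at a genuine jump of \<open>g\<close>.)
\<close>

definition solves_elliptic ::
    "(real \<Rightarrow> real) \<Rightarrow> real \<Rightarrow> (real \<Rightarrow> real) \<Rightarrow> (real \<Rightarrow> real) \<Rightarrow> bool" where
  "solves_elliptic b \<epsilon> f g \<longleftrightarrow>
     (\<forall>x. f (x + 1) = f x) \<and>
     f differentiable_on UNIV \<and> continuous_on UNIV (deriv f) \<and>
     (\<forall>x. isCont g x \<longrightarrow> deriv f differentiable (at x) \<and> Lhat b \<epsilon> f x = g x)"


section \<open>Landscapes and valleys\<close>

definition critical_points ::
    "(real \<Rightarrow> real) \<Rightarrow> int \<Rightarrow> (int \<Rightarrow> real) \<Rightarrow> (int \<Rightarrow> real) \<Rightarrow> bool" where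
  "critical_points b q M m \<longleftrightarrow>
     q \<ge> 1 \<and>
     M ` {1..q} = {x \<in> {0..<1}. loc_max (S b) x} \<and>
     m ` {1..q} = {x \<in> {0..<1}. loc_min (S b) x} \<and>
     (\<forall>k\<in>{1..q}. M k < m k) \<and> (\<forall>k\<in>{1..<q}. m k < M (k + 1)) \<and>
     (\<forall>j r. M (j + r * q) = of_int r + M j)"

text \<open>The clause \<open>L 1 = M 1\<close> is the choice of the origin.\<close>

definition landscape_maxima ::
    "(real \<Rightarrow> real) \<Rightarrow> int \<Rightarrow> (int \<Rightarrow> real) \<Rightarrow> int \<Rightarrow> (int \<Rightarrow> real) \<Rightarrow> bool" where
  "landscape_maxima b q M p L \<longleftrightarrow>
     p \<ge> 1 \<and>
     strict_mono_on {1..p} L \<and>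
     L ` {1..p} = {M k |k. k \<in> {1..q} \<and> zmax b (M k) = M k} \<and>
     L 1 = M 1 \<and>
     (\<forall>n r. L (n + r * p) = of_int r + L n)"

definition ell :: "(real \<Rightarrow> real) \<Rightarrow> (int \<Rightarrow> real) \<Rightarrow> int \<Rightarrow> real" where
  "ell b L n = Inf {x. x \<ge> L n \<and> S b x = S b (L (n + 1))}"

definition landscape :: "(real \<Rightarrow> real) \<Rightarrow> (int \<Rightarrow> real) \<Rightarrow> int \<Rightarrow> real set" where
  "landscape b L n = {ell b L n..L (n + 1)}"

text \<open>The points \<open>M(a(n,0)) < \<dots> < M(a(n,r\<^sub>n))\<close>; a valley is an interval between two
  consecutive ones.\<close>

definition valley_points :: "(real \<Rightarrow> real) \<Rightarrow> (int \<Rightarrow> real) \<Rightarrow> int \<Rightarrow> real set" where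
  "valley_points b L n =
     insert (ell b L n)
       {x \<in> {ell b L n<..L (n + 1)}. loc_max (S b) x \<and> S b x = S b (ell b L n)}"

definition is_valley ::
    "(real \<Rightarrow> real) \<Rightarrow> (int \<Rightarrow> real) \<Rightarrow> int \<Rightarrow> real \<Rightarrow> real \<Rightarrow> bool" where
  "is_valley b L n u v \<longleftrightarrow>
     u \<in> valley_points b L n \<and> v \<in> valley_points b L n \<and> u < v \<and>
     valley_points b L n \<inter> {u<..<v} = {}"


section \<open>Deepest valleys and wells\<close>

definition global_minima :: "(real \<Rightarrow> real) \<Rightarrow> real \<Rightarrow> real \<Rightarrow> real set" where
  "global_minima b u v = {x. is_arg_min (V b) (\<lambda>y. y \<in> {u<..<v}) x}"

definition is_deepest_valley ::
    "(real \<Rightarrow> real) \<Rightarrow> (int \<Rightarrow> real) \<Rightarrow> int \<Rightarrow> real \<Rightarrow> real \<Rightarrow> bool" where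
  "is_deepest_valley b L n u v \<longleftrightarrow>
     is_valley b L n u v \<and> (\<exists>x \<in> global_minima b u v. V b x = 0)"

definition is_leftmost_deepest ::
    "(real \<Rightarrow> real) \<Rightarrow> (int \<Rightarrow> real) \<Rightarrow> real \<Rightarrow> real \<Rightarrow> bool" where
  "is_leftmost_deepest b L u v \<longleftrightarrow>
     (\<exists>n. is_deepest_valley b L n u v \<and>
          (\<forall>u' v'. is_deepest_valley b L n u' v' \<longrightarrow> u \<le> u'))"

text \<open>
  \<open>(wm j, wp j)\<close> is the \<open>j\<close>-th deepest valley; \<^term>\<open>Min (global_minima b u v)\<close> is the first
  of its minima. Every deepest valley on the line has exactly one integer translate
  whose first minimum lies in \<open>(0,1)\<close>.
\<close>

definition deepest_valleys ::
    "(real \<Rightarrow> real) \<Rightarrow> (int \<Rightarrow> real) \<Rightarrow> int \<Rightarrow> (int \<Rightarrow> real) \<Rightarrow> (int \<Rightarrow> real) \<Rightarrow> bool" where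
  "deepest_valleys b L N wm wp \<longleftrightarrow>
     N \<ge> 1 \<and>
     (\<lambda>j. (wm j, wp j)) ` {1..N} =
       {(u, v). (\<exists>n. is_deepest_valley b L n u v) \<and> Min (global_minima b u v) \<in> {0<..<1}} \<and>
     strict_mono_on {1..N} (\<lambda>j. Min (global_minima b (wm j) (wp j))) \<and>
     is_leftmost_deepest b L (wm 1) (wp 1) \<and>
     (\<forall>j r. wm (j + r * N) = of_int r + wm j \<and> wp (j + r * N) = of_int r + wp j)"

definition wells ::
    "(real \<Rightarrow> real) \<Rightarrow> int \<Rightarrow> (int \<Rightarrow> real) \<Rightarrow> (int \<Rightarrow> real) \<Rightarrow> (int \<Rightarrow> real) \<Rightarrow> (int \<Rightarrow> real) \<Rightarrow> bool"
  where
  "wells b N wm wp em ep \<longleftrightarrow>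
     (\<forall>j\<in>{1..N}.
        {em j<..<ep j} \<subseteq> {wm j<..<wp j} \<and>
        global_minima b (wm j) (wp j) \<subseteq> {em j<..<ep j} \<and>
        V b (em j) = V b (ep j) \<and> V b (em j) < H b \<and>
        (\<forall>\<theta>\<in>{em j<..<ep j}. V b \<theta> < V b (em j))) \<and>
     (\<forall>j r. em (j + r * N) = of_int r + em j \<and> ep (j + r * N) = of_int r + ep j)"

text \<open>The \<open>i\<close>-th well as a subset of the torus, i.e. the union of its integer translates.\<close>

definition torus_well :: "(int \<Rightarrow> real) \<Rightarrow> (int \<Rightarrow> real) \<Rightarrow> int \<Rightarrow> real set" where
  "torus_well em ep i = {\<theta>. \<exists>r::int. \<theta> + of_int r \<in> {em i<..<ep i}}"

definition torus_wells :: "int \<Rightarrow> (int \<Rightarrow> real) \<Rightarrow> (int \<Rightarrow> real) \<Rightarrow> real set" where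
  "torus_wells N em ep = (\<Union>i\<in>{1..N}. torus_well em ep i)"

text \<open>The function \<open>\<Sum>\<^sub>i A(i) \<chi>(E\<^sub>i)\<close> on the torus.\<close>

definition well_step :: "int \<Rightarrow> (int \<Rightarrow> real) \<Rightarrow> (int \<Rightarrow> real) \<Rightarrow> (int \<Rightarrow> real) \<Rightarrow> real \<Rightarrow> real" where
  "well_step N em ep A \<theta> = (\<Sum>i\<in>{1..N}. A i * indicator (torus_well em ep i) \<theta>)"


section \<open>The reduced generator\<close>

definition weight :: "(real \<Rightarrow> real) \<Rightarrow> (int \<Rightarrow> real) \<Rightarrow> (int \<Rightarrow> real) \<Rightarrow> int \<Rightarrow> real" where
  "weight b wm wp j =
     (\<Sum>x\<in>global_minima b (wm j) (wp j). sqrt (2 * pi / deriv (deriv (S b)) x))"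

text \<open>\<^term>\<open>\<sigma> b L wm wp em ep j\<close> is the quantity attached to the pair \<open>(j, j+1)\<close>.\<close>

definition \<sigma> ::
    "(real \<Rightarrow> real) \<Rightarrow> (int \<Rightarrow> real) \<Rightarrow> (int \<Rightarrow> real) \<Rightarrow> (int \<Rightarrow> real) \<Rightarrow>
     (int \<Rightarrow> real) \<Rightarrow> (int \<Rightarrow> real) \<Rightarrow> int \<Rightarrow> real" where
  "\<sigma> b L wm wp em ep j =
     (\<Sum>x\<in>{x. loc_max (S b) x \<and> V b x = H b \<and> x \<in> {ep j<..<em (j + 1)} \<and>
              (\<exists>n. {wm j<..<wp j} \<subseteq> landscape b L n \<and> x \<in> landscape b L n)}.
        sqrt (2 * pi / (- deriv (deriv (S b)) x)))"

text \<open>The arguments of the rate are integers, not residues, so that for two wells the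
  jumps \<open>j \<rightarrow> j + 1\<close> and \<open>j \<rightarrow> j - 1\<close> remain distinct.\<close>

definition rate ::
    "(real \<Rightarrow> real) \<Rightarrow> (int \<Rightarrow> real) \<Rightarrow> (int \<Rightarrow> real) \<Rightarrow> (int \<Rightarrow> real) \<Rightarrow>
     (int \<Rightarrow> real) \<Rightarrow> (int \<Rightarrow> real) \<Rightarrow> int \<Rightarrow> int \<Rightarrow> real" where
  "rate b L wm wp em ep i j =
     (if j = i + 1 then 1 / (weight b wm wp i * \<sigma> b L wm wp em ep i)
      else if j = i - 1 then
        (if is_leftmost_deepest b L (wm i) (wp i) then 0
         else 1 / (weight b wm wp i * \<sigma> b L wm wp em ep j))
      else 0)"

text \<open>Representative in \<open>{1..N}\<close> of an index modulo \<open>N\<close>.\<close>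

definition wrap :: "int \<Rightarrow> int \<Rightarrow> int" where
  "wrap N j = (j - 1) mod N + 1"

definition reduced_gen ::
    "(real \<Rightarrow> real) \<Rightarrow> (int \<Rightarrow> real) \<Rightarrow> int \<Rightarrow> (int \<Rightarrow> real) \<Rightarrow> (int \<Rightarrow> real) \<Rightarrow>
     (int \<Rightarrow> real) \<Rightarrow> (int \<Rightarrow> real) \<Rightarrow> (int \<Rightarrow> real) \<Rightarrow> int \<Rightarrow> real" where
  "reduced_gen b L N wm wp em ep F j =
     (\<Sum>a\<in>{1, -1}. rate b L wm wp em ep j (j + a) * (F (wrap N (j + a)) - F (wrap N j)))"


section \<open>The right-hand side and the explicit solution\<close>

definition g_rhs ::
    "(real \<Rightarrow> real) \<Rightarrow> (int \<Rightarrow> real) \<Rightarrow> int \<Rightarrow> (int \<Rightarrow> real) \<Rightarrow> (int \<Rightarrow> real) \<Rightarrow>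
     (int \<Rightarrow> real) \<Rightarrow> (int \<Rightarrow> real) \<Rightarrow> (int \<Rightarrow> real) \<Rightarrow> real \<Rightarrow> real" where
  "g_rhs b L N wm wp em ep F =
     well_step N em ep (reduced_gen b L N wm wp em ep F)"

definition r_eps ::
    "(real \<Rightarrow> real) \<Rightarrow> (int \<Rightarrow> real) \<Rightarrow> int \<Rightarrow> (int \<Rightarrow> real) \<Rightarrow> (int \<Rightarrow> real) \<Rightarrow>
     (int \<Rightarrow> real) \<Rightarrow> (int \<Rightarrow> real) \<Rightarrow> (int \<Rightarrow> real) \<Rightarrow> real \<Rightarrow> real" where
  "r_eps b L N wm wp em ep F \<epsilon> =
     integral\<^sup>L (mu_eps b \<epsilon>) (g_rhs b L N wm wp em ep F) /
     measure (mu_eps b \<epsilon>) (torus_well em ep 1 \<inter> {0..<1})"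

definition gbar ::
    "(real \<Rightarrow> real) \<Rightarrow> (int \<Rightarrow> real) \<Rightarrow> int \<Rightarrow> (int \<Rightarrow> real) \<Rightarrow> (int \<Rightarrow> real) \<Rightarrow>
     (int \<Rightarrow> real) \<Rightarrow> (int \<Rightarrow> real) \<Rightarrow> (int \<Rightarrow> real) \<Rightarrow> real \<Rightarrow> real \<Rightarrow> real" where
  "gbar b L N wm wp em ep F \<epsilon> \<theta> =
     g_rhs b L N wm wp em ep F \<theta>
     - r_eps b L N wm wp em ep F \<epsilon> * indicator (torus_well em ep 1) \<theta>"

definition a_eps :: "(real \<Rightarrow> real) \<Rightarrow> real \<Rightarrow> real \<Rightarrow> (real \<Rightarrow> real) \<Rightarrow> real" where
  "a_eps b \<epsilon> w g =
     1 / (exp (B b / \<epsilon>) - 1) * (1 / \<epsilon>) * exp (- H b / \<epsilon>) *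
     (LBINT y=w..1+w. g y * exp (- S b y / \<epsilon>))"

text \<open>The explicit formula on \<open>[w, 1 + w]\<close>, with value \<open>c\<close> at \<open>w\<close>.\<close>

definition f_formula ::
    "(real \<Rightarrow> real) \<Rightarrow> real \<Rightarrow> real \<Rightarrow> real \<Rightarrow> (real \<Rightarrow> real) \<Rightarrow> real \<Rightarrow> real" where
  "f_formula b \<epsilon> w c g x =
     c + a_eps b \<epsilon> w g * (LBINT y=w..x. exp (S b y / \<epsilon>))
     + 1 / \<epsilon> * exp (- H b / \<epsilon>) *
       (LBINT y=w..x. exp (S b y / \<epsilon>) * (LBINT z=w..y. g z * exp (- S b z / \<epsilon>)))"

definition f_eps ::
    "(real \<Rightarrow> real) \<Rightarrow> (int \<Rightarrow> real) \<Rightarrow> int \<Rightarrow> (int \<Rightarrow> real) \<Rightarrow> (int \<Rightarrow> real) \<Rightarrow>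
     (int \<Rightarrow> real) \<Rightarrow> (int \<Rightarrow> real) \<Rightarrow> (int \<Rightarrow> real) \<Rightarrow> real \<Rightarrow> real \<Rightarrow> real" where
  "f_eps b L N wm wp em ep F \<epsilon> =
     f_formula b \<epsilon> (wm 1) (F 1) (gbar b L N wm wp em ep F \<epsilon>)"

text \<open>The 1-periodic function that agrees with \<open>h\<close> on \<open>[w, 1 + w)\<close>; it also agrees with
  \<open>h\<close> at \<open>1 + w\<close> precisely when \<open>h (1 + w) = h w\<close>.\<close>

definition periodic_ext :: "real \<Rightarrow> (real \<Rightarrow> real) \<Rightarrow> real \<Rightarrow> real" where
  "periodic_ext w h x = h (x - of_int \<lfloor>x - w\<rfloor>)"

end

theory Submission
  imports Defs "HOL-Probability.Distributions" "HOL-Real_Asymp.Real_Asymp"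
begin

text \<open>
  The derivative of the explicit solution is \<open>exp (S / \<epsilon>)\<close> times a constant plus an integral of
  \<open>g * exp (- S / \<epsilon>)\<close>. On the whole line that factor is a multiple of the integral of
  \<open>g * exp (- S / \<epsilon>)\<close> over \<open>(-\<infinity>, y]\<close>, so the derivative is periodic
  (\<open>slope_periodic\<close>), and the solution itself is periodic exactly when it returns to its initial value
  after one period. By an integration by parts (\<open>lint_flux_eq\<close>) its increment over one period is
  proportional to the stationary mean of \<open>g\<close>, which vanishes for the corrected right-hand side.

  The right-hand side is a combination of indicators of the wells, so the solution is a combination
  of elementary solutions \<open>elem \<epsilon> i\<close>, one for each well (\<open>f_formula_comb\<close>). Each of them is a
  nonnegative, nondecreasing double integral of \<open>exp ((S y - S z - H) / \<epsilon>) / \<epsilon>\<close> over \<open>z\<close> in the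
  well or a translate of it and \<open>y\<close> to the right of \<open>z\<close>. The exponent is never positive, and it vanishes only if
  \<open>z\<close> is a global minimum of the well and \<open>y\<close> is a maximum at the height of the crest of its valley.
  Such maxima all lie in the landscape of the well, because everything to the right of the landscape
  is strictly lower (\<open>S_le_right_of_ell\<close>, \<open>S_valley\<close>). Beyond the well the double integral factorizes
  and Laplace asymptotics apply to both factors: on the \<open>j\<close>-th well the \<open>i\<close>-th elementary solution
  tends to the weight of well \<open>i\<close> times the sum of the saddles between the wells \<open>i\<close> and \<open>j\<close>
  that belong to the landscape of \<open>i\<close> (\<open>elem_limit_wells\<close>).

  It remains to sum these limits with the coefficients \<open>gen F i\<close>. Multiplied by the weight, such a
  coefficient is a difference of the two fluxes \<open>(F (k + 1) - F k) / saddle k\<close> for \<open>k = i\<close> and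
  \<open>k = i - 1\<close>, the second one being absent for the left-most well of a landscape. So the sums
  telescope twice and give \<open>F j - F 1\<close> (\<open>sum_gen_level\<close>). Over a full period they give 0. Hence the
  correction by \<open>r(\<epsilon>)\<close> contributes nothing in the limit (\<open>r_of_eq\<close>). Monotonicity of the elementary
  solutions makes the convergence uniform on each well, and their values at the end of the period
  bound the solution everywhere.
\<close>

section \<open>Oriented integrals of locally integrable functions\<close>

abbreviation lint :: "real \<Rightarrow> real \<Rightarrow> (real \<Rightarrow> real) \<Rightarrow> real" where
  "lint a c g \<equiv> interval_lebesgue_integral lborel (ereal a) (ereal c) g"

definition locally_integrable :: "(real \<Rightarrow> real) \<Rightarrow> bool" where
  "locally_integrable g \<longleftrightarrow> (\<forall>a c. set_integrable lborel {a..c} g)"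

lemma locally_integrable_imp_integrable_on:
  "locally_integrable g \<Longrightarrow> g integrable_on {a..c}"
  by (simp add: locally_integrable_def set_borel_integral_eq_integral)

lemma locally_integrable_continuous:
  assumes "continuous_on UNIV g"
  shows "locally_integrable g"
  unfolding locally_integrable_def
  by (meson assms borel_integrable_atLeastAtMost' continuous_on_subset subset_UNIV)

lemma locally_integrable_bounded_mult:
  fixes g \<phi> :: "real \<Rightarrow> real"
  assumes "g \<in> borel_measurable borel" and "\<And>x. \<bar>g x\<bar> \<le> D" and "continuous_on UNIV \<phi>"
  shows "locally_integrable (\<lambda>x. g x * \<phi> x)"
  unfolding locally_integrable_def
proof (intro allI)
  fix a c
  have "set_integrable lborel {a..c} \<phi>"
    using assms(3) locally_integrable_continuous locally_integrable_def by blast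
  then have i: "set_integrable lborel {a..c} (\<lambda>x. D * \<phi> x)"
    by simp
  have "\<phi> \<in> borel_measurable borel"
    using assms(3) by (simp add: borel_measurable_continuous_onI)
  with assms(1) have m: "(\<lambda>x. g x * \<phi> x) \<in> borel_measurable borel"
    by measurable
  show "set_integrable lborel {a..c} (\<lambda>x. g x * \<phi> x)"
    unfolding set_integrable_def
  proof (rule Bochner_Integration.integrable_bound)
    show "integrable lborel (\<lambda>x. indicator {a..c} x *\<^sub>R (D * \<phi> x))"
      using i by (simp add: set_integrable_def)
    show "(\<lambda>x. indicator {a..c} x *\<^sub>R (g x * \<phi> x)) \<in> borel_measurable lborel"
      using m by simp
    have "\<bar>g x * \<phi> x\<bar> \<le> \<bar>D * \<phi> x\<bar>" for x
      using assms(2)[of x] by (auto simp: abs_mult intro!: mult_right_mono)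
    then show "AE x in lborel. norm (indicator {a..c} x *\<^sub>R (g x * \<phi> x))
        \<le> norm (indicator {a..c} x *\<^sub>R (D * \<phi> x))"
      by (auto simp: indicator_def)
  qed
qed

lemma lint_eq_integral:
  assumes "locally_integrable g" and "w \<le> x"
  shows "lint w x g = integral {w..x} g"
  using assms by (simp add: interval_integral_eq_integral locally_integrable_def)

text \<open>
  With a common base point to the left of both limits, an oriented integral is a difference of
  two ordinary ones, whatever the order of its limits; this reduces continuity and
  differentiability in the upper limit to the Henstock--Kurzweil integral.
\<close>

lemma lint_eq_integral_diff:
  assumes "locally_integrable g" and "a \<le> w" and "a \<le> x"
  shows "lint w x g = integral {a..x} g - integral {a..w} g"
proof -
  have *: "lint u v g = integral {a..v} g - integral {a..u} g" if "a \<le> u" "u \<le> v" for u v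
    using that lint_eq_integral[OF assms(1) that(2)]
      Henstock_Kurzweil_Integration.integral_combine[of a u v g]
      locally_integrable_imp_integrable_on[OF assms(1), of a v]
    by simp
  show ?thesis
  proof (cases "w \<le> x")
    case True
    then show ?thesis using * assms by simp
  next
    case False
    then have "lint x w g = integral {a..w} g - integral {a..x} g"
      using * assms by simp
    then show ?thesis
      using interval_integral_endpoints_reverse[of "ereal w" "ereal x" g] by simp
  qed
qed

lemma lint_combine:
  assumes "locally_integrable g"
  shows "lint u v g + lint v w g = lint u w g"
  using lint_eq_integral_diff[OF assms, of "min u (min v w)"] by simp

lemma lint_has_derivative:
  assumes "locally_integrable g" and "isCont g x"
  shows "((\<lambda>u. lint w u g) has_real_derivative g x) (at x)"
proof -
  define a where "a = min w x - 1"
  have "((\<lambda>u. integral {a..u} g) has_vector_derivative g x) (at x within {a..x+1} - {})"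
    by (rule integral_has_vector_derivative_continuous_at)
      (use assms in \<open>auto simp: a_def locally_integrable_imp_integrable_on
          intro: continuous_at_imp_continuous_at_within\<close>)
  moreover have "at x within {a..x+1} = at x"
    by (rule at_within_interior) (auto simp: a_def interior_atLeastAtMost_real)
  ultimately have "((\<lambda>u. integral {a..u} g) has_real_derivative g x) (at x)"
    by (simp add: has_real_derivative_iff_has_vector_derivative)
  then have "((\<lambda>u. integral {a..u} g - integral {a..w} g) has_real_derivative g x) (at x)"
    by (auto intro!: derivative_eq_intros)
  moreover have "eventually (\<lambda>u. lint w u g = integral {a..u} g - integral {a..w} g) (nhds x)"
  proof -
    have "eventually (\<lambda>u. u > a) (nhds x)"
      by (rule eventually_nhds_in_open[of "{a<..}", simplified]) (simp add: a_def)
    then show ?thesis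
      by eventually_elim (rule lint_eq_integral_diff[OF assms(1)], auto simp: a_def)
  qed
  ultimately show ?thesis
    using DERIV_cong_ev[OF refl _ refl] by fastforce
qed

lemma lint_continuous:
  assumes "locally_integrable g"
  shows "isCont (\<lambda>u. lint w u g) x"
proof -
  define a where "a = min w x - 1"
  have "continuous_on {a..x+1} (\<lambda>u. integral {a..u} g)"
    by (rule indefinite_integral_continuous_1)
      (rule locally_integrable_imp_integrable_on[OF assms])
  then have "continuous_on {a<..<x+1} (\<lambda>u. integral {a..u} g)"
    by (rule continuous_on_subset) auto
  then have "continuous_on {a<..<x+1} (\<lambda>u. integral {a..u} g - integral {a..w} g)"
    by (intro continuous_intros)
  also have "?this \<longleftrightarrow> continuous_on {a<..<x+1} (\<lambda>u. lint w u g)"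
    by (intro continuous_on_cong refl lint_eq_integral_diff[symmetric] assms) (auto simp: a_def)
  finally show ?thesis
    by (rule continuous_on_interior) (auto simp: a_def)
qed

lemma lint_sum:
  assumes "finite I" and "\<And>i. i \<in> I \<Longrightarrow> locally_integrable (g i)"
  shows "locally_integrable (\<lambda>y. \<Sum>i\<in>I. c i * g i y)"
    and "lint w x (\<lambda>y. \<Sum>i\<in>I. c i * g i y) = (\<Sum>i\<in>I. c i * lint w x (g i))"
proof -
  show l: "locally_integrable (\<lambda>y. \<Sum>i\<in>I. c i * g i y)"
    unfolding locally_integrable_def
  proof (intro allI)
    fix a d
    have "set_integrable lborel {a..d} (\<lambda>y. c i * g i y)" if "i \<in> I" for i
      using assms(2)[OF that] by (simp add: locally_integrable_def)
    then have "integrable lborel (\<lambda>y. \<Sum>i\<in>I. indicator {a..d} y *\<^sub>R (c i * g i y))"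
      unfolding set_integrable_def by (rule Bochner_Integration.integrable_sum)
    then show "set_integrable lborel {a..d} (\<lambda>y. \<Sum>i\<in>I. c i * g i y)"
      by (simp add: set_integrable_def scaleR_sum_right del: real_scaleR_def)
  qed
  define a where "a = min w x"
  have *: "integral {a..u} (\<lambda>y. \<Sum>i\<in>I. c i * g i y) = (\<Sum>i\<in>I. c i * integral {a..u} (g i))" for u
  proof -
    have "integral {a..u} (\<lambda>y. \<Sum>i\<in>I. c i * g i y) = (\<Sum>i\<in>I. integral {a..u} (\<lambda>y. c i * g i y))"
      using assms(2) by (intro integral_sum assms(1) integrable_on_mult_right
          locally_integrable_imp_integrable_on)
    then show ?thesis by (simp only: integral_mult_right)
  qed
  show "lint w x (\<lambda>y. \<Sum>i\<in>I. c i * g i y) = (\<Sum>i\<in>I. c i * lint w x (g i))"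
  proof -
    have "a \<le> w" "a \<le> x" by (auto simp: a_def)
    note d = lint_eq_integral_diff[OF _ this]
    have "(\<Sum>i\<in>I. c i * lint w x (g i))
        = (\<Sum>i\<in>I. c i * integral {a..x} (g i) - c i * integral {a..w} (g i))"
      by (intro sum.cong refl) (simp only: d[OF assms(2)] right_diff_distrib)
    then show ?thesis
      by (simp only: d[OF l] * sum_subtractf)
  qed
qed

lemma lint_add:
  assumes "locally_integrable g" and "locally_integrable h"
  shows "locally_integrable (\<lambda>y. c * g y + d * h y)"
    and "lint w x (\<lambda>y. c * g y + d * h y) = c * lint w x g + d * lint w x h"
  using lint_sum[where I = "{True, False}" and g = "\<lambda>i. if i then g else h"
      and c = "\<lambda>i. if i then c else d"] assms
  by simp_all

lemma lint_cmult:
  "lint w x (\<lambda>y. c * g y) = c * lint w x g"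
  by simp

lemma lint_shift:
  assumes "locally_integrable g"
  shows "lint (w + t) (x + t) g = lint w x (\<lambda>y. g (y + t))"
proof -
  have *: "lint (u + t) (v + t) g = lint u v (\<lambda>y. g (y + t))" if "u \<le> v" for u v
  proof -
    have "integrable lborel (\<lambda>x. indicator {u+t..v+t} (t + 1 * x) *\<^sub>R g (t + 1 * x))"
      using assms unfolding locally_integrable_def set_integrable_def
      by (subst lborel_integrable_real_affine_iff) auto
    then have "set_integrable lborel {u..v} (\<lambda>y. g (y + t))"
      by (simp add: set_integrable_def indicator_def add.commute cong: if_cong)
    then have "lint u v (\<lambda>y. g (y + t)) = integral {u..v} (\<lambda>y. g (y + t))"
      using that interval_integral_eq_integral by blast
    also have "\<dots> = integral {u+t..v+t} g"
      using integral_shift_Icc_real[of u v g t] by (simp add: o_def add.commute)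
    finally show ?thesis
      using that lint_eq_integral[OF assms, of "u + t" "v + t"] by simp
  qed
  show ?thesis
  proof (cases "w \<le> x")
    case False
    then show ?thesis
      using *[of x w] interval_integral_endpoints_reverse[of "ereal w" "ereal x" "\<lambda>y. g (y + t)"]
        interval_integral_endpoints_reverse[of "ereal (w + t)" "ereal (x + t)" g]
      by linarith
  qed (use * in simp)
qed

lemma lint_mono:
  assumes "locally_integrable g" and "locally_integrable h" and "w \<le> x"
    and "\<And>y. w \<le> y \<Longrightarrow> y \<le> x \<Longrightarrow> g y \<le> h y"
  shows "lint w x g \<le> lint w x h"
proof -
  have "integral {w..x} g \<le> integral {w..x} h"
    by (rule integral_le) (use assms locally_integrable_imp_integrable_on in auto)
  then show ?thesis using assms by (simp add: lint_eq_integral)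
qed

lemma lint_cong:
  assumes "w \<le> x" and "\<And>y. w < y \<Longrightarrow> y < x \<Longrightarrow> g y = h y"
  shows "lint w x g = lint w x h"
  by (rule interval_integral_cong) (use assms in \<open>auto simp: einterval_iff min_def max_def\<close>)

lemma lint_mono_nonneg:
  assumes "locally_integrable g" and "x \<le> y" and "\<And>z. x \<le> z \<Longrightarrow> z \<le> y \<Longrightarrow> 0 \<le> g z"
  shows "lint w x g \<le> lint w y g"
proof -
  have "lint x y (\<lambda>_. 0) \<le> lint x y g"
    using assms by (intro lint_mono[OF locally_integrable_continuous[OF continuous_on_const]]) auto
  then show ?thesis using lint_combine[OF assms(1), of w x y] by simp
qed

lemma lint_pos:
  assumes "continuous_on UNIV g" and "w < x" and "\<And>y. g y > 0"
  shows "lint w x g > 0"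
proof -
  have "isCont g y" for y
    using assms(1) by (simp add: continuous_on_eq_continuous_at)
  then have "lint w w g < lint w x g"
    using assms lint_has_derivative[OF locally_integrable_continuous[OF assms(1)]]
    by (intro DERIV_pos_imp_increasing[OF assms(2)]) blast
  then show ?thesis by simp
qed

text \<open>
  The piece by which one window of length 1 sticks out on the left is a translate of the piece
  that is missing on the right, and oriented integrals make the two cancel without a case
  distinction.
\<close>

lemma lint_period:
  assumes "locally_integrable g" and "\<And>x. g (x + 1) = g x"
  shows "lint w (w + 1) g = lint 0 1 g"
proof -
  have "lint w (w + 1) g = lint w 0 g + lint 0 1 g + lint 1 (w + 1) g"
    using lint_combine[OF assms(1), of w 0 1] lint_combine[OF assms(1), of w 1 "w + 1"] by simp
  moreover have "lint 1 (w + 1) g = lint 0 w g"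
    using lint_shift[OF assms(1), of 0 1 w] assms(2) by simp
  moreover have "lint w 0 g + lint 0 w g = 0"
    using lint_combine[OF assms(1), of w 0 w] by simp
  ultimately show ?thesis by simp
qed

section \<open>Laplace asymptotics\<close>

lemma gaussian_integral:
  fixes \<kappa> :: real
  assumes "\<kappa> > 0"
  shows "integrable lborel (\<lambda>u. exp (- \<kappa> / 2 * u\<^sup>2))"
    and "integral\<^sup>L lborel (\<lambda>u. exp (- \<kappa> / 2 * u\<^sup>2)) = sqrt (2 * pi / \<kappa>)"
proof -
  define s where "s = 1 / sqrt \<kappa>"
  have s: "s > 0" "s\<^sup>2 = 1 / \<kappa>"
    using assms by (auto simp: s_def power_divide)
  have e: "exp (- \<kappa> / 2 * u\<^sup>2) = sqrt (2 * pi / \<kappa>) * normal_density 0 s u" for u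
    using assms s(1) by (simp add: normal_density_def s(2) field_simps)
  show "integrable lborel (\<lambda>u. exp (- \<kappa> / 2 * u\<^sup>2))"
    unfolding e using integrable_normal_density[OF s(1)] by simp
  show "integral\<^sup>L lborel (\<lambda>u. exp (- \<kappa> / 2 * u\<^sup>2)) = sqrt (2 * pi / \<kappa>)"
    unfolding e using integral_normal_density[OF s(1)] by simp
qed

text \<open>
  The substitution \<open>y = z + sqrt \<epsilon> * u\<close> turns the integral into one whose
  integrand tends to a Gaussian at every fixed \<open>u\<close>, because
  \<open>\<phi> (z + h)\<close> is \<open>- \<kappa> / 2 * h\<^sup>2\<close> to second order,
  and the quadratic upper bound on \<open>\<phi>\<close> supplies an integrable majorant.
\<close>

lemma laplace_single_peak:
  fixes \<phi> :: "real \<Rightarrow> real"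
  assumes cont: "continuous_on {z-\<delta>..z+\<delta>} \<phi>" and "\<delta> > 0" and "k > 0" and "\<kappa> > 0"
    and bound: "\<And>h. \<bar>h\<bar> \<le> \<delta> \<Longrightarrow> \<phi> (z + h) \<le> - k * h\<^sup>2"
    and zero: "\<phi> z = 0"
    and quad: "((\<lambda>h. \<phi> (z + h) / h\<^sup>2) \<longlongrightarrow> - \<kappa> / 2) (at 0)"
  shows "((\<lambda>\<epsilon>. (LINT y|lborel. indicator {z-\<delta>..z+\<delta>} y * exp (\<phi> y / \<epsilon>)) / sqrt \<epsilon>)
    \<longlongrightarrow> sqrt (2 * pi / \<kappa>)) (at_right 0)"
proof -
  define s where "s t = sqrt (inverse t)" for t :: real
  define f where "f t u = indicator {z-\<delta>..z+\<delta>} (z + s t * u) * exp (\<phi> (z + s t * u) * t)" for t u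
  have meas: "f t \<in> borel_measurable lborel" for t
  proof -
    have "continuous_on {z-\<delta>..z+\<delta>} (\<lambda>y. exp (\<phi> y * t))"
      by (intro continuous_intros cont)
    then have "(\<lambda>y. indicator {z-\<delta>..z+\<delta>} y *\<^sub>R exp (\<phi> y * t)) \<in> borel_measurable borel"
      by (intro borel_measurable_continuous_on_indicator) auto
    then have "(\<lambda>y. indicator {z-\<delta>..z+\<delta>} y * exp (\<phi> y * t)) \<in> borel_measurable borel"
      by simp
    from measurable_compose[OF _ this, of "\<lambda>u. z + s t * u" borel]
    show ?thesis unfolding f_def by simp
  qed
  have s0: "((\<lambda>t. s t * u) \<longlongrightarrow> 0) at_top" for u
    unfolding s_def by real_asymp
  have "((\<lambda>t. integral\<^sup>L lborel (f t)) \<longlongrightarrow>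
      integral\<^sup>L lborel (\<lambda>u. exp (- \<kappa> / 2 * u\<^sup>2))) at_top"
  proof (rule integral_dominated_convergence_at_top)
    show "integrable lborel (\<lambda>u. exp (- (2 * k) / 2 * u\<^sup>2))"
      using \<open>k > 0\<close> by (intro gaussian_integral) simp
    show "f t \<in> borel_measurable lborel" for t by (rule meas)
    show "AE u in lborel. ((\<lambda>t. f t u) \<longlongrightarrow> exp (- \<kappa> / 2 * u\<^sup>2)) at_top"
    proof (rule AE_I2)
      fix u :: real
      show "((\<lambda>t. f t u) \<longlongrightarrow> exp (- \<kappa> / 2 * u\<^sup>2)) at_top"
      proof (cases "u = 0")
        case True
        then show ?thesis using \<open>\<delta> > 0\<close> zero by (simp add: f_def)
      next
        case False
        have pos: "eventually (\<lambda>t. t > 0) (at_top :: real filter)"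
          by (rule eventually_gt_at_top)
        have "filterlim (\<lambda>t. s t * u) (at 0) at_top"
          unfolding filterlim_at using s0
          by (auto intro!: eventually_mono[OF pos] simp: s_def False)
        then have "((\<lambda>t. \<phi> (z + s t * u) / (s t * u)\<^sup>2) \<longlongrightarrow> - \<kappa> / 2) at_top"
          using filterlim_compose[OF quad] by fast
        then have "((\<lambda>t. exp (\<phi> (z + s t * u) / (s t * u)\<^sup>2 * u\<^sup>2)) \<longlongrightarrow> exp (- \<kappa> / 2 * u\<^sup>2)) at_top"
          by (intro tendsto_exp tendsto_mult_right)
        moreover have "eventually (\<lambda>t. f t u = exp (\<phi> (z + s t * u) / (s t * u)\<^sup>2 * u\<^sup>2)) at_top"
        proof -
          have "eventually (\<lambda>t. \<bar>s t * u\<bar> < \<delta>) at_top"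
            using s0[of u] \<open>\<delta> > 0\<close> by (simp add: tendsto_iff dist_real_def)
          with pos show ?thesis
            by eventually_elim (auto simp: f_def s_def power_mult_distrib False field_simps abs_if
                split: if_splits)
        qed
        ultimately show ?thesis
          using tendsto_cong by fast
      qed
    qed
    show "\<forall>\<^sub>F t in at_top. AE u in lborel. norm (f t u) \<le> exp (- (2 * k) / 2 * u\<^sup>2)"
      using eventually_gt_at_top[of "0::real"]
    proof eventually_elim
      case (elim t)
      have "norm (f t u) \<le> exp (- (2 * k) / 2 * u\<^sup>2)" for u
      proof (cases "\<bar>s t * u\<bar> \<le> \<delta>")
        case True
        have "\<phi> (z + s t * u) * t \<le> - k * (s t * u)\<^sup>2 * t"
          using bound[OF True] elim by (intro mult_right_mono) auto
        also have "\<dots> = - k * u\<^sup>2"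
          using elim by (simp add: s_def power_mult_distrib)
        finally have "exp (\<phi> (z + s t * u) * t) \<le> exp (- k * u\<^sup>2)"
          by simp
        then show ?thesis by (auto simp: f_def indicator_def)
      next
        case False
        then have "z + s t * u \<notin> {z-\<delta>..z+\<delta>}" by auto
        then show ?thesis by (simp add: f_def)
      qed
      then show ?case by simp
    qed
  qed auto
  then have "((\<lambda>t. integral\<^sup>L lborel (f t)) \<longlongrightarrow> sqrt (2 * pi / \<kappa>)) at_top"
    using gaussian_integral(2)[OF \<open>\<kappa> > 0\<close>] by simp
  moreover have "\<forall>\<^sub>F t in at_top. integral\<^sup>L lborel (f t) =
      (LINT y|lborel. indicator {z-\<delta>..z+\<delta>} y * exp (\<phi> y / inverse t)) / sqrt (inverse t)"
    using eventually_gt_at_top[of "0::real"]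
  proof eventually_elim
    case (elim t)
    then have "s t > 0" by (simp add: s_def)
    then have "(LINT y|lborel. indicator {z-\<delta>..z+\<delta>} y * exp (\<phi> y / inverse t)) = s t * integral\<^sup>L lborel (f t)"
      using lborel_integral_real_affine[of "s t" "\<lambda>y. indicator {z-\<delta>..z+\<delta>} y * exp (\<phi> y / inverse t)" z]
      by (simp add: f_def[abs_def] divide_inverse)
    with \<open>s t > 0\<close> show ?case by (simp add: s_def)
  qed
  ultimately show ?thesis
    unfolding filterlim_at_right_to_top using tendsto_cong by fast
qed

lemma exp_neg_inverse_over_power:
  fixes \<eta> :: real
  assumes "\<eta> > 0"
  shows "((\<lambda>\<epsilon>. exp (- \<eta> / \<epsilon>) / \<epsilon>) \<longlongrightarrow> 0) (at_right 0)"
    and "((\<lambda>\<epsilon>. exp (- \<eta> / \<epsilon>) / sqrt \<epsilon>) \<longlongrightarrow> 0) (at_right 0)"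
proof -
  show 1: "((\<lambda>\<epsilon>. exp (- \<eta> / \<epsilon>) / \<epsilon>) \<longlongrightarrow> 0) (at_right 0)"
    using assms by real_asymp
  show "((\<lambda>\<epsilon>. exp (- \<eta> / \<epsilon>) / sqrt \<epsilon>) \<longlongrightarrow> 0) (at_right 0)"
    using assms by real_asymp
qed

lemma tendsto_quadratic_quotient:
  fixes \<phi> \<phi>' :: "real \<Rightarrow> real"
  assumes "\<And>x. (\<phi> has_real_derivative \<phi>' x) (at x)" and "(\<phi>' has_real_derivative D) (at z)"
    and "\<phi> z = 0" and "\<phi>' z = 0"
  shows "((\<lambda>h. \<phi> (z + h) / h\<^sup>2) \<longlongrightarrow> D / 2) (at 0)"
proof (rule lhopital)
  have "isCont \<phi> z" using assms(1) DERIV_isCont by blast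
  then show "((\<lambda>h. \<phi> (z + h)) \<longlongrightarrow> 0) (at 0)"
    using assms(3) by (simp add: isCont_def LIM_offset_zero_iff)
  show "((\<lambda>h::real. h\<^sup>2) \<longlongrightarrow> 0) (at 0)"
    by (auto intro!: tendsto_eq_intros)
  show "\<forall>\<^sub>F h in at 0. h\<^sup>2 \<noteq> (0::real)"
    by (simp add: eventually_at_filter)
  show "\<forall>\<^sub>F h in at 0. 2 * h \<noteq> (0::real)"
    by (simp add: eventually_at_filter)
  show "\<forall>\<^sub>F h in at 0. ((\<lambda>h. \<phi> (z + h)) has_real_derivative \<phi>' (z + h)) (at h)"
    by (intro always_eventually allI)
      (use assms(1) in \<open>simp add: DERIV_shift[of \<phi>, symmetric] add.commute[of z]\<close>)
  show "\<forall>\<^sub>F h in at 0. ((\<lambda>h. h\<^sup>2) has_real_derivative 2 * h) (at (h::real))"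
    by (auto intro!: always_eventually derivative_eq_intros)
  have "((\<lambda>h. (\<phi>' (z + h) - \<phi>' z) / h) \<longlongrightarrow> D) (at 0)"
    using assms(2) by (simp add: DERIV_def)
  then have "((\<lambda>h. (\<phi>' (z + h) / h) / 2) \<longlongrightarrow> D / 2) (at 0)"
    using assms(4) by (intro tendsto_divide) auto
  then show "((\<lambda>h. \<phi>' (z + h) / (2 * h)) \<longlongrightarrow> D / 2) (at 0)"
    by (simp add: field_simps)
qed

text \<open>
  At a critical point \<open>\<phi> (z + h) - \<phi> z\<close> is
  \<open>D / 2 * h\<^sup>2\<close> to second order; at a maximum these quotients are
  nonpositive, which leaves only the negative sign for a nonzero \<open>D\<close>.
\<close>

lemma loc_max_derivatives:
  fixes \<phi> \<phi>' :: "real \<Rightarrow> real"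
  assumes deriv: "\<And>x. (\<phi> has_real_derivative \<phi>' x) (at x)" and "loc_max \<phi> z"
    and "(\<phi>' has_real_derivative D) (at z)" and "D \<noteq> 0"
  shows "\<phi>' z = 0" and "D < 0"
proof -
  have max: "\<forall>\<^sub>F y in nhds z. \<phi> y \<le> \<phi> z"
    using assms(2) by (simp add: loc_max_def)
  then obtain d where "d > 0" "\<And>y. \<bar>z - y\<bar> < d \<Longrightarrow> \<phi> y \<le> \<phi> z"
    by (auto simp: eventually_nhds_metric dist_real_def abs_minus_commute)
  then show crit: "\<phi>' z = 0"
    by (intro DERIV_local_max[OF deriv, of d z]) auto
  have "((\<lambda>h. (\<phi> (z + h) - \<phi> z) / h\<^sup>2) \<longlongrightarrow> D / 2) (at 0)"
    by (rule tendsto_quadratic_quotient[where \<phi> = "\<lambda>x. \<phi> x - \<phi> z" and \<phi>' = \<phi>'])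
      (use assms crit DERIV_diff[OF deriv DERIV_const] in auto)
  moreover have "((\<lambda>h. z + h) \<longlongrightarrow> z) (at 0)"
    by (auto intro!: tendsto_eq_intros)
  then have "\<forall>\<^sub>F h in at 0. \<phi> (z + h) \<le> \<phi> z"
    using max by (rule eventually_compose_filterlim[rotated])
  then have "\<forall>\<^sub>F h in at 0. (\<phi> (z + h) - \<phi> z) / h\<^sup>2 \<le> 0"
    by (auto simp: divide_nonpos_nonneg elim!: eventually_mono)
  ultimately have "D / 2 \<le> 0"
    by (rule tendsto_upperbound) simp
  then show "D < 0" using assms(4) by simp
qed

text \<open>
  Cut out disjoint intervals around the zeros of \<open>\<phi>\<close>: each of them contributes
  its own Gaussian integral, and on the compact remainder \<open>\<phi>\<close> is bounded away
  from zero, so that the remainder is exponentially small.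
\<close>

lemma laplace_finitely_many_peaks:
  fixes \<phi> \<phi>' D :: "real \<Rightarrow> real"
  assumes deriv: "\<And>x. (\<phi> has_real_derivative \<phi>' x) (at x)"
    and nonpos: "\<And>x. a \<le> x \<Longrightarrow> x \<le> c \<Longrightarrow> \<phi> x \<le> 0"
    and ends: "\<phi> a < 0" "\<phi> c < 0" and "a \<le> c"
    and fin: "finite {x. a \<le> x \<and> x \<le> c \<and> \<phi> x = 0}"
    and deriv2: "\<And>z. a \<le> z \<Longrightarrow> z \<le> c \<Longrightarrow> \<phi> z = 0 \<Longrightarrow> (\<phi>' has_real_derivative D z) (at z) \<and> D z \<noteq> 0"
  shows "((\<lambda>\<epsilon>. lint a c (\<lambda>y. exp (\<phi> y / \<epsilon>)) / sqrt \<epsilon>)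
    \<longlongrightarrow> (\<Sum>z\<in>{x. a \<le> x \<and> x \<le> c \<and> \<phi> x = 0}. sqrt (2 * pi / - D z))) (at_right 0)"
proof -
  define Z where "Z = {x. a \<le> x \<and> x \<le> c \<and> \<phi> x = 0}"
  have cont: "continuous_on A \<phi>" for A
    using deriv by (meson DERIV_isCont continuous_at_imp_continuous_on)
  have Z: "a < z" "z < c" "\<phi> z = 0" "(\<phi>' has_real_derivative D z) (at z)" "D z \<noteq> 0"
    if "z \<in> Z" for z
    using that ends deriv2[of z] by (auto simp: Z_def order.strict_iff_order)
  have near: "\<forall>\<^sub>F x in nhds z. \<phi> x \<le> 0" if "z \<in> Z" for z
  proof -
    have "\<forall>\<^sub>F x in nhds z. x \<in> {a<..<c}"
      using Z[OF that] by (intro eventually_nhds_in_open) auto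
    then show ?thesis by eventually_elim (auto intro: nonpos)
  qed
  have max: "loc_max \<phi> z" if "z \<in> Z" for z
    using near[OF that] Z(3)[OF that] by (simp add: loc_max_def)
  have crit: "\<phi>' z = 0" and D: "D z < 0" if "z \<in> Z" for z
    using loc_max_derivatives[OF deriv max Z(4,5)] that by auto
  have quad: "((\<lambda>h. \<phi> (z + h) / h\<^sup>2) \<longlongrightarrow> D z / 2) (at 0)" if "z \<in> Z" for z
    by (rule tendsto_quadratic_quotient[OF deriv Z(4)[OF that] Z(3)[OF that] crit[OF that]])
  have "\<forall>\<^sub>F \<delta> in at_right 0. (\<forall>h. \<bar>h\<bar> \<le> \<delta> \<longrightarrow> \<phi> (z + h) \<le> D z / 4 * h\<^sup>2) \<and> a < z - \<delta> \<and> z + \<delta> < c"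
    if "z \<in> Z" for z
  proof -
    have "\<forall>\<^sub>F h in at 0. \<phi> (z + h) / h\<^sup>2 < D z / 4"
      using order_tendstoD(2)[OF quad[OF that], of "D z / 4"] D[OF that] by simp
    then obtain d where d: "d > 0" "\<And>h. h \<noteq> 0 \<Longrightarrow> \<bar>h\<bar> < d \<Longrightarrow> \<phi> (z + h) / h\<^sup>2 < D z / 4"
      by (auto simp: eventually_at dist_real_def)
    have "\<phi> (z + h) \<le> D z / 4 * h\<^sup>2" if "\<bar>h\<bar> < d" for h
      using d(2)[of h] that Z(3)[OF \<open>z \<in> Z\<close>] by (cases "h = 0") (auto simp: field_simps)
    moreover have "\<forall>\<^sub>F \<delta> in at_right 0. \<delta> < d \<and> \<delta> < z - a \<and> \<delta> < c - z"
      unfolding eventually_at_right_field using d(1) Z(1,2)[OF that]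
      by (intro exI[of _ "min d (min (z - a) (c - z))"]) auto
    ultimately show ?thesis by (auto elim!: eventually_mono)
  qed
  then have "\<forall>\<^sub>F \<delta> in at_right 0. \<forall>z\<in>Z.
      (\<forall>h. \<bar>h\<bar> \<le> \<delta> \<longrightarrow> \<phi> (z + h) \<le> D z / 4 * h\<^sup>2) \<and> a < z - \<delta> \<and> z + \<delta> < c"
    using fin by (intro eventually_ball_finite) (auto simp: Z_def)
  then have "\<forall>\<^sub>F \<delta> in at_right 0. 0 < \<delta> \<and> (\<forall>z\<in>Z.
      (\<forall>h. \<bar>h\<bar> \<le> \<delta> \<longrightarrow> \<phi> (z + h) \<le> D z / 4 * h\<^sup>2) \<and> a < z - \<delta> \<and> z + \<delta> < c)"
    using eventually_at_right_less[of "0::real"] by eventually_elim simp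
  then obtain \<delta> where "0 < \<delta> \<and> (\<forall>z\<in>Z.
      (\<forall>h. \<bar>h\<bar> \<le> \<delta> \<longrightarrow> \<phi> (z + h) \<le> D z / 4 * h\<^sup>2) \<and> a < z - \<delta> \<and> z + \<delta> < c)"
    using eventually_happens by force
  then have \<delta>: "\<delta> > 0"
      "\<And>z h. z \<in> Z \<Longrightarrow> \<bar>h\<bar> \<le> \<delta> \<Longrightarrow> \<phi> (z + h) \<le> D z / 4 * h\<^sup>2"
      "\<And>z. z \<in> Z \<Longrightarrow> a < z - \<delta> \<and> z + \<delta> < c"
    by auto
  \<comment> \<open>distinct zeros are more than \<open>\<delta>\<close> apart, so closed intervals of radius \<open>\<delta> / 3\<close> around them are disjoint\<close>
  define r where "r = \<delta> / 3"
  define P where "P z = {z - r..z + r}" for z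
  have r: "0 < r" "r \<le> \<delta>" using \<delta>(1) by (auto simp: r_def)
  have far: "\<bar>z - z'\<bar> > \<delta>" if "z \<in> Z" "z' \<in> Z" "z \<noteq> z'" for z z'
  proof (rule ccontr)
    assume "\<not> \<delta> < \<bar>z - z'\<bar>"
    then have "\<phi> (z + (z' - z)) \<le> D z / 4 * (z' - z)\<^sup>2"
      by (intro \<delta>(2) that) auto
    also have "\<dots> < 0"
      using D[OF that(1)] that(3) by (intro mult_neg_pos) auto
    finally show False using Z(3)[OF that(2)] by simp
  qed
  define R where "R = {a..c} - (\<Union>z\<in>Z. {z - r<..<z + r})"
  have "compact R"
    unfolding R_def by (intro compact_diff) auto
  have "\<exists>\<eta>>0. \<forall>x\<in>R. \<phi> x \<le> - \<eta>"
  proof (cases "R = {}")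
    case False
    then obtain x where x: "x \<in> R" "\<And>y. y \<in> R \<Longrightarrow> \<phi> y \<le> \<phi> x"
      using continuous_attains_sup[OF \<open>compact R\<close> _ cont] by blast
    have "x \<notin> Z" using x(1) r(1) by (auto simp: R_def)
    then have "\<phi> x < 0" using x(1) nonpos[of x] by (auto simp: R_def Z_def)
    then show ?thesis using x(2) by (intro exI[of _ "- \<phi> x"]) auto
  qed (auto intro: exI[of _ 1])
  then obtain \<eta> where \<eta>: "\<eta> > 0" "\<And>x. x \<in> R \<Longrightarrow> \<phi> x \<le> - \<eta>" by blast

  define Q where "Q = {a..c} - (\<Union>z\<in>Z. P z)"
  have QR: "Q \<subseteq> R" by (force simp: Q_def R_def P_def)
  have finZ: "finite Z" using fin by (simp add: Z_def)
  have split: "indicator {a..c} y = (\<Sum>z\<in>Z. indicator (P z) y) + (indicator Q y :: real)" for y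
  proof -
    have "disjoint_family_on P Z"
      unfolding disjoint_family_on_def
    proof (intro ballI impI)
      fix z z' assume "z \<in> Z" "z' \<in> Z" "z \<noteq> z'"
      then have "\<bar>z - z'\<bar> > 3 * r" using far by (simp add: r_def)
      with r(1) show "P z \<inter> P z' = {}" by (auto simp: P_def)
    qed
    then have "(\<Sum>z\<in>Z. indicator (P z) y) = (indicator (\<Union>z\<in>Z. P z) y :: real)"
      by (simp add: indicator_UN_disjoint[OF finZ])
    moreover have "(\<Union>z\<in>Z. P z) \<subseteq> {a..c}"
      using \<delta>(3) r by (force simp: P_def)
    ultimately show ?thesis by (auto simp: Q_def indicator_def)
  qed
  have meas: "Q \<in> sets lborel" "\<And>z. P z \<in> sets lborel"
    unfolding Q_def P_def using finZ by (auto intro!: sets.Diff sets.finite_UN)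
  have main: "((\<lambda>\<epsilon>. \<Sum>z\<in>Z. (LINT y|lborel. indicator (P z) y * exp (\<phi> y / \<epsilon>)) / sqrt \<epsilon>)
      \<longlongrightarrow> (\<Sum>z\<in>Z. sqrt (2 * pi / - D z))) (at_right 0)"
  proof (rule tendsto_sum)
    fix z assume z: "z \<in> Z"
    show "((\<lambda>\<epsilon>. (LINT y|lborel. indicator (P z) y * exp (\<phi> y / \<epsilon>)) / sqrt \<epsilon>)
        \<longlongrightarrow> sqrt (2 * pi / - D z)) (at_right 0)"
      unfolding P_def
    proof (rule laplace_single_peak)
      show "\<phi> (z + h) \<le> - (- D z / 4) * h\<^sup>2" if "\<bar>h\<bar> \<le> r" for h
        using \<delta>(2)[OF z, of h] that r by simp
    qed (use r z D Z quad cont in auto)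
  qed
  have rest: "((\<lambda>\<epsilon>. (LINT y|lborel. indicator Q y * exp (\<phi> y / \<epsilon>)) / sqrt \<epsilon>) \<longlongrightarrow> 0) (at_right 0)"
  proof (rule tendsto_sandwich)
    show "\<forall>\<^sub>F \<epsilon> in at_right 0. 0 \<le> (LINT y|lborel. indicator Q y * exp (\<phi> y / \<epsilon>)) / sqrt \<epsilon>"
      using eventually_at_right_less[of 0]
      by eventually_elim (auto intro!: divide_nonneg_nonneg Bochner_Integration.integral_nonneg)
    show "\<forall>\<^sub>F \<epsilon> in at_right 0. (LINT y|lborel. indicator Q y * exp (\<phi> y / \<epsilon>)) / sqrt \<epsilon>
        \<le> (c - a) * (exp (- \<eta> / \<epsilon>) / sqrt \<epsilon>)"
      using eventually_at_right_less[of 0]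
    proof eventually_elim
      case (elim \<epsilon>)
      have "(LINT y|lborel. indicator Q y * exp (\<phi> y / \<epsilon>)) \<le> (LINT y|lborel. indicator {a..c} y * exp (- \<eta> / \<epsilon>))"
      proof (rule integral_mono')
        show "integrable lborel (\<lambda>y. indicator {a..c} y * exp (- \<eta> / \<epsilon>))"
          using \<open>a \<le> c\<close> by (auto intro!: integrable_mult_left integrable_real_indicator)
        show "indicator Q y * exp (\<phi> y / \<epsilon>) \<le> indicator {a..c} y * exp (- \<eta> / \<epsilon>)" for y
        proof (cases "y \<in> Q")
          case True
          then have "\<phi> y \<le> - \<eta>" "y \<in> {a..c}"
            using \<eta>(2)[of y] QR by (auto simp: Q_def)
          then have "\<phi> y / \<epsilon> \<le> - \<eta> / \<epsilon>" "y \<in> {a..c}"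
            using elim by (auto intro: divide_right_mono simp del: divide_minus_left)
          then show ?thesis using True by simp
        qed auto
      qed auto
      also have "\<dots> = (c - a) * exp (- \<eta> / \<epsilon>)" using \<open>a \<le> c\<close> by simp
      finally show ?case using elim by (simp add: divide_right_mono)
    qed
    show "((\<lambda>\<epsilon>. (c - a) * (exp (- \<eta> / \<epsilon>) / sqrt \<epsilon>)) \<longlongrightarrow> 0) (at_right 0)"
      by (intro tendsto_mult_right_zero exp_neg_inverse_over_power(2) \<eta>(1))
  qed simp
  have eq: "lint a c (\<lambda>y. exp (\<phi> y / \<epsilon>)) / sqrt \<epsilon> =
      (\<Sum>z\<in>Z. (LINT y|lborel. indicator (P z) y * exp (\<phi> y / \<epsilon>)) / sqrt \<epsilon>)
        + (LINT y|lborel. indicator Q y * exp (\<phi> y / \<epsilon>)) / sqrt \<epsilon>" for \<epsilon>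
  proof -
    have "continuous_on {a..c} (\<lambda>y. exp (\<phi> y / \<epsilon>))"
      unfolding divide_inverse by (intro continuous_intros cont)
    then have i: "integrable lborel (\<lambda>y. indicator {a..c} y * exp (\<phi> y / \<epsilon>))"
      using borel_integrable_atLeastAtMost'[of a c "\<lambda>y. exp (\<phi> y / \<epsilon>)"]
      by (simp add: set_integrable_def)
    have sub: "integrable lborel (\<lambda>y. indicator A y * exp (\<phi> y / \<epsilon>))"
      if "A \<in> sets lborel" "A \<subseteq> {a..c}" for A
    proof -
      have "(\<lambda>y. indicator A y *\<^sub>R (indicator {a..c} y * exp (\<phi> y / \<epsilon>)))
          = (\<lambda>y. indicator A y * exp (\<phi> y / \<epsilon>))"
        using that(2) by (auto simp: indicator_def fun_eq_iff)
      with integrable_mult_indicator[OF that(1) i] show ?thesis by simp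
    qed
    have iP: "integrable lborel (\<lambda>y. indicator (P z) y * exp (\<phi> y / \<epsilon>))" if "z \<in> Z" for z
      using \<delta>(3)[OF that] r by (intro sub meas) (auto simp: P_def)
    have iQ: "integrable lborel (\<lambda>y. indicator Q y * exp (\<phi> y / \<epsilon>))"
      by (intro sub meas) (auto simp: Q_def)
    have "lint a c (\<lambda>y. exp (\<phi> y / \<epsilon>)) = (LINT y|lborel. indicator {a..c} y * exp (\<phi> y / \<epsilon>))"
      using \<open>a \<le> c\<close> by (simp add: interval_integral_Icc set_lebesgue_integral_def)
    also have "\<dots> = (\<Sum>z\<in>Z. (LINT y|lborel. indicator (P z) y * exp (\<phi> y / \<epsilon>)))
        + (LINT y|lborel. indicator Q y * exp (\<phi> y / \<epsilon>))"
      using iP iQ by (simp add: split distrib_right sum_distrib_right)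
    finally show ?thesis by (simp add: add_divide_distrib sum_divide_distrib)
  qed
  show ?thesis
    unfolding eq Z_def[symmetric] using tendsto_add[OF main rest] by simp
qed

section \<open>The potential and the explicit solution\<close>

locale drift =
  fixes b :: "real \<Rightarrow> real"
  assumes admissible: "admissible_drift b"
begin

lemma b_periodic: "b (x + 1) = b x"
  and b_deriv: "(b has_real_derivative deriv b x) (at x)"
  and b_nondegenerate: "b x = 0 \<Longrightarrow> deriv b x \<noteq> 0"
  and b_finite: "finite {x \<in> {0..<1}. b x = 0}"
  and B_pos: "B b > 0"
  using admissible
  by (auto simp: admissible_drift_def B_def differentiable_on_def DERIV_deriv_iff_real_differentiable)

lemma b_periodic_int: "b (x + of_int r) = b x"
proof (induction r arbitrary: x rule: int_induct[where k = 0])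
  case (step1 i)
  then show ?case using b_periodic[of "x + of_int i"] by (simp add: add.assoc)
next
  case (step2 i)
  then show ?case using b_periodic[of "x + of_int (i - 1)"] by simp
qed simp

lemma b_continuous: "continuous_on A b"
  using b_deriv by (meson DERIV_isCont continuous_at_imp_continuous_on)

lemma b_locally_integrable: "locally_integrable b"
  using b_continuous locally_integrable_continuous by blast

lemma S_deriv: "(S b has_real_derivative - b x) (at x)"
proof -
  have "((\<lambda>u. lint 0 u b) has_real_derivative b x) (at x)"
    using b_locally_integrable b_continuous[of UNIV]
    by (intro lint_has_derivative) (auto simp: continuous_on_eq_continuous_at)
  then show ?thesis
    unfolding S_def[abs_def] using DERIV_minus by (fastforce simp: zero_ereal_def)
qed

lemma S_deriv_chain [derivative_intros]:
  "(g has_real_derivative D) (at x within A)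
    \<Longrightarrow> ((\<lambda>x. S b (g x)) has_real_derivative - b (g x) * D) (at x within A)"
  using DERIV_chain2[OF S_deriv] by blast

lemma S_deriv2: "deriv (deriv (S b)) x = - deriv b x"
proof -
  have "deriv (S b) = (\<lambda>x. - b x)"
    using S_deriv DERIV_imp_deriv by blast
  then show ?thesis
    using DERIV_imp_deriv[OF DERIV_minus[OF b_deriv]] by simp
qed

lemma S_continuous: "continuous_on A (S b)"
  using S_deriv by (meson DERIV_isCont continuous_at_imp_continuous_on)

lemma S_continuous_comp [continuous_intros]:
  "continuous_on A g \<Longrightarrow> continuous_on A (\<lambda>x. S b (g x))"
  using continuous_on_compose2[OF S_continuous[of UNIV]] by blast

lemma S_add_1: "S b (x + 1) = S b x - B b"
proof -
  have "lint 0 (x + 1) b = lint 0 1 b + lint 1 (x + 1) b"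
    by (rule lint_combine[OF b_locally_integrable, symmetric])
  also have "lint 1 (x + 1) b = lint 0 x b"
    using lint_shift[OF b_locally_integrable, of 0 1 x] b_periodic by simp
  finally show ?thesis
    by (simp add: S_def B_def zero_ereal_def one_ereal_def)
qed

lemma S_add_int: "S b (x + of_int r) = S b x - of_int r * B b"
proof (induction r arbitrary: x rule: int_induct[where k = 0])
  case (step1 i)
  have "S b (x + of_int (i + 1)) = S b (x + of_int i + 1)"
    by (simp add: add.assoc)
  then show ?case
    unfolding S_add_1 step1.IH by (simp add: algebra_simps)
next
  case (step2 i)
  have "S b (x + of_int i) = S b (x + of_int (i - 1) + 1)"
    by simp
  then show ?case
    unfolding S_add_1 step2.IH by (simp add: algebra_simps)
qed simp

lemma finite_zeros: "finite {x. a \<le> x \<and> x \<le> c \<and> b x = 0}"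
proof -
  have "{x. a \<le> x \<and> x \<le> c \<and> b x = 0}
      \<subseteq> (\<lambda>(x, r). x + of_int r) ` ({x \<in> {0..<1}. b x = 0} \<times> {\<lfloor>a\<rfloor>..\<lfloor>c\<rfloor>})"
  proof
    fix x assume x: "x \<in> {x. a \<le> x \<and> x \<le> c \<and> b x = 0}"
    have "x = frac x + of_int \<lfloor>x\<rfloor>" by (simp add: frac_def)
    moreover from this have "b (frac x) = 0"
      using x b_periodic_int[of "frac x" "\<lfloor>x\<rfloor>"] by simp
    moreover have "frac x \<in> {0..<1}" by (simp add: frac_lt_1)
    moreover have "\<lfloor>x\<rfloor> \<in> {\<lfloor>a\<rfloor>..\<lfloor>c\<rfloor>}" using x by (auto intro: floor_mono)
    ultimately show "x \<in> (\<lambda>(x, r). x + of_int r) ` ({x \<in> {0..<1}. b x = 0} \<times> {\<lfloor>a\<rfloor>..\<lfloor>c\<rfloor>})"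
      by (intro image_eqI[of _ _ "(frac x, \<lfloor>x\<rfloor>)"]) auto
  qed
  then show ?thesis
    by (rule finite_subset) (use b_finite in auto)
qed

lemma exp_S_continuous: "continuous_on A (\<lambda>y. exp (S b y / \<epsilon>))" "continuous_on A (\<lambda>y. exp (- S b y / \<epsilon>))"
  unfolding divide_inverse by (intro continuous_intros)+

lemma exp_S_locally_integrable: "locally_integrable (\<lambda>y. exp (S b y / \<epsilon>))"
  using exp_S_continuous locally_integrable_continuous by blast

lemma exp_S_add_1: "exp (S b (y + 1) / \<epsilon>) = exp (- B b / \<epsilon>) * exp (S b y / \<epsilon>)"
  "exp (- S b (y + 1) / \<epsilon>) = exp (B b / \<epsilon>) * exp (- S b y / \<epsilon>)"
  unfolding S_add_1 by (simp_all add: exp_add[symmetric] diff_divide_distrib)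

text \<open>
  With a bounded right-hand side the explicit formula makes sense on the whole line, and there it is
  already periodic as soon as it takes the same value at both ends of one period: the constant
  \<open>a(\<epsilon>)\<close> is the one for which its derivative is periodic.
\<close>

context
  fixes \<epsilon> w D :: real and g :: "real \<Rightarrow> real"
  assumes \<epsilon>: "\<epsilon> > 0" and g_meas: "g \<in> borel_measurable borel"
    and g_bound: "\<And>x. \<bar>g x\<bar> \<le> D" and g_periodic: "\<And>x. g (x + 1) = g x"
begin

definition primitive :: "real \<Rightarrow> real" where
  "primitive y = lint w y (\<lambda>z. g z * exp (- S b z / \<epsilon>))"

definition slope :: "real \<Rightarrow> real" where
  "slope y = exp (S b y / \<epsilon>) * (a_eps b \<epsilon> w g + 1 / \<epsilon> * exp (- H b / \<epsilon>) * primitive y)"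

lemma weighted_locally_integrable: "locally_integrable (\<lambda>z. g z * exp (- S b z / \<epsilon>))"
  using g_meas g_bound exp_S_continuous(2) by (rule locally_integrable_bounded_mult)

lemma primitive_continuous: "continuous_on A primitive"
  unfolding primitive_def[abs_def]
  by (intro continuous_at_imp_continuous_on ballI lint_continuous weighted_locally_integrable)

lemma slope_continuous: "continuous_on A slope"
  unfolding slope_def[abs_def] by (intro continuous_intros primitive_continuous exp_S_continuous)

lemma f_formula_eq_lint_slope: "f_formula b \<epsilon> w c g x = c + lint w x slope"
proof -
  have 1: "locally_integrable (\<lambda>y. exp (S b y / \<epsilon>) * primitive y)"
    by (intro locally_integrable_continuous continuous_intros exp_S_continuous primitive_continuous)
  have "slope = (\<lambda>y. a_eps b \<epsilon> w g * exp (S b y / \<epsilon>)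
      + 1 / \<epsilon> * exp (- H b / \<epsilon>) * (exp (S b y / \<epsilon>) * primitive y))"
    by (simp add: slope_def fun_eq_iff algebra_simps)
  then have "lint w x slope = a_eps b \<epsilon> w g * lint w x (\<lambda>y. exp (S b y / \<epsilon>))
      + 1 / \<epsilon> * exp (- H b / \<epsilon>) * lint w x (\<lambda>y. exp (S b y / \<epsilon>) * primitive y)"
    by (simp only: lint_add(2)[OF exp_S_locally_integrable 1])
  then show ?thesis
    by (simp add: f_formula_def primitive_def)
qed

lemma f_formula_deriv: "(f_formula b \<epsilon> w c g has_real_derivative slope x) (at x)"
proof -
  have "((\<lambda>x. c + lint w x slope) has_real_derivative 0 + slope x) (at x)"
    using slope_continuous[of UNIV]
    by (intro DERIV_add DERIV_const lint_has_derivative locally_integrable_continuous)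
      (auto simp: continuous_on_eq_continuous_at)
  then show ?thesis
    by (simp add: f_formula_eq_lint_slope[abs_def])
qed

lemma primitive_add_1: "primitive (y + 1) = primitive (w + 1) + exp (B b / \<epsilon>) * primitive y"
proof -
  have "primitive (y + 1) = primitive (w + 1) + lint (w + 1) (y + 1) (\<lambda>z. g z * exp (- S b z / \<epsilon>))"
    unfolding primitive_def by (rule lint_combine[OF weighted_locally_integrable, symmetric])
  also have "lint (w + 1) (y + 1) (\<lambda>z. g z * exp (- S b z / \<epsilon>))
      = lint w y (\<lambda>z. exp (B b / \<epsilon>) * (g z * exp (- S b z / \<epsilon>)))"
    unfolding lint_shift[OF weighted_locally_integrable]
    by (simp only: exp_S_add_1 g_periodic mult.left_commute)
  finally show ?thesis by (simp add: primitive_def)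
qed

lemma a_eps_eq: "a_eps b \<epsilon> w g = 1 / \<epsilon> * exp (- H b / \<epsilon>) * primitive (w + 1) / (exp (B b / \<epsilon>) - 1)"
  by (simp add: a_eps_def primitive_def add.commute)

lemma exp_B_gt_1: "exp (B b / \<epsilon>) > 1"
  using B_pos \<epsilon> by simp

lemma slope_periodic: "slope (y + 1) = slope y"
proof -
  define e where "e = exp (B b / \<epsilon>)"
  have e: "e > 1" "exp (- B b / \<epsilon>) = 1 / e"
    using exp_B_gt_1 exp_minus[of "B b / \<epsilon>"] by (simp_all add: e_def inverse_eq_divide)
  define c where "c = 1 / \<epsilon> * exp (- H b / \<epsilon>)"
  have a: "a_eps b \<epsilon> w g = c * primitive (w + 1) / (e - 1)"
    by (simp add: a_eps_eq c_def e_def)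
  have a': "(e - 1) * a_eps b \<epsilon> w g = c * primitive (w + 1)"
    using e(1) by (simp add: a)
  have "a_eps b \<epsilon> w g + c * primitive (w + 1) = e * a_eps b \<epsilon> w g"
    unfolding a'[symmetric] by (simp add: algebra_simps)
  then have "a_eps b \<epsilon> w g + c * primitive (y + 1) = e * (a_eps b \<epsilon> w g + c * primitive y)"
    unfolding primitive_add_1[of y] e_def[symmetric] by (simp add: algebra_simps)
  then have "slope (y + 1) = exp (- B b / \<epsilon>) * exp (S b y / \<epsilon>) * (e * (a_eps b \<epsilon> w g + c * primitive y))"
    unfolding slope_def exp_S_add_1 c_def[symmetric] by (simp only:)
  then show ?thesis
    unfolding slope_def c_def[symmetric] e(2) using e(1) by simp
qed

lemma f_formula_add_1:
  "f_formula b \<epsilon> w c g (x + 1) - f_formula b \<epsilon> w c g x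
    = f_formula b \<epsilon> w c g (w + 1) - f_formula b \<epsilon> w c g w"
proof -
  have "((\<lambda>x. f_formula b \<epsilon> w c g (x + 1) - f_formula b \<epsilon> w c g x) has_real_derivative 0) (at x)" for x
  proof -
    have "((\<lambda>x. f_formula b \<epsilon> w c g (x + 1)) has_real_derivative slope (x + 1)) (at x)"
      using f_formula_deriv[of c "x + 1"] DERIV_shift by blast
    from DERIV_diff[OF this f_formula_deriv[of c x]] show ?thesis
      by (simp add: slope_periodic)
  qed
  then show ?thesis
    using DERIV_const_ratio_const[of w x "\<lambda>x. f_formula b \<epsilon> w c g (x + 1) - f_formula b \<epsilon> w c g x" 0]
    by (cases "x = w") auto
qed

text \<open>
  A periodic function is its own periodic extension. Differentiating twice gives
  \<open>\<epsilon> f'' = - b f' + exp (- H / \<epsilon>) g\<close> wherever \<open>g\<close> is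
  continuous, since the derivative of \<open>exp (S / \<epsilon>)\<close> is
  \<open>- b / \<epsilon>\<close> times itself.
\<close>

lemma solves_elliptic_f_formula:
  assumes "f_formula b \<epsilon> w c g (w + 1) = f_formula b \<epsilon> w c g w"
  shows "periodic_ext w (f_formula b \<epsilon> w c g) = f_formula b \<epsilon> w c g"
    and "solves_elliptic b \<epsilon> (f_formula b \<epsilon> w c g) g"
proof -
  let ?f = "f_formula b \<epsilon> w c g"
  have per: "?f (x + 1) = ?f x" for x
    using f_formula_add_1[of c x] assms by simp
  have per_int: "?f (x + of_int r) = ?f x" for x r
  proof (induction r arbitrary: x rule: int_induct[where k = 0])
    case (step1 i)
    then show ?case using per[of "x + of_int i"] by (simp add: add.assoc)
  next
    case (step2 i)
    then show ?case using per[of "x + of_int (i - 1)"] by simp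
  qed simp
  show "periodic_ext w ?f = ?f"
    using per_int[of _ "- _"] by (simp add: periodic_ext_def fun_eq_iff)
  have deriv: "deriv ?f = slope"
    using f_formula_deriv DERIV_imp_deriv by blast
  show "solves_elliptic b \<epsilon> ?f g"
    unfolding solves_elliptic_def deriv
  proof (intro conjI allI impI)
    show "?f differentiable_on UNIV"
      using f_formula_deriv
      by (meson differentiable_at_withinI differentiable_on_def real_differentiable_def)
    fix x assume "isCont g x"
    have "isCont (\<lambda>z. exp (- S b z / \<epsilon>)) x"
      using exp_S_continuous(2)[of UNIV] by (simp add: continuous_on_eq_continuous_at)
    with \<open>isCont g x\<close> have "(primitive has_real_derivative g x * exp (- S b x / \<epsilon>)) (at x)"
      unfolding primitive_def[abs_def]
      by (intro lint_has_derivative weighted_locally_integrable isCont_mult)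
    then have "(slope has_real_derivative
        - b x / \<epsilon> * slope x + exp (S b x / \<epsilon>) *
          (1 / \<epsilon> * exp (- H b / \<epsilon>) * (g x * exp (- S b x / \<epsilon>)))) (at x)"
      unfolding slope_def[abs_def]
      using \<epsilon> by (auto intro!: derivative_eq_intros simp: field_simps)
    also have "- b x / \<epsilon> * slope x + exp (S b x / \<epsilon>) *
          (1 / \<epsilon> * exp (- H b / \<epsilon>) * (g x * exp (- S b x / \<epsilon>)))
        = - b x / \<epsilon> * slope x + 1 / \<epsilon> * exp (- H b / \<epsilon>) * g x"
      by (simp add: exp_minus)
    finally have d: "(slope has_real_derivative
        - b x / \<epsilon> * slope x + 1 / \<epsilon> * exp (- H b / \<epsilon>) * g x) (at x)" .
    then show "slope differentiable (at x)"
      using real_differentiable_def by blast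
    show "Lhat b \<epsilon> ?f x = g x"
      unfolding Lhat_def deriv DERIV_imp_deriv[OF d]
      using \<epsilon> by (simp add: algebra_simps exp_minus)
  qed (use per slope_continuous in auto)
qed

end

end

section \<open>Geometry of landscapes and valleys\<close>

context drift
begin

lemma S_add_int_less:
  assumes "x \<le> y" and "y < x + 1" and "r \<ge> (1::int)"
  shows "S b (y + of_int r) < S b y"
  using B_pos assms by (simp add: S_add_int)

text \<open>
  By the drift of \<open>S\<close> only one period to the right of \<open>x\<close> matters.
  There the maximum is attained on a compact set, whose largest element is the wanted point.
\<close>

lemma zmax_exists:
  "\<exists>z\<ge>x. (\<forall>u\<ge>x. S b u \<le> S b z) \<and> (\<forall>u>z. S b u < S b z)"
proof -
  have red: "\<exists>y' r. x \<le> y' \<and> y' < x + 1 \<and> r \<ge> 0 \<and> y = y' + of_int r" if "y \<ge> x" for y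
    using that by (intro exI[of _ "y - of_int \<lfloor>y - x\<rfloor>"] exI[of _ "\<lfloor>y - x\<rfloor>"])
      (simp, linarith)
  obtain y0 where y0: "y0 \<in> {x..x+1}" "\<And>y. y \<in> {x..x+1} \<Longrightarrow> S b y \<le> S b y0"
    using continuous_attains_sup[of "{x..x+1}" "S b"] S_continuous by auto
  define A where "A = {y \<in> {x..x+1}. S b y = S b y0}"
  have "closed A"
    unfolding A_def using S_continuous by (intro continuous_closed_preimage_constant) auto
  then have "compact A"
    unfolding A_def by (metis (no_types, lifting) bounded_closed_interval bounded_subset
        compact_eq_bounded_closed mem_Collect_eq subsetI)
  then obtain z where z: "z \<in> A" "\<And>y. y \<in> A \<Longrightarrow> y \<le> z"
    using compact_attains_sup[of A] y0(1) by (auto simp: A_def)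
  have max: "S b u \<le> S b y0" if "u \<ge> x" for u
  proof -
    from red[OF that]
    obtain y' r where y': "x \<le> y'" "y' < x + 1" "r \<ge> 0" "u = y' + of_int r"
      by blast
    have "S b u \<le> S b y'" using y' B_pos by (simp add: S_add_int)
    also have "\<dots> \<le> S b y0" using y' y0(2) by auto
    finally show ?thesis .
  qed
  have "S b u < S b z" if "u > z" for u
  proof (rule ccontr)
    assume "\<not> S b u < S b z"
    then have eq: "S b u = S b y0" using max[of u] that z(1) by (auto simp: A_def)
    have "u \<ge> x" using that z(1) by (auto simp: A_def)
    from red[OF this]
    obtain y' r where y': "x \<le> y'" "y' < x + 1" "r \<ge> 0" "u = y' + of_int r"
      by blast
    show False
    proof (cases "r \<ge> 1")
      case True
      then show False
        using S_add_int_less[OF y'(1,2) True] eq y' max[of y'] by simp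
    next
      case False
      then have "r = 0" using y'(3) by simp
      then have "u \<in> A" using y' eq by (auto simp: A_def)
      then show False using z(2)[of u] that by simp
    qed
  qed
  then show ?thesis using z(1) max by (auto simp: A_def)
qed

lemma zmax_properties:
  "x \<le> zmax b x" "x \<le> u \<Longrightarrow> S b u \<le> S b (zmax b x)" "zmax b x < u \<Longrightarrow> S b u < S b (zmax b x)"
proof -
  obtain z where z: "z \<ge> x" "\<And>u. u \<ge> x \<Longrightarrow> S b u \<le> S b z" "\<And>u. u > z \<Longrightarrow> S b u < S b z"
    using zmax_exists by blast
  have "zmax b x = z"
    unfolding zmax_def
  proof (rule Greatest_equality)
    fix y assume "x \<le> y \<and> (\<forall>u\<ge>x. S b u \<le> S b y)"
    then have "S b z \<le> S b y" using z(1) by blast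
    then show "y \<le> z" using z(3)[of y] by (meson not_le)
  qed (use z in auto)
  then show "x \<le> zmax b x" "x \<le> u \<Longrightarrow> S b u \<le> S b (zmax b x)" "zmax b x < u \<Longrightarrow> S b u < S b (zmax b x)"
    using z by auto
qed

lemma zmax_fixed_iff: "zmax b x = x \<longleftrightarrow> (\<forall>u>x. S b u < S b x)"
proof
  assume "zmax b x = x"
  then show "\<forall>u>x. S b u < S b x" using zmax_properties(3)[of x] by simp
next
  assume r: "\<forall>u>x. S b u < S b x"
  have "\<not> zmax b x > x"
    using r zmax_properties(2)[of x x] by (meson not_less order_refl)
  then show "zmax b x = x" using zmax_properties(1)[of x] by simp
qed

lemma loc_max_S_shift: "loc_max (S b) x \<Longrightarrow> loc_max (S b) (x + of_int r)"
proof -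
  assume "loc_max (S b) x"
  moreover have "((\<lambda>y. y - of_int r) \<longlongrightarrow> x) (nhds (x + of_int r))"
    by (auto intro!: tendsto_eq_intros filterlim_ident)
  ultimately have "\<forall>\<^sub>F y in nhds (x + of_int r). S b (y - of_int r) \<le> S b x"
    unfolding loc_max_def by (rule eventually_compose_filterlim)
  then show ?thesis
    unfolding loc_max_def
    by eventually_elim (use S_add_int[of _ r] in \<open>metis diff_add_cancel diff_right_mono\<close>)
qed

lemma S_deriv_minus: "((\<lambda>x. - b x) has_real_derivative - deriv b x) (at x)"
  by (intro DERIV_minus b_deriv)

lemma loc_max_S_curvature:
  assumes "loc_max (S b) x"
  shows "b x = 0" and "deriv (deriv (S b)) x < 0"
proof -
  have "\<forall>\<^sub>F y in nhds x. S b y \<le> S b x" using assms by (simp add: loc_max_def)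
  then obtain d where "d > 0" "\<And>y. \<bar>x - y\<bar> < d \<Longrightarrow> S b y \<le> S b x"
    by (auto simp: eventually_nhds_metric dist_real_def abs_minus_commute)
  then have "- b x = 0"
    by (intro DERIV_local_max[OF S_deriv, of d x]) auto
  then show 0: "b x = 0" by simp
  show "deriv (deriv (S b)) x < 0"
    unfolding S_deriv2
    using loc_max_derivatives(2)[OF S_deriv assms S_deriv_minus] b_nondegenerate[OF 0] by simp
qed

lemma loc_min_S_curvature:
  assumes "loc_max (\<lambda>y. - S b y) x"
  shows "b x = 0" and "deriv (deriv (S b)) x > 0"
proof -
  have d: "((\<lambda>y. - S b y) has_real_derivative b y) (at y)" for y
    using DERIV_minus[OF S_deriv[of y]] by simp
  have "\<forall>\<^sub>F y in nhds x. S b x \<le> S b y" using assms by (simp add: loc_max_def)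
  then obtain d where "d > 0" "\<And>y. \<bar>x - y\<bar> < d \<Longrightarrow> S b x \<le> S b y"
    by (auto simp: eventually_nhds_metric dist_real_def abs_minus_commute)
  then have "- b x = 0" by (intro DERIV_local_min[OF S_deriv, of d x]) auto
  then show 0: "b x = 0" by simp
  show "deriv (deriv (S b)) x > 0"
    unfolding S_deriv2 using loc_max_derivatives(2)[OF d assms b_deriv] b_nondegenerate[OF 0] by simp
qed

end

locale metastable_drift = drift b for b +
  fixes q p N :: int and M m L wm wp em ep :: "int \<Rightarrow> real"
  assumes critical: "critical_points b q M m"
    and maxima: "landscape_maxima b q M p L"
    and valleys: "deepest_valleys b L N wm wp"
    and wells: "wells b N wm wp em ep"
begin

lemma p_pos: "p \<ge> 1" and N_pos: "N \<ge> 1"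
  using maxima valleys by (auto simp: landscape_maxima_def deepest_valleys_def)

lemma L_shift: "L (n + r * p) = of_int r + L n"
  using maxima by (auto simp: landscape_maxima_def)

lemma L_base:
  assumes "k \<in> {1..p}"
  shows "L k \<in> {0..<1}" "zmax b (L k) = L k"
proof -
  have "L k \<in> {M k |k. k \<in> {1..q} \<and> zmax b (M k) = M k}"
    using assms maxima unfolding landscape_maxima_def by blast
  then obtain j where j: "j \<in> {1..q}" "L k = M j" "zmax b (M j) = M j" by blast
  moreover have "M j \<in> {x \<in> {0..<1}. loc_max (S b) x}"
    using critical j(1) unfolding critical_points_def by blast
  ultimately show "L k \<in> {0..<1}" "zmax b (L k) = L k" by auto
qed

lemma int_decompose:
  obtains k r where "k \<in> {1..p}" "n = k + r * p"
proof
  show "(n - 1) mod p + 1 \<in> {1..p}"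
  proof -
    have "0 < p" using p_pos by simp
    from pos_mod_bound[OF this, of "n - 1"] pos_mod_sign[OF this, of "n - 1"]
    show ?thesis unfolding atLeastAtMost_iff by linarith
  qed
  show "n = (n - 1) mod p + 1 + (n - 1) div p * p"
    using mod_div_mult_eq[of "n - 1" p] by simp
qed

lemma S_less_L:
  assumes "y > L n"
  shows "S b y < S b (L n)"
proof -
  obtain k r where k: "k \<in> {1..p}" "n = k + r * p" by (rule int_decompose)
  have "y - of_int r > L k" using assms k L_shift by simp
  then have "S b (y - of_int r) < S b (L k)"
    using L_base(2)[OF k(1)] zmax_fixed_iff by blast
  then show ?thesis
    using S_add_int[of "y - of_int r" r] S_add_int[of "L k" r] L_shift[of k r] k(2)
    by (simp add: add.commute)
qed

lemma L_step: "L n < L (n + 1)"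
proof -
  obtain k r where k: "k \<in> {1..p}" "n = k + r * p" by (rule int_decompose)
  have "L k < L (k + 1)"
  proof (cases "k = p")
    case True
    have "L (p + 1) = 1 + L 1" using L_shift[of 1 1] by (simp add: add.commute)
    then show ?thesis using L_base(1)[OF k(1)] L_base(1)[of 1] p_pos True by simp
  next
    case False
    then show ?thesis
      using k(1) maxima unfolding landscape_maxima_def
      by (auto intro: strict_mono_onD)
  qed
  then show ?thesis using L_shift[of k r] L_shift[of "k + 1" r] k(2) by (simp add: algebra_simps)
qed

lemma L_strict_mono: "n < n' \<Longrightarrow> L n < L n'"
proof (induction n' rule: int_gr_induct)
  case base
  then show ?case by (rule L_step)
next
  case (step i)
  then show ?case using L_step[of i] by simp
qed

lemma L_mono: "n \<le> n' \<Longrightarrow> L n \<le> L n'"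
  using L_strict_mono[of n n'] by (cases "n = n'") auto

text \<open>
  Translating such a point into \<open>[0, 1)\<close> preserves both properties, and there the
  landscape maxima are all listed.
\<close>

lemma L_enumerates:
  assumes "loc_max (S b) x" and "\<And>u. u > x \<Longrightarrow> S b u < S b x"
  shows "\<exists>n. x = L n"
proof -
  have x: "x = frac x + of_int \<lfloor>x\<rfloor>" by (simp add: frac_def)
  have "loc_max (S b) (frac x)"
    using loc_max_S_shift[OF assms(1), of "- \<lfloor>x\<rfloor>"] by (simp add: frac_def)
  then have "frac x \<in> M ` {1..q}"
    using critical frac_lt_1[of x] unfolding critical_points_def by auto
  then obtain j where j: "j \<in> {1..q}" "frac x = M j" by blast
  have "S b u < S b (frac x)" if "u > frac x" for u
  proof -
    have "u + of_int \<lfloor>x\<rfloor> > x" using that by (simp add: frac_def)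
    from assms(2)[OF this] have "S b u - of_int \<lfloor>x\<rfloor> * B b < S b x"
      by (simp only: S_add_int)
    moreover have "S b x = S b (frac x) - of_int \<lfloor>x\<rfloor> * B b"
      by (subst x) (rule S_add_int)
    ultimately show ?thesis by simp
  qed
  then have "zmax b (M j) = M j" using j(2) zmax_fixed_iff by simp
  then have "frac x \<in> L ` {1..p}"
    using maxima j unfolding landscape_maxima_def by auto
  then obtain k where "frac x = L k" by blast
  then show ?thesis
    using x L_shift[of k "\<lfloor>x\<rfloor>"] by (metis add.commute)
qed

lemma ell_properties:
  "L n < ell b L n" "ell b L n \<le> L (n + 1)" "S b (ell b L n) = S b (L (n + 1))"
proof -
  define A where "A = {x. x \<ge> L n \<and> S b x = S b (L (n + 1))}"
  have "closed A"
  proof -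
    have "A = {L n..} \<inter> {x. S b x = S b (L (n + 1))}" by (auto simp: A_def)
    moreover have "closed {x. S b x = S b (L (n + 1))}"
      using continuous_closed_preimage_constant[of UNIV "S b"] S_continuous by simp
    ultimately show ?thesis by auto
  qed
  moreover have mem: "L (n + 1) \<in> A" using L_step[of n] by (simp add: A_def)
  moreover have bdd: "bdd_below A" by (rule bdd_belowI[of _ "L n"]) (simp add: A_def)
  ultimately have "Inf A \<in> A" by (intro closed_contains_Inf) auto
  then have e: "ell b L n \<in> A" by (simp add: ell_def A_def)
  show "ell b L n \<le> L (n + 1)"
    unfolding ell_def using cInf_lower[OF mem bdd] by (simp add: A_def)
  show "S b (ell b L n) = S b (L (n + 1))" using e by (simp add: A_def)
  then have "ell b L n \<noteq> L n" using S_less_L[OF L_step[of n]] by auto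
  then show "L n < ell b L n" using e by (simp add: A_def)
qed

text \<open>
  No point to the right of \<open>ell n\<close> is higher than \<open>L (n + 1)\<close>: the last maximum of \<open>S\<close> to the right
  of \<open>ell n\<close> would otherwise be a landscape maximum strictly between \<open>L n\<close> and \<open>L (n + 1)\<close>.
\<close>

lemma S_le_right_of_ell:
  assumes "y \<ge> ell b L n"
  shows "S b y \<le> S b (L (n + 1))"
proof (rule ccontr)
  assume y: "\<not> S b y \<le> S b (L (n + 1))"
  define z where "z = zmax b (ell b L n)"
  have z: "z \<ge> ell b L n" "\<And>u. u \<ge> ell b L n \<Longrightarrow> S b u \<le> S b z" "\<And>u. u > z \<Longrightarrow> S b u < S b z"
    using zmax_properties[of "ell b L n"] by (auto simp: z_def)
  have high: "S b z > S b (L (n + 1))" using z(2)[OF assms] y by simp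
  then have "z \<noteq> ell b L n" using ell_properties(3)[of n] by auto
  then have gt: "z > ell b L n" using z(1) by simp
  have lt: "z < L (n + 1)"
    using high S_less_L[of "n + 1" z] by (cases z "L (n + 1)" rule: linorder_cases) auto
  have "\<forall>\<^sub>F u in nhds z. u \<in> {ell b L n<..}"
    using gt by (intro eventually_nhds_in_open) auto
  then have "loc_max (S b) z"
    unfolding loc_max_def by eventually_elim (use z(2) in auto)
  then obtain k where k: "z = L k" using L_enumerates z(3) by blast
  have "L n < L k" "L k < L (n + 1)" using gt lt ell_properties(1)[of n] k by auto
  then have "n < k" "k < n + 1"
    using L_mono by (meson not_less)+
  then show False by simp
qed

lemma V_on_landscape:
  assumes "x \<in> landscape b L n"
  shows "V b x = S b x - S b (L (n + 1)) + H b"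
proof -
  have x: "ell b L n \<le> x" "x \<le> L (n + 1)" using assms by (auto simp: landscape_def)
  have "S b (zmax b x) \<le> S b (L (n + 1))"
    using zmax_properties(1)[of x] x by (intro S_le_right_of_ell) simp
  moreover have "S b (L (n + 1)) \<le> S b (zmax b x)" using x zmax_properties(2) by blast
  ultimately show ?thesis by (simp add: V_def Vhat_def)
qed

lemma landscape_unique:
  assumes "x \<in> landscape b L n" and "x \<in> landscape b L n'"
  shows "n = n'"
proof -
  have *: False if "k < k'" "x \<in> landscape b L k" "x \<in> landscape b L k'" for k k'
    using that L_mono[of "k + 1" k'] ell_properties(1)[of k'] by (auto simp: landscape_def)
  show ?thesis using *[of n n'] *[of n' n] assms by (meson linorder_neqE_linordered_idom)
qed

lemma loc_max_in_landscape:
  assumes "ell b L n < x" and "S b x = S b (L (n + 1))"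
  shows "loc_max (S b) x"
proof -
  have "\<forall>\<^sub>F u in nhds x. u \<in> {ell b L n<..}"
    using assms by (intro eventually_nhds_in_open) auto
  then show ?thesis
    unfolding loc_max_def by eventually_elim (use S_le_right_of_ell[of n] assms in auto)
qed

lemma valley_properties:
  assumes "is_valley b L n u v"
  shows "ell b L n \<le> u" "u < v" "v \<le> L (n + 1)" "S b u = S b (L (n + 1))" "S b v = S b (L (n + 1))"
    and "u < x \<Longrightarrow> x < v \<Longrightarrow> S b x < S b (L (n + 1))"
proof -
  have uv: "u \<in> valley_points b L n" "v \<in> valley_points b L n" "u < v"
      "valley_points b L n \<inter> {u<..<v} = {}"
    using assms by (auto simp: is_valley_def)
  have P: "ell b L n \<le> x" "x \<le> L (n + 1)" "S b x = S b (L (n + 1))" if "x \<in> valley_points b L n" for x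
    using that ell_properties[of n] by (auto simp: valley_points_def)
  show "ell b L n \<le> u" "u < v" "v \<le> L (n + 1)" "S b u = S b (L (n + 1))" "S b v = S b (L (n + 1))"
    using P uv by auto
  assume x: "u < x" "x < v"
  have "S b x \<noteq> S b (L (n + 1))"
  proof
    assume eq: "S b x = S b (L (n + 1))"
    have "loc_max (S b) x" using P(1)[OF uv(1)] x eq by (intro loc_max_in_landscape[of n]) auto
    then have "x \<in> valley_points b L n"
      using x eq P(1)[OF uv(1)] P(2)[OF uv(2)] ell_properties(3)[of n]
      by (auto simp: valley_points_def)
    then show False using uv(4) x by auto
  qed
  then show "S b x < S b (L (n + 1))"
    using S_le_right_of_ell[of n x] P(1)[OF uv(1)] x by simp
qed

lemma valley_subset_landscape: "is_valley b L n u v \<Longrightarrow> {u..v} \<subseteq> landscape b L n"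
  using valley_properties(1-3) by (fastforce simp: landscape_def)

text \<open>
  In one landscape two valleys are gaps between neighbouring points of the same set; valleys of
  different landscapes are separated by the landscapes.
\<close>

lemma valleys_disjoint:
  assumes "is_valley b L n u v" and "is_valley b L n' u' v'"
    and "u < x" "x < v" "u' < x'" "x' < v'" "x < x'" and "(u, v) \<noteq> (u', v')"
  shows "v \<le> u'"
proof -
  note A = valley_properties[OF assms(1)] and A' = valley_properties[OF assms(2)]
  consider "n < n'" | "n' < n" | "n = n'" by linarith
  then show ?thesis
  proof cases
    case 1
    then show ?thesis using A(3) A'(1) L_mono[of "n + 1" n'] ell_properties(1)[of n'] by auto
  next
    case 2
    then show ?thesis using A(1) A'(3) L_mono[of "n' + 1" n] ell_properties(1)[of n] assms by auto
  next
    case 3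
    have "y \<le> u \<or> v \<le> y" "y \<le> u' \<or> v' \<le> y" if "y \<in> valley_points b L n" for y
      using assms(1,2) 3 that by (auto simp: is_valley_def disjoint_iff not_less)
    moreover have "u \<in> valley_points b L n" "v \<in> valley_points b L n"
      "u' \<in> valley_points b L n" "v' \<in> valley_points b L n"
      using assms(1,2) 3 by (auto simp: is_valley_def)
    ultimately have "v' \<le> u \<or> v \<le> v'" "v \<le> u' \<or> v' \<le> v" "u \<le> u' \<or> v' \<le> u" "u' \<le> u \<or> v \<le> u'"
      by blast+
    then show ?thesis
      using assms(3-8) by (cases "v \<le> u'") auto
  qed
qed

text \<open>
  Inside a landscape \<open>V\<close> and \<open>S\<close> differ by a constant, so the minima
  of depth \<open>H\<close> are level points of \<open>S\<close> and local minima, hence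
  nondegenerate zeros of the drift.
\<close>

lemma deepest_valley_minima:
  assumes "is_deepest_valley b L n u v"
  shows "is_valley b L n u v"
    and "global_minima b u v = {x. u < x \<and> x < v \<and> S b x = S b (L (n + 1)) - H b}"
    and "u < x \<Longrightarrow> x < v \<Longrightarrow> S b (L (n + 1)) - H b \<le> S b x"
    and "finite (global_minima b u v)" "global_minima b u v \<noteq> {}"
    and "x \<in> global_minima b u v \<Longrightarrow> loc_max (\<lambda>y. - S b y) x"
proof -
  show val: "is_valley b L n u v" using assms by (simp add: is_deepest_valley_def)
  have V: "V b x = S b x - S b (L (n + 1)) + H b" if "u < x" "x < v" for x
    using valley_subset_landscape[OF val] that by (intro V_on_landscape) auto
  obtain x0 where x0: "is_arg_min (V b) (\<lambda>y. y \<in> {u<..<v}) x0" "V b x0 = 0"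
    using assms by (auto simp: is_deepest_valley_def global_minima_def)
  show low: "S b (L (n + 1)) - H b \<le> S b x" if "u < x" "x < v" for x
    using x0 that V[OF that] by (force simp: is_arg_min_def)
  show gm: "global_minima b u v = {x. u < x \<and> x < v \<and> S b x = S b (L (n + 1)) - H b}"
  proof (intro set_eqI iffI; clarsimp)
    fix x assume "x \<in> global_minima b u v"
    then have x: "u < x" "x < v" "\<not> V b x0 < V b x"
      using x0(1) by (auto simp: global_minima_def is_arg_min_def)
    then show "u < x \<and> x < v \<and> S b x = S b (L (n + 1)) - H b"
      using V[OF x(1,2)] low[OF x(1,2)] x0(2) by auto
  next
    fix x assume x: "u < x" "x < v" "S b x = S b (L (n + 1)) - H b"
    then show "x \<in> global_minima b u v"
      using V low by (fastforce simp: global_minima_def is_arg_min_def)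
  qed
  show "global_minima b u v \<noteq> {}" using x0(1) by (auto simp: global_minima_def)
  show lm: "loc_max (\<lambda>y. - S b y) x" if "x \<in> global_minima b u v" for x
  proof -
    have "\<forall>\<^sub>F y in nhds x. y \<in> {u<..<v}"
      using that gm by (intro eventually_nhds_in_open) auto
    then show ?thesis
      unfolding loc_max_def
    proof (rule eventually_mono)
      fix y assume "y \<in> {u<..<v}"
      then have "S b (L (n + 1)) - H b \<le> S b y" by (intro low) auto
      moreover have "S b x = S b (L (n + 1)) - H b" using that gm by auto
      ultimately show "- S b y \<le> - S b x" by simp
    qed
  qed
  have "b x = 0" if "x \<in> global_minima b u v" for x
    by (rule loc_min_S_curvature(1)[OF lm[OF that]])
  then have "global_minima b u v \<subseteq> {x. u \<le> x \<and> x \<le> v \<and> b x = 0}"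
    unfolding gm by auto
  then show "finite (global_minima b u v)"
    using finite_zeros finite_subset by blast
qed

section \<open>The deepest valleys and their wells\<close>

definition first_min :: "int \<Rightarrow> real" where
  "first_min j = Min (global_minima b (wm j) (wp j))"

text \<open>
  The index of the landscape that contains the \<open>j\<close>-th deepest valley. It is unique,
  since landscapes are disjoint.
\<close>

definition lidx :: "int \<Rightarrow> int" where
  "lidx j = (SOME n. is_deepest_valley b L n (wm j) (wp j))"

definition crest :: "int \<Rightarrow> real" where
  "crest j = S b (wp j)"

lemma valley_list:
  "(\<lambda>j. (wm j, wp j)) ` {1..N} =
     {(u, v). (\<exists>n. is_deepest_valley b L n u v) \<and> Min (global_minima b u v) \<in> {0<..<1}}"
  and first_min_strict_mono: "strict_mono_on {1..N} first_min"
  and first_leftmost: "is_leftmost_deepest b L (wm 1) (wp 1)"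
  and em_shift: "em (j + r * N) = of_int r + em j"
  using valleys wells
  unfolding deepest_valleys_def wells_def first_min_def[abs_def] by blast+

lemma deepest_lidx:
  assumes "j \<in> {1..N}"
  shows "is_deepest_valley b L (lidx j) (wm j) (wp j)" and "first_min j \<in> {0<..<1}"
proof -
  have "(wm j, wp j) \<in> (\<lambda>j. (wm j, wp j)) ` {1..N}" using assms by blast
  then have *: "(\<exists>n. is_deepest_valley b L n (wm j) (wp j)) \<and> first_min j \<in> {0<..<1}"
    unfolding valley_list first_min_def by simp
  then show "is_deepest_valley b L (lidx j) (wm j) (wp j)"
    unfolding lidx_def using someI_ex[of "\<lambda>n. is_deepest_valley b L n (wm j) (wp j)"] by blast
  show "first_min j \<in> {0<..<1}" using * by blast
qed

lemma valley_wm_wp: "j \<in> {1..N} \<Longrightarrow> is_valley b L (lidx j) (wm j) (wp j)"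
  using deepest_valley_minima(1)[OF deepest_lidx(1)] .

lemma crest_eq: "j \<in> {1..N} \<Longrightarrow> crest j = S b (L (lidx j + 1))"
  using valley_properties(5)[OF valley_wm_wp] by (simp add: crest_def)

text \<open>
  All of this is inherited from the landscape of the valley, whose right end has the height of
  the crest.
\<close>

lemma S_valley:
  assumes "j \<in> {1..N}"
  shows "ell b L (lidx j) \<le> wm j" "wm j < wp j" "wp j \<le> L (lidx j + 1)" "S b (wm j) = crest j"
    and "wm j < x \<Longrightarrow> x < wp j \<Longrightarrow> S b x < crest j"
    and "wm j < x \<Longrightarrow> x < wp j \<Longrightarrow> crest j - H b \<le> S b x"
    and "L (lidx j) < wm j"
    and "wm j \<le> x \<Longrightarrow> S b x \<le> crest j"
    and "L (lidx j + 1) < x \<Longrightarrow> S b x < crest j"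
proof -
  note v = valley_properties[OF valley_wm_wp[OF assms]]
  show 1: "ell b L (lidx j) \<le> wm j" and "wm j < wp j" "wp j \<le> L (lidx j + 1)" "S b (wm j) = crest j"
    using v(1-5) by (auto simp: crest_def)
  show "S b x < crest j" if "wm j < x" "x < wp j" using v(5,6) that by (simp add: crest_def)
  show "crest j - H b \<le> S b x" if "wm j < x" "x < wp j"
    using deepest_valley_minima(3)[OF deepest_lidx(1)[OF assms]] that v(5) by (simp add: crest_def)
  show "L (lidx j) < wm j" using 1 ell_properties(1)[of "lidx j"] by simp
  show "S b x \<le> crest j" if "wm j \<le> x"
    using S_le_right_of_ell[of "lidx j" x] 1 that crest_eq[OF assms] by simp
  show "S b x < crest j" if "L (lidx j + 1) < x"
    using S_less_L[OF that] crest_eq[OF assms] by simp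
qed

lemma global_minima_eq:
  assumes "j \<in> {1..N}"
  shows "global_minima b (wm j) (wp j) = {x. wm j < x \<and> x < wp j \<and> S b x = crest j - H b}"
    and "finite (global_minima b (wm j) (wp j))" "global_minima b (wm j) (wp j) \<noteq> {}"
    and "x \<in> global_minima b (wm j) (wp j) \<Longrightarrow> loc_max (\<lambda>y. - S b y) x"
  using deepest_valley_minima(2,4,5,6)[OF deepest_lidx(1)[OF assms]] crest_eq[OF assms] by auto

lemma first_min:
  assumes "j \<in> {1..N}"
  shows "wm j < first_min j" "first_min j < wp j" "loc_max (\<lambda>y. - S b y) (first_min j)"
proof -
  have "first_min j \<in> global_minima b (wm j) (wp j)"
    unfolding first_min_def using global_minima_eq[OF assms] by (intro Min_in) auto
  then show "wm j < first_min j" "first_min j < wp j" "loc_max (\<lambda>y. - S b y) (first_min j)"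
    using global_minima_eq[OF assms] by auto
qed

text \<open>
  The first minimum of a deepest valley lies in \<open>(0, 1)\<close>, and \<open>L 1\<close> is the first critical point there.
  So the deepest valleys of one period belong to the landscapes \<open>1, \<dots>, p\<close>.
\<close>

lemma lidx_range:
  assumes "j \<in> {1..N}"
  shows "lidx j \<in> {1..p}"
proof -
  note v = S_valley[OF assms] and m = first_min[OF assms] and range = deepest_lidx(2)[OF assms]
  have "lidx j \<le> p"
  proof (rule ccontr)
    assume "\<not> lidx j \<le> p"
    then have "L (1 + 1 * p) \<le> L (lidx j)" by (intro L_mono) simp
    then show False using L_shift[of 1 1] L_base(1)[of 1] p_pos v(7) m(1) range by auto
  qed
  moreover have "lidx j \<ge> 1"
  proof (rule ccontr)
    assume "\<not> lidx j \<ge> 1"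
    then have "L (lidx j + 1) \<le> L 1" by (intro L_mono) simp
    then have lt: "first_min j < M 1"
      using v(3) m(2) maxima by (simp add: landscape_maxima_def)
    have "loc_min (S b) (first_min j)" using m(3) by (simp add: loc_min_def loc_max_def)
    then have "first_min j \<in> m ` {1..q}"
      using critical range unfolding critical_points_def by auto
    then obtain k where k: "k \<in> {1..q}" "first_min j = m k" by blast
    have "M 1 \<le> M k" if "1 \<le> k" "k \<le> q" for k
      using that
    proof (induction k rule: int_ge_induct)
      case (step i)
      then have "i \<in> {1..<q}" "i \<in> {1..q}" by auto
      then have "M i < m i" "m i < M (i + 1)" using critical unfolding critical_points_def by blast+
      then show ?case using step by auto
    qed simp
    moreover have "M k < m k" using critical k(1) unfolding critical_points_def by blast
    ultimately show False using k lt by force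
  qed
  ultimately show ?thesis by simp
qed

lemma valleys_ordered:
  assumes "i \<in> {1..N}" and "j \<in> {1..N}" and "i < j"
  shows "wp i \<le> wm j"
proof (rule valleys_disjoint[OF valley_wm_wp[OF assms(1)] valley_wm_wp[OF assms(2)]])
  show lt: "first_min i < first_min j"
    using first_min_strict_mono assms by (auto intro: strict_mono_onD)
  then show "(wm i, wp i) \<noteq> (wm j, wp j)" by (auto simp: first_min_def)
qed (use first_min assms in auto)

lemma lidx_mono:
  assumes "i \<in> {1..N}" and "j \<in> {1..N}" and "i \<le> j"
  shows "lidx i \<le> lidx j"
proof (rule ccontr)
  assume a: "\<not> lidx i \<le> lidx j"
  then have "i < j" using assms by (cases "i = j") auto
  then have "wp i \<le> wm j" using valleys_ordered assms by blast
  moreover have "L (lidx j + 1) \<le> L (lidx i)" using a by (intro L_mono) simp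
  ultimately show False
    using S_valley(3,2)[OF assms(2)] S_valley(2,7)[OF assms(1)] by simp
qed

lemma one_in_range: "1 \<in> {1..N}"
  using N_pos by simp

lemma period_of_valleys:
  assumes "j \<in> {1..N}"
  shows "wm 1 \<le> wm j" "wp j \<le> L (lidx j + 1)" "L (lidx j + 1) < wm 1 + 1"
proof -
  show "wm 1 \<le> wm j"
    using valleys_ordered[of 1 j] S_valley(2)[OF one_in_range] assms by (cases "j = 1") auto
  have "L (lidx j + 1) \<le> L (1 + 1 * p)"
    using lidx_range[OF assms] by (intro L_mono) simp
  also have "\<dots> = 1 + L 1" using L_shift[of 1 1] by simp
  also have "L 1 \<le> L (lidx 1)" using lidx_range[OF one_in_range] by (intro L_mono) simp
  also have "L (lidx 1) < wm 1" using S_valley(7)[OF one_in_range] .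
  finally show "L (lidx j + 1) < wm 1 + 1" by simp
  show "wp j \<le> L (lidx j + 1)" using S_valley(3)[OF assms] .
qed

lemma well_properties:
  assumes "j \<in> {1..N}"
  shows "wm j < em j" "em j < ep j" "ep j < wp j" "S b (em j) < crest j" "S b (ep j) = S b (em j)"
    and "em j < x \<Longrightarrow> x < ep j \<Longrightarrow> S b x < S b (em j)"
    and "global_minima b (wm j) (wp j) = {x. em j \<le> x \<and> x \<le> ep j \<and> S b x = crest j - H b}"
    and "crest j - H b < S b (em j)"
proof -
  have w: "{em j<..<ep j} \<subseteq> {wm j<..<wp j}" "global_minima b (wm j) (wp j) \<subseteq> {em j<..<ep j}"
      "V b (em j) = V b (ep j)" "V b (em j) < H b" "\<And>\<theta>. \<theta> \<in> {em j<..<ep j} \<Longrightarrow> V b \<theta> < V b (em j)"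
    using wells assms unfolding wells_def by blast+
  show lt: "em j < ep j" using w(2) global_minima_eq(3)[OF assms] by fastforce
  then have le: "wm j \<le> em j" "ep j \<le> wp j"
    using w(1) by (simp_all add: greaterThanLessThan_subseteq_greaterThanLessThan)
  have V: "V b x = S b x - crest j + H b" if "wm j \<le> x" "x \<le> wp j" for x
    using valley_subset_landscape[OF valley_wm_wp[OF assms]] V_on_landscape[of x "lidx j"]
      crest_eq[OF assms] that by auto
  show S: "S b (em j) < crest j" "S b (ep j) = S b (em j)"
    using w(3,4) V[of "em j"] V[of "ep j"] le lt by auto
  show in1: "wm j < em j" using S le S_valley(4)[OF assms] by (cases "wm j = em j") auto
  show in2: "ep j < wp j" using S le by (cases "ep j = wp j") (auto simp: crest_def)
  show less: "S b x < S b (em j)" if "em j < x" "x < ep j" for x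
    using w(5)[of x] V[of x] V[of "em j"] le lt that by auto
  have "first_min j \<in> global_minima b (wm j) (wp j)"
    unfolding first_min_def using global_minima_eq[OF assms] by (intro Min_in) auto
  then have "em j < first_min j" "first_min j < ep j" "S b (first_min j) = crest j - H b"
    using w(2) unfolding global_minima_eq(1)[OF assms] by auto
  then show "crest j - H b < S b (em j)" using less[of "first_min j"] by simp
  have "em j < x \<and> x < ep j" if "wm j < x" "x < wp j" "S b x = crest j - H b" for x
    using w(2) that unfolding global_minima_eq(1)[OF assms] by auto
  then show "global_minima b (wm j) (wp j) = {x. em j \<le> x \<and> x \<le> ep j \<and> S b x = crest j - H b}"
    unfolding global_minima_eq(1)[OF assms] using in1 in2 by (intro Collect_cong) fastforce
qed

lemma S_well_le:
  assumes "j \<in> {1..N}" and "em j \<le> x" and "x \<le> ep j"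
  shows "S b x \<le> S b (em j)" "crest j - H b \<le> S b x"
proof -
  show "S b x \<le> S b (em j)"
    using well_properties(5)[OF assms(1)] well_properties(6)[OF assms(1), of x] assms(2,3)
    by (cases "x = em j \<or> x = ep j") auto
  show "crest j - H b \<le> S b x"
    using S_valley(6)[OF assms(1)] well_properties(1,3)[OF assms(1)] assms(2,3) by simp
qed

lemma ep_less_em_Suc:
  assumes "j \<in> {1..N}"
  shows "ep j < em (j + 1)" and "wp j < em (j + 1)"
proof -
  show "wp j < em (j + 1)"
  proof (cases "j < N")
    case True
    then show ?thesis
      using valleys_ordered[of j "j + 1"] well_properties(1)[of "j + 1"] assms by simp
  next
    case False
    then have "em (j + 1) = 1 + em 1"
      using em_shift[of 1 1] assms by (simp add: add.commute)
    then show ?thesis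
      using period_of_valleys[OF assms] well_properties(1)[OF one_in_range] by simp
  qed
  then show "ep j < em (j + 1)" using well_properties(3)[OF assms] by simp
qed

text \<open>
  A deepest valley to the left of valley \<open>j\<close> in the same landscape is either one of
  the listed valleys \<open>1, \<dots>, j - 1\<close>, so that the landscape also contains
  valley \<open>j - 1\<close> in between, or its first minimum is not positive. In the second
  case valley 1 would lie between the two and belong to that landscape without being its
  left-most deepest valley.
\<close>

lemma leftmost_iff:
  assumes "j \<in> {1..N}" and "j \<noteq> 1"
  shows "is_leftmost_deepest b L (wm j) (wp j) \<longleftrightarrow> lidx (j - 1) \<noteq> lidx j"
proof
  have j1: "j - 1 \<in> {1..N}" using assms by simp
  assume "is_leftmost_deepest b L (wm j) (wp j)"
  then obtain n where n: "is_deepest_valley b L n (wm j) (wp j)"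
    "\<And>u v. is_deepest_valley b L n u v \<Longrightarrow> wm j \<le> u"
    by (auto simp: is_leftmost_deepest_def)
  have "wm j \<in> landscape b L n" "wm j \<in> landscape b L (lidx j)"
    using valley_subset_landscape[OF deepest_valley_minima(1)] n(1) deepest_lidx(1)[OF assms(1)]
      S_valley(2)[OF assms(1)] by (meson atLeastAtMost_iff less_imp_le order_refl subsetD)+
  then have "n = lidx j" by (rule landscape_unique)
  then have "\<not> is_deepest_valley b L (lidx j) (wm (j - 1)) (wp (j - 1))"
    using n(2) valleys_ordered[of "j - 1" j] S_valley(2)[OF j1] j1 assms by force
  then show "lidx (j - 1) \<noteq> lidx j" using deepest_lidx(1)[OF j1] by metis
next
  have j1: "j - 1 \<in> {1..N}" using assms by simp
  assume ne: "lidx (j - 1) \<noteq> lidx j"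
  show "is_leftmost_deepest b L (wm j) (wp j)"
  proof (rule ccontr)
    assume "\<not> ?thesis"
    then obtain u v where uv: "is_deepest_valley b L (lidx j) u v" "u < wm j"
      using deepest_lidx(1)[OF assms(1)] unfolding is_leftmost_deepest_def by (meson not_le)
    define x where "x = Min (global_minima b u v)"
    have "x \<in> global_minima b u v"
      unfolding x_def using deepest_valley_minima(4,5)[OF uv(1)] by (intro Min_in)
    then have x: "u < x" "x < v" "loc_max (\<lambda>y. - S b y) x"
      using deepest_valley_minima(2,6)[OF uv(1)] by auto
    note val = deepest_valley_minima(1)[OF uv(1)]
    note dis = valleys_disjoint[OF _ val]  valleys_disjoint[OF val]
    have xj: "x < first_min j"
    proof (rule ccontr)
      assume "\<not> x < first_min j"
      moreover have "x \<noteq> first_min j"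
      proof
        assume eq: "x = first_min j"
        define y where "y = wm j"
        have "y < x" using first_min(1)[OF assms(1)] eq by (simp add: y_def)
        then have "S b y < S b (L (lidx j + 1))"
          using valley_properties(6)[OF val, of y] uv(2) x by (simp add: y_def)
        then show False using S_valley(4)[OF assms(1)] crest_eq[OF assms(1)] by (simp add: y_def)
      qed
      ultimately have "wp j \<le> u"
        using dis(1)[OF valley_wm_wp[OF assms(1)], of "first_min j" x] first_min[OF assms(1)] x uv(2)
        by auto
      then show False using S_valley(2)[OF assms(1)] uv(2) by simp
    qed
    have vj: "v \<le> wm j"
      using dis(2)[OF valley_wm_wp[OF assms(1)], of x "first_min j"] x xj first_min[OF assms(1)] uv(2)
      by auto
    have same: "lidx k = lidx j" if "k \<in> {1..N}" "k \<le> j" "u < wp k" for k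
    proof (rule ccontr)
      assume "lidx k \<noteq> lidx j"
      then have "lidx k + 1 \<le> lidx j" using lidx_mono[OF that(1) assms(1) that(2)] by simp
      then have "wp k \<le> L (lidx j)" using S_valley(3)[OF that(1)] L_mono[of "lidx k + 1" "lidx j"] by simp
      also have "\<dots> < u"
        using valley_properties(1)[OF val] ell_properties(1)[of "lidx j"] by simp
      finally show False using that(3) by simp
    qed
    show False
    proof (cases "x \<in> {0<..<1}")
      case True
      then have "(u, v) \<in> (\<lambda>j. (wm j, wp j)) ` {1..N}"
        unfolding valley_list using uv(1) x_def by auto
      then obtain k where k: "k \<in> {1..N}" "u = wm k" "v = wp k" by auto
      have "k < j" using uv(2) k valleys_ordered[OF assms(1) k(1)] S_valley(2)[OF assms(1)]
        by (cases k j rule: linorder_cases) auto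
      then have "k \<le> j - 1" by simp
      then have "u < wp (j - 1)"
        using valleys_ordered[OF k(1) j1] S_valley(2)[OF j1] S_valley(2)[OF k(1)] k
        by (cases "k = j - 1") auto
      then show False using same[OF j1] ne by simp
    next
      case False
      have "x < 1" using xj deepest_lidx(2)[OF assms(1)] by simp
      then have "x \<le> 0" using False by auto
      then have x1: "x < first_min 1" using deepest_lidx(2)[OF one_in_range] by simp
      have "(u, v) \<noteq> (wm 1, wp 1)"
        using x1 by (auto simp: x_def first_min_def)
      then have v1: "v \<le> wm 1"
        using dis(2)[OF valley_wm_wp[OF one_in_range], of x "first_min 1"] x x1
          first_min[OF one_in_range] by auto
      then have "u < wp 1" using x S_valley(2)[OF one_in_range] by simp
      then have l1: "lidx 1 = lidx j" using same[OF one_in_range] assms by simp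
      obtain n where n: "is_deepest_valley b L n (wm 1) (wp 1)"
        "\<And>u v. is_deepest_valley b L n u v \<Longrightarrow> wm 1 \<le> u"
        using first_leftmost by (auto simp: is_leftmost_deepest_def)
      have "wm 1 \<in> landscape b L n" "wm 1 \<in> landscape b L (lidx 1)"
        using valley_subset_landscape[OF deepest_valley_minima(1)] n(1) deepest_lidx(1)[OF one_in_range]
          S_valley(2)[OF one_in_range] by (meson atLeastAtMost_iff less_imp_le order_refl subsetD)+
      then have "n = lidx 1" by (rule landscape_unique)
      then have "wm 1 \<le> u" using n(2)[of u v] uv(1) l1 by simp
      then show False using v1 x by simp
    qed
  qed
qed

text \<open>
  For the deepest valleys of one period, these points are local maxima in the landscape of the
  valley.
\<close>

definition peaks :: "int \<Rightarrow> real \<Rightarrow> real set" where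
  "peaks j x = {y. ep j < y \<and> y < x \<and> S b y = crest j}"

abbreviation saddle :: "int \<Rightarrow> real" where
  "saddle \<equiv> \<sigma> b L wm wp em ep"

abbreviation peak_weight :: "real \<Rightarrow> real" where
  "peak_weight x \<equiv> sqrt (2 * pi / (- deriv (deriv (S b)) x))"

lemma peak_properties:
  assumes "j \<in> {1..N}" and "y \<in> peaks j x"
  shows "y \<le> L (lidx j + 1)" "loc_max (S b) y" "y \<in> landscape b L (lidx j)"
proof -
  have y: "ep j < y" "S b y = crest j" using assms(2) by (auto simp: peaks_def)
  have "ell b L (lidx j) < y"
    using y well_properties(1,2)[OF assms(1)] S_valley(1)[OF assms(1)] by simp
  then show "loc_max (S b) y"
    using y crest_eq[OF assms(1)] by (intro loc_max_in_landscape) auto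
  show "y \<le> L (lidx j + 1)"
    using y S_valley(9)[OF assms(1), of y] by (cases "y \<le> L (lidx j + 1)") auto
  then show "y \<in> landscape b L (lidx j)"
    using \<open>ell b L (lidx j) < y\<close> by (simp add: landscape_def)
qed

lemma finite_peaks:
  assumes "j \<in> {1..N}"
  shows "finite (peaks j x)"
proof (rule finite_subset)
  show "peaks j x \<subseteq> {y. ep j \<le> y \<and> y \<le> x \<and> b y = 0}"
    using loc_max_S_curvature(1) peak_properties(2)[OF assms] by (auto simp: peaks_def)
qed (rule finite_zeros)

lemma saddle_eq:
  assumes "j \<in> {1..N}"
  shows "saddle j = (\<Sum>y\<in>peaks j (em (j + 1)). peak_weight y)" and "saddle j > 0"
proof -
  have "{x. loc_max (S b) x \<and> V b x = H b \<and> x \<in> {ep j<..<em (j + 1)} \<and>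
      (\<exists>n. {wm j<..<wp j} \<subseteq> landscape b L n \<and> x \<in> landscape b L n)} = peaks j (em (j + 1))"
    (is "?A = ?B")
  proof
    show "?A \<subseteq> ?B"
    proof
      fix x assume x: "x \<in> ?A"
      then obtain n where n: "{wm j<..<wp j} \<subseteq> landscape b L n" "x \<in> landscape b L n" by blast
      have "first_min j \<in> landscape b L n" using n(1) first_min[OF assms] by auto
      moreover have "first_min j \<in> landscape b L (lidx j)"
        using valley_subset_landscape[OF valley_wm_wp[OF assms]] first_min[OF assms] by auto
      ultimately have "n = lidx j" by (rule landscape_unique)
      then have "S b x = crest j"
        using V_on_landscape[OF n(2)] x crest_eq[OF assms] by simp
      then show "x \<in> ?B" using x by (simp add: peaks_def)
    qed
    show "?B \<subseteq> ?A"
    proof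
      fix x assume x: "x \<in> ?B"
      note pp = peak_properties[OF assms x]
      have "V b x = H b"
        using V_on_landscape[OF pp(3)] x crest_eq[OF assms] by (simp add: peaks_def)
      moreover have "{wm j<..<wp j} \<subseteq> landscape b L (lidx j)"
        using valley_subset_landscape[OF valley_wm_wp[OF assms]] by auto
      ultimately show "x \<in> ?A" using pp x by (auto simp: peaks_def)
    qed
  qed
  then show eq: "saddle j = (\<Sum>y\<in>peaks j (em (j + 1)). peak_weight y)"
    by (simp add: \<sigma>_def)
  show "saddle j > 0"
    unfolding eq
  proof (rule sum_pos)
    have "wp j \<in> peaks j (em (j + 1))"
      using well_properties(3)[OF assms] ep_less_em_Suc(2)[OF assms] by (simp add: peaks_def crest_def)
    then show "peaks j (em (j + 1)) \<noteq> {}" by auto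
    show "peak_weight y > 0" if "y \<in> peaks j (em (j + 1))" for y
      using loc_max_S_curvature(2)[OF peak_properties(2)[OF assms that]]
      by (simp add: divide_pos_neg)
  qed (rule finite_peaks[OF assms])
qed

lemma S_valley_later:
  assumes "i \<in> {1..N}" "j \<in> {1..N}" "i < j"
  shows "lidx i \<noteq> lidx j \<Longrightarrow> em j \<le> y \<Longrightarrow> S b y < crest i"
    and "em j \<le> y \<Longrightarrow> y \<le> ep j \<Longrightarrow> S b y < crest i"
    and "lidx i = lidx j \<Longrightarrow> crest i = crest j"
proof -
  show later: "S b y < crest i" if "lidx i \<noteq> lidx j" "em j \<le> y" for y
  proof -
    have "lidx i + 1 \<le> lidx j" using lidx_mono[of i j] assms that(1) by simp
    then have "L (lidx i + 1) \<le> L (lidx j)" by (rule L_mono)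
    then have "L (lidx i + 1) < y"
      using S_valley(7)[OF assms(2)] well_properties(1)[OF assms(2)] that(2) by simp
    then show ?thesis by (rule S_valley(9)[OF assms(1)])
  qed
  show same: "crest i = crest j" if "lidx i = lidx j"
    using crest_eq assms that by simp
  show "S b y < crest i" if "em j \<le> y" "y \<le> ep j"
  proof (cases "lidx i = lidx j")
    case True
    then show ?thesis
      using same S_well_le(1)[OF assms(2) that] well_properties(4)[OF assms(2)] by simp
  qed (use later that in auto)
qed

text \<open>
  Of all the maxima to the right of a well at the height of its crest, those between two
  consecutive wells \<open>k\<close> and \<open>k + 1\<close> are the ones counted in \<open>saddle k\<close>, provided
  the two wells \<open>i\<close> and \<open>k\<close> share a landscape; further to the right there are none.
\<close>

lemma sum_peaks:
  assumes "i \<in> {1..N}" and "i \<le> j" and "j \<le> N"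
  shows "(\<Sum>y\<in>peaks i (em (j + 1)). peak_weight y)
    = (\<Sum>k\<in>{i..j}. if lidx k = lidx i then saddle k else 0)"
  using assms(2,3)
proof (induction j rule: int_ge_induct)
  case base
  then show ?case using saddle_eq(1)[OF assms(1)] by simp
next
  case (step j)
  have j: "j + 1 \<in> {1..N}" "i < j + 1" using step assms by auto
  have lt: "em (j + 1) < em (j + 1 + 1)"
    using well_properties(2)[OF j(1)] ep_less_em_Suc(1)[OF j(1)] by simp
  have ei: "ep i < em (j + 1)"
    using valleys_ordered[OF assms(1) j] well_properties(3)[OF assms(1)] well_properties(1)[OF j(1)] by simp
  have new: "peaks i (em (j + 1 + 1)) - peaks i (em (j + 1))
      = (if lidx (j + 1) = lidx i then peaks (j + 1) (em (j + 1 + 1)) else {})"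
    (is "?D = _")
  proof -
    have D: "?D = {y. em (j + 1) \<le> y \<and> y < em (j + 1 + 1) \<and> S b y = crest i}"
      using lt ei by (auto simp: peaks_def)
    show ?thesis
    proof (cases "lidx (j + 1) = lidx i")
      case True
      then have c: "crest i = crest (j + 1)" using S_valley_later(3)[OF assms(1) j] by simp
      have "S b y \<noteq> crest i" if "em (j + 1) \<le> y" "y \<le> ep (j + 1)" for y
        using S_valley_later(2)[OF assms(1) j that] by simp
      then have "{y. em (j + 1) \<le> y \<and> y < em (j + 1 + 1) \<and> S b y = crest i}
          = peaks (j + 1) (em (j + 1 + 1))"
        unfolding peaks_def using well_properties(2)[OF j(1)] c by force
      then have "?D = peaks (j + 1) (em (j + 1 + 1))" using D by simp
      then show ?thesis using True by simp
    next
      case False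
      then have "?D = {}"
        unfolding D using S_valley_later(1)[OF assms(1) j] by fastforce
      then show ?thesis using False by simp
    qed
  qed
  have "peaks i (em (j + 1)) \<subseteq> peaks i (em (j + 1 + 1))"
    using lt by (auto simp: peaks_def)
  then have "(\<Sum>y\<in>peaks i (em (j + 1 + 1)). peak_weight y)
      = (\<Sum>y\<in>peaks i (em (j + 1)). peak_weight y) + (\<Sum>y\<in>?D. peak_weight y)"
    using sum.subset_diff[OF _ finite_peaks[OF assms(1)], where g = peak_weight] by fastforce
  also have "(\<Sum>y\<in>?D. peak_weight y) = (if lidx (j + 1) = lidx i then saddle (j + 1) else 0)"
    unfolding new using saddle_eq(1)[OF j(1)] by simp
  also have "(\<Sum>y\<in>peaks i (em (j + 1)). peak_weight y)
      = (\<Sum>k\<in>{i..j}. if lidx k = lidx i then saddle k else 0)"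
    using step by simp
  also have "\<dots> + (if lidx (j + 1) = lidx i then saddle (j + 1) else 0)
      = (\<Sum>k\<in>{i..j+1}. if lidx k = lidx i then saddle k else 0)"
  proof -
    have "{i..j+1} = insert (j + 1) {i..j}" using step by auto
    then show ?thesis by simp
  qed
  finally show ?case .
qed

text \<open>
  The peaks of the landscape lie to the left of its right end, which precedes
  \<open>wm 1 + 1\<close>.
\<close>

lemma peaks_of_period:
  assumes "i \<in> {1..N}"
  shows "peaks i (wm 1 + 1) = peaks i (em (N + 1))"
proof -
  have e: "em (N + 1) = 1 + em 1" using em_shift[of 1 1] by (simp add: add.commute)
  have "y < wm 1 + 1" if "y \<in> peaks i x" for x y
    using peak_properties(1)[OF assms that] period_of_valleys(3)[OF assms] by simp
  moreover have "wm 1 + 1 < em (N + 1)" using e well_properties(1)[OF one_in_range] by simp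
  ultimately show ?thesis by (fastforce simp: peaks_def)
qed

lemma weight_pos:
  assumes "j \<in> {1..N}"
  shows "weight b wm wp j > 0"
  unfolding weight_def
proof (rule sum_pos)
  show "sqrt (2 * pi / deriv (deriv (S b)) x) > 0" if "x \<in> global_minima b (wm j) (wp j)" for x
    using loc_min_S_curvature(2)[OF global_minima_eq(4)[OF assms that]] by simp
qed (use global_minima_eq[OF assms] in auto)

section \<open>Elementary solutions and their limits\<close>

definition chi :: "int \<Rightarrow> real \<Rightarrow> real" where
  "chi i = indicator (torus_well em ep i)"

definition mass :: "real \<Rightarrow> int \<Rightarrow> real \<Rightarrow> real" where
  "mass \<epsilon> i y = lint (wm 1) y (\<lambda>z. chi i z * exp (- S b z / \<epsilon>))"

text \<open>
  For \<open>\<epsilon> > 0\<close> this is \<open>1 - exp (- B / \<epsilon>)\<close> times the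
  integral of \<open>chi i * exp (- S / \<epsilon>)\<close> over the half-line
  \<open>(-\<infinity>, y]\<close>: each period further to the left contributes the mass of one
  period times another factor \<open>exp (- B / \<epsilon>)\<close>.
\<close>

definition flux :: "real \<Rightarrow> int \<Rightarrow> real \<Rightarrow> real" where
  "flux \<epsilon> i y = (1 - exp (- B b / \<epsilon>)) * mass \<epsilon> i y + exp (- B b / \<epsilon>) * mass \<epsilon> i (wm 1 + 1)"

text \<open>
  This is \<open>1 - exp (- B / \<epsilon>)\<close> times the increment from \<open>wm 1\<close>
  to \<open>x\<close> of the explicit formula for the right-hand side \<open>chi i\<close>. It
  is nondecreasing in \<open>x\<close> because that right-hand side is nonnegative.
\<close>

definition elem :: "real \<Rightarrow> int \<Rightarrow> real \<Rightarrow> real" where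
  "elem \<epsilon> i x = 1 / \<epsilon> * exp (- H b / \<epsilon>) * lint (wm 1) x (\<lambda>y. exp (S b y / \<epsilon>) * flux \<epsilon> i y)"

lemma chi_measurable: "chi i \<in> borel_measurable borel"
proof -
  have "torus_well em ep i = (\<Union>r::int. {em i - of_int r<..<ep i - of_int r})"
    by (auto simp: torus_well_def algebra_simps)
  then have "open (torus_well em ep i)" by auto
  then show ?thesis unfolding chi_def by simp
qed

lemma chi_bound: "\<bar>chi i x\<bar> \<le> 1"
  by (simp add: chi_def indicator_def)

lemma chi_periodic: "chi i (x + 1) = chi i x"
proof -
  have "x + 1 \<in> torus_well em ep i \<longleftrightarrow> x \<in> torus_well em ep i"
  proof
    assume "x + 1 \<in> torus_well em ep i"
    then obtain r where "x + 1 + of_int r \<in> {em i<..<ep i}" by (auto simp: torus_well_def)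
    then have "x + of_int (r + 1) \<in> {em i<..<ep i}" by (simp add: algebra_simps)
    then show "x \<in> torus_well em ep i" unfolding torus_well_def by blast
  next
    assume "x \<in> torus_well em ep i"
    then obtain r where "x + of_int r \<in> {em i<..<ep i}" by (auto simp: torus_well_def)
    then have "x + 1 + of_int (r - 1) \<in> {em i<..<ep i}" by (simp add: algebra_simps)
    then show "x + 1 \<in> torus_well em ep i" unfolding torus_well_def by blast
  qed
  then show ?thesis by (simp add: chi_def indicator_def)
qed

lemma well_in_period:
  assumes "i \<in> {1..N}"
  shows "wm 1 < em i" "em i < ep i" "ep i < wm 1 + 1"
  using period_of_valleys[OF assms] well_properties(1-3)[OF assms] by auto

lemma chi_eq:
  assumes "i \<in> {1..N}" and "wm 1 \<le> z" and "z \<le> wm 1 + 1"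
  shows "chi i z = indicator {em i<..<ep i} z"
proof -
  have only_0: "r = 0" if "z + of_int r \<in> {em i<..<ep i}" for r :: int
  proof -
    have "of_int r < (1::real)" "- 1 < (of_int r :: real)"
      using that well_in_period[OF assms(1)] assms(2,3) by auto
    then show ?thesis by linarith
  qed
  have "z \<in> torus_well em ep i \<longleftrightarrow> z \<in> {em i<..<ep i}"
  proof
    assume "z \<in> torus_well em ep i"
    then obtain r :: int where "z + of_int r \<in> {em i<..<ep i}" by (auto simp: torus_well_def)
    with only_0[OF this] show "z \<in> {em i<..<ep i}" by simp
  next
    assume "z \<in> {em i<..<ep i}"
    then have "z + of_int 0 \<in> {em i<..<ep i}" by simp
    then show "z \<in> torus_well em ep i" unfolding torus_well_def by blast
  qed
  then show ?thesis by (simp add: chi_def indicator_def)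
qed

lemma chi_weighted_locally_integrable: "locally_integrable (\<lambda>z. chi i z * exp (- S b z / \<epsilon>))"
  using chi_measurable chi_bound exp_S_continuous(2) by (rule locally_integrable_bounded_mult)

lemma mass_continuous: "continuous_on A (mass \<epsilon> i)"
  unfolding mass_def[abs_def]
  by (intro continuous_at_imp_continuous_on ballI lint_continuous chi_weighted_locally_integrable)

lemma flux_continuous: "continuous_on A (flux \<epsilon> i)"
  unfolding flux_def[abs_def] by (intro continuous_intros mass_continuous)

lemma exp_flux_locally_integrable: "locally_integrable (\<lambda>y. exp (S b y / \<epsilon>) * flux \<epsilon> i y)"
  by (intro locally_integrable_continuous continuous_intros exp_S_continuous flux_continuous)

definition well_mass :: "real \<Rightarrow> int \<Rightarrow> real" where
  "well_mass \<epsilon> i = lint (em i) (ep i) (\<lambda>z. exp (- S b z / \<epsilon>))"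

lemma mass_left:
  assumes "i \<in> {1..N}" and "wm 1 \<le> y" and "y \<le> em i"
  shows "mass \<epsilon> i y = 0"
proof -
  have "mass \<epsilon> i y = lint (wm 1) y (\<lambda>_. 0)"
    unfolding mass_def
    by (rule lint_cong) (use assms well_in_period[OF assms(1)] chi_eq[OF assms(1)] in auto)
  then show ?thesis by simp
qed

lemma mass_ep:
  assumes "i \<in> {1..N}"
  shows "mass \<epsilon> i (ep i) = well_mass \<epsilon> i"
proof -
  have "mass \<epsilon> i (ep i) = mass \<epsilon> i (em i) + lint (em i) (ep i) (\<lambda>z. chi i z * exp (- S b z / \<epsilon>))"
    unfolding mass_def by (rule lint_combine[OF chi_weighted_locally_integrable, symmetric])
  also have "lint (em i) (ep i) (\<lambda>z. chi i z * exp (- S b z / \<epsilon>)) = well_mass \<epsilon> i"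
    unfolding well_mass_def
    by (rule lint_cong) (use well_in_period[OF assms] chi_eq[OF assms] in auto)
  finally show ?thesis using mass_left[OF assms, of "em i"] well_in_period[OF assms] by simp
qed

lemma mass_right:
  assumes "i \<in> {1..N}" and "ep i \<le> y" and "y \<le> wm 1 + 1"
  shows "mass \<epsilon> i y = well_mass \<epsilon> i"
proof -
  have "mass \<epsilon> i y = mass \<epsilon> i (ep i) + lint (ep i) y (\<lambda>z. chi i z * exp (- S b z / \<epsilon>))"
    unfolding mass_def by (rule lint_combine[OF chi_weighted_locally_integrable, symmetric])
  also have "lint (ep i) y (\<lambda>z. chi i z * exp (- S b z / \<epsilon>)) = lint (ep i) y (\<lambda>_. 0)"
    by (rule lint_cong) (use assms well_in_period[OF assms(1)] chi_eq[OF assms(1)] in auto)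
  finally show ?thesis using mass_ep[OF assms(1)] by simp
qed

lemma mass_mono:
  assumes "x \<le> y"
  shows "mass \<epsilon> i x \<le> mass \<epsilon> i y"
  unfolding mass_def using assms chi_weighted_locally_integrable
  by (intro lint_mono_nonneg) (auto simp: chi_def)

lemma well_mass_pos:
  assumes "i \<in> {1..N}"
  shows "well_mass \<epsilon> i > 0"
  unfolding well_mass_def
  using well_in_period[OF assms] exp_S_continuous(2) by (intro lint_pos) auto

lemma flux_values:
  assumes "i \<in> {1..N}" and "\<epsilon> > 0" and "wm 1 \<le> y" and "y \<le> wm 1 + 1"
  shows "exp (- B b / \<epsilon>) * well_mass \<epsilon> i \<le> flux \<epsilon> i y" "flux \<epsilon> i y \<le> well_mass \<epsilon> i"
    and "y \<le> em i \<Longrightarrow> flux \<epsilon> i y = exp (- B b / \<epsilon>) * well_mass \<epsilon> i"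
    and "ep i \<le> y \<Longrightarrow> flux \<epsilon> i y = well_mass \<epsilon> i"
proof -
  define e where "e = exp (- B b / \<epsilon>)"
  have e: "0 < e" "e < 1" using B_pos assms(2) by (auto simp: e_def)
  have f: "flux \<epsilon> i y = (1 - e) * mass \<epsilon> i y + e * well_mass \<epsilon> i"
    unfolding flux_def e_def using mass_right[OF assms(1), of "wm 1 + 1"] well_in_period[OF assms(1)] by simp
  have "0 \<le> mass \<epsilon> i y"
    using mass_mono[OF assms(3), of \<epsilon> i] by (simp add: mass_def)
  moreover have le: "mass \<epsilon> i y \<le> well_mass \<epsilon> i"
    using mass_mono[OF assms(4), of \<epsilon> i] mass_right[OF assms(1), of "wm 1 + 1"] well_in_period[OF assms(1)] by simp
  ultimately show "exp (- B b / \<epsilon>) * well_mass \<epsilon> i \<le> flux \<epsilon> i y"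
    unfolding f e_def[symmetric] using e by simp
  have "(1 - e) * mass \<epsilon> i y \<le> (1 - e) * well_mass \<epsilon> i"
    using le e by (intro mult_left_mono) auto
  then show "flux \<epsilon> i y \<le> well_mass \<epsilon> i" unfolding f by (simp add: algebra_simps)
  show "flux \<epsilon> i y = exp (- B b / \<epsilon>) * well_mass \<epsilon> i" if "y \<le> em i"
    unfolding f e_def[symmetric] using mass_left[OF assms(1,3) that] by simp
  show "flux \<epsilon> i y = well_mass \<epsilon> i" if "ep i \<le> y"
    unfolding f using mass_right[OF assms(1) that assms(4)] by (simp add: algebra_simps)
qed

lemma elem_start: "elem \<epsilon> i (wm 1) = 0"
  by (simp add: elem_def)

lemma elem_mono:
  assumes "i \<in> {1..N}" and "\<epsilon> > 0" and "wm 1 \<le> x" and "x \<le> y" and "y \<le> wm 1 + 1"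
  shows "elem \<epsilon> i x \<le> elem \<epsilon> i y"
proof -
  have "lint (wm 1) x (\<lambda>y. exp (S b y / \<epsilon>) * flux \<epsilon> i y) \<le> lint (wm 1) y (\<lambda>y. exp (S b y / \<epsilon>) * flux \<epsilon> i y)"
  proof (rule lint_mono_nonneg[OF exp_flux_locally_integrable assms(4)])
    fix z assume z: "x \<le> z" "z \<le> y"
    have "0 \<le> exp (- B b / \<epsilon>) * well_mass \<epsilon> i" using well_mass_pos[OF assms(1)] by (simp add: less_imp_le)
    also have "\<dots> \<le> flux \<epsilon> i z" using flux_values(1)[OF assms(1,2)] z assms by simp
    finally show "0 \<le> exp (S b z / \<epsilon>) * flux \<epsilon> i z" by simp
  qed
  then show ?thesis
    unfolding elem_def using assms(2) by (intro mult_left_mono) auto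
qed

lemma elem_nonneg:
  assumes "i \<in> {1..N}" and "\<epsilon> > 0" and "wm 1 \<le> x" and "x \<le> wm 1 + 1"
  shows "0 \<le> elem \<epsilon> i x"
  using elem_mono[OF assms(1,2) order_refl assms(3,4)] elem_start by simp

lemma elem_pos:
  assumes "i \<in> {1..N}" and "\<epsilon> > 0"
  shows "0 < elem \<epsilon> i (wm 1 + 1)"
proof -
  have "0 < exp (- B b / \<epsilon>) * well_mass \<epsilon> i * lint (wm 1) (wm 1 + 1) (\<lambda>y. exp (S b y / \<epsilon>))"
    using well_mass_pos[OF assms(1)] exp_S_continuous(1) by (intro mult_pos_pos lint_pos) auto
  also have "\<dots> = lint (wm 1) (wm 1 + 1) (\<lambda>y. exp (- B b / \<epsilon>) * well_mass \<epsilon> i * exp (S b y / \<epsilon>))"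
    by (rule lint_cmult[symmetric])
  also have "\<dots> \<le> lint (wm 1) (wm 1 + 1) (\<lambda>y. exp (S b y / \<epsilon>) * flux \<epsilon> i y)"
  proof (rule lint_mono[OF _ exp_flux_locally_integrable])
    show "locally_integrable (\<lambda>y. exp (- B b / \<epsilon>) * well_mass \<epsilon> i * exp (S b y / \<epsilon>))"
      by (intro locally_integrable_continuous continuous_intros exp_S_continuous)
    show "exp (- B b / \<epsilon>) * well_mass \<epsilon> i * exp (S b y / \<epsilon>) \<le> exp (S b y / \<epsilon>) * flux \<epsilon> i y"
      if "wm 1 \<le> y" "y \<le> wm 1 + 1" for y
      using flux_values(1)[OF assms that] by (simp add: mult.commute)
  qed simp
  finally show ?thesis unfolding elem_def using assms(2) by simp
qed

text \<open>
  The integral of \<open>exp (- (S - min S) / \<epsilon>)\<close> over the well, with the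
  minimum \<open>crest i - H\<close> of \<open>S\<close> there.
\<close>

definition scaled_mass :: "real \<Rightarrow> int \<Rightarrow> real" where
  "scaled_mass \<epsilon> i = exp ((crest i - H b) / \<epsilon>) * well_mass \<epsilon> i"

lemma scaled_mass_eq:
  "scaled_mass \<epsilon> i = lint (em i) (ep i) (\<lambda>z. exp ((crest i - H b - S b z) / \<epsilon>))"
proof -
  have "scaled_mass \<epsilon> i = lint (em i) (ep i) (\<lambda>z. exp ((crest i - H b) / \<epsilon>) * exp (- S b z / \<epsilon>))"
    unfolding scaled_mass_def well_mass_def by (rule lint_cmult[symmetric])
  then show ?thesis by (simp add: exp_add[symmetric] diff_divide_distrib)
qed

lemma scaled_mass_bounds:
  assumes "i \<in> {1..N}" and "\<epsilon> > 0"
  shows "0 \<le> scaled_mass \<epsilon> i" "scaled_mass \<epsilon> i \<le> 1"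
proof -
  show "0 \<le> scaled_mass \<epsilon> i"
    unfolding scaled_mass_def using well_mass_pos[OF assms(1), of \<epsilon>] by simp
  have "scaled_mass \<epsilon> i \<le> lint (em i) (ep i) (\<lambda>_. 1)"
    unfolding scaled_mass_eq
  proof (rule lint_mono)
    show "locally_integrable (\<lambda>z. exp ((crest i - H b - S b z) / \<epsilon>))"
      unfolding divide_inverse by (intro locally_integrable_continuous continuous_intros S_continuous)
    show "exp ((crest i - H b - S b z) / \<epsilon>) \<le> 1" if "em i \<le> z" "z \<le> ep i" for z
      using S_well_le(2)[OF assms(1) that] assms(2) by (simp add: divide_nonpos_pos)
  qed (use well_in_period[OF assms(1)] in \<open>auto intro: locally_integrable_continuous\<close>)
  also have "\<dots> = ep i - em i" using well_in_period[OF assms(1)] by simp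
  also have "\<dots> \<le> 1" using well_in_period[OF assms(1)] by simp
  finally show "scaled_mass \<epsilon> i \<le> 1" .
qed

lemma S_less_crest_left:
  assumes "i \<in> {1..N}" and "wm 1 \<le> y"
  shows "S b y - B b < crest i"
  using S_valley(9)[OF assms(1), of "y + 1"] period_of_valleys(3)[OF assms(1)] assms(2) S_add_1[of y] by simp

text \<open>
  Points left of the well are reached only after one turn around the torus, which costs a factor
  \<open>exp (- B / \<epsilon>)\<close>. So the relevant height is always the one met when
  moving to the right from the well. The hypotheses keep it \<open>\<eta>\<close> below the
  crest, and the crest is \<open>H\<close> above the bottom of the well.
\<close>

lemma integrand_bound:
  assumes "i \<in> {1..N}" and "\<epsilon> > 0" and "wm 1 \<le> y" and "y \<le> wm 1 + 1"
    and "y \<le> em i \<Longrightarrow> S b y - B b \<le> crest i - \<eta>" and "em i \<le> y \<Longrightarrow> S b y \<le> crest i - \<eta>"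
  shows "exp (- H b / \<epsilon>) * (exp (S b y / \<epsilon>) * flux \<epsilon> i y) \<le> scaled_mass \<epsilon> i * exp (- \<eta> / \<epsilon>)"
proof -
  have *: "exp (- H b / \<epsilon>) * (exp t * well_mass \<epsilon> i) \<le> scaled_mass \<epsilon> i * exp (- \<eta> / \<epsilon>)"
    if "t \<le> (crest i - \<eta>) / \<epsilon>" for t
  proof -
    have "exp (- H b / \<epsilon>) * exp t \<le> exp (- H b / \<epsilon>) * exp ((crest i - \<eta>) / \<epsilon>)"
      using that by simp
    also have "\<dots> = exp ((crest i - H b) / \<epsilon>) * exp (- \<eta> / \<epsilon>)"
      by (simp add: exp_add[symmetric] diff_divide_distrib)
    finally have "exp (- H b / \<epsilon>) * exp t * well_mass \<epsilon> i
        \<le> exp ((crest i - H b) / \<epsilon>) * exp (- \<eta> / \<epsilon>) * well_mass \<epsilon> i"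
      using well_mass_pos[OF assms(1), of \<epsilon>] by (intro mult_right_mono) auto
    then show ?thesis by (simp add: scaled_mass_def mult_ac)
  qed
  show ?thesis
  proof (cases "y \<le> em i")
    case True
    have "exp (S b y / \<epsilon>) * flux \<epsilon> i y = exp ((S b y - B b) / \<epsilon>) * well_mass \<epsilon> i"
      using flux_values(3)[OF assms(1-4) True] by (simp add: exp_add[symmetric] diff_divide_distrib)
    moreover have "(S b y - B b) / \<epsilon> \<le> (crest i - \<eta>) / \<epsilon>"
      using assms(2) assms(5)[OF True] by (intro divide_right_mono) auto
    ultimately show ?thesis using * by simp
  next
    case False
    have "exp (S b y / \<epsilon>) * flux \<epsilon> i y \<le> exp (S b y / \<epsilon>) * well_mass \<epsilon> i"
      using flux_values(2)[OF assms(1-4)] by simp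
    then have "exp (- H b / \<epsilon>) * (exp (S b y / \<epsilon>) * flux \<epsilon> i y)
        \<le> exp (- H b / \<epsilon>) * (exp (S b y / \<epsilon>) * well_mass \<epsilon> i)"
      by simp
    also have "\<dots> \<le> scaled_mass \<epsilon> i * exp (- \<eta> / \<epsilon>)"
      using assms(2) assms(6) False by (intro * divide_right_mono) auto
    finally show ?thesis .
  qed
qed

lemma elem_bound:
  assumes "i \<in> {1..N}" and "\<epsilon> > 0" and "wm 1 \<le> x" and "x \<le> wm 1 + 1" and "0 \<le> \<eta>"
    and "\<And>y. wm 1 \<le> y \<Longrightarrow> y \<le> x \<Longrightarrow> y \<le> em i \<Longrightarrow> S b y - B b \<le> crest i - \<eta>"
    and "\<And>y. em i \<le> y \<Longrightarrow> y \<le> x \<Longrightarrow> S b y \<le> crest i - \<eta>"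
  shows "elem \<epsilon> i x \<le> exp (- \<eta> / \<epsilon>) / \<epsilon>"
proof -
  have "exp (- H b / \<epsilon>) * lint (wm 1) x (\<lambda>y. exp (S b y / \<epsilon>) * flux \<epsilon> i y)
      = lint (wm 1) x (\<lambda>y. exp (- H b / \<epsilon>) * (exp (S b y / \<epsilon>) * flux \<epsilon> i y))"
    by (rule lint_cmult[symmetric])
  also have "\<dots> \<le> lint (wm 1) x (\<lambda>_. exp (- \<eta> / \<epsilon>))"
  proof (rule lint_mono[OF _ _ assms(3)])
    show "locally_integrable (\<lambda>y. exp (- H b / \<epsilon>) * (exp (S b y / \<epsilon>) * flux \<epsilon> i y))"
      by (intro locally_integrable_continuous continuous_intros exp_S_continuous flux_continuous)
    fix y assume y: "wm 1 \<le> y" "y \<le> x"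
    have "exp (- H b / \<epsilon>) * (exp (S b y / \<epsilon>) * flux \<epsilon> i y) \<le> scaled_mass \<epsilon> i * exp (- \<eta> / \<epsilon>)"
      using y assms by (intro integrand_bound) auto
    also have "\<dots> \<le> exp (- \<eta> / \<epsilon>)"
      using scaled_mass_bounds[OF assms(1,2)] by simp
    finally show "exp (- H b / \<epsilon>) * (exp (S b y / \<epsilon>) * flux \<epsilon> i y) \<le> exp (- \<eta> / \<epsilon>)" .
  qed (auto intro: locally_integrable_continuous)
  also have "\<dots> = (x - wm 1) * exp (- \<eta> / \<epsilon>)" using assms(3) by simp
  also have "\<dots> \<le> 1 * exp (- \<eta> / \<epsilon>)" using assms(4) by (intro mult_right_mono) auto
  finally show ?thesis
    unfolding elem_def using assms(2) by (simp add: divide_right_mono)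
qed

lemma elem_le_inverse:
  assumes "i \<in> {1..N}" and "\<epsilon> > 0" and "wm 1 \<le> x" and "x \<le> wm 1 + 1"
  shows "elem \<epsilon> i x \<le> 1 / \<epsilon>"
proof -
  have "elem \<epsilon> i x \<le> exp (- 0 / \<epsilon>) / \<epsilon>"
  proof (rule elem_bound[OF assms])
    show "S b y - B b \<le> crest i - 0" if "wm 1 \<le> y" for y
      using S_less_crest_left[OF assms(1) that] by simp
    show "S b y \<le> crest i - 0" if "em i \<le> y" for y
      using S_valley(8)[OF assms(1), of y] well_properties(1)[OF assms(1)] that by simp
  qed simp
  then show ?thesis by simp
qed

text \<open>
  Up to the right end of its own well, all heights that enter are strictly below the crest, by
  compactness even by a fixed amount; the contribution is exponentially small.
\<close>

lemma elem_before_well: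
  assumes "i \<in> {1..N}"
  shows "((\<lambda>\<epsilon>. elem \<epsilon> i (ep i)) \<longlongrightarrow> 0) (at_right 0)"
proof -
  note w = well_in_period[OF assms]
  obtain x0 where x0: "x0 \<in> {wm 1..em i}" "\<And>y. y \<in> {wm 1..em i} \<Longrightarrow> S b y \<le> S b x0"
    using continuous_attains_sup[of "{wm 1..em i}" "S b"] S_continuous w by auto
  \<comment> \<open>left of the well heights count after one more turn, that is, lowered by \<open>B\<close>\<close>
  define \<eta> where "\<eta> = min (crest i - (S b x0 - B b)) (crest i - S b (em i))"
  have \<eta>: "\<eta> > 0"
    using S_less_crest_left[OF assms, of x0] x0(1) well_properties(4)[OF assms] by (simp add: \<eta>_def)
  have "elem \<epsilon> i (ep i) \<le> exp (- \<eta> / \<epsilon>) / \<epsilon>" if "\<epsilon> > 0" for \<epsilon>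
  proof (rule elem_bound[OF assms that])
    show "S b y - B b \<le> crest i - \<eta>" if "wm 1 \<le> y" "y \<le> em i" for y
      using x0(2)[of y] that by (simp add: \<eta>_def min_def)
    show "S b y \<le> crest i - \<eta>" if "em i \<le> y" "y \<le> ep i" for y
      using S_well_le(1)[OF assms that] by (simp add: \<eta>_def min_def)
  qed (use w \<eta> in auto)
  moreover have "0 \<le> elem \<epsilon> i (ep i)" if "\<epsilon> > 0" for \<epsilon>
    using elem_nonneg[OF assms that] w by simp
  ultimately show ?thesis
    by (intro tendsto_sandwich[OF _ _ tendsto_const exp_neg_inverse_over_power(1)[OF \<eta>]])
      (auto intro!: eventually_at_rightI[of 0 1])
qed

text \<open>
  The exponent vanishes exactly at the global minima of the well, which are nondegenerate and
  lie in its interior.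
\<close>

lemma scaled_mass_limit:
  assumes "i \<in> {1..N}"
  shows "((\<lambda>\<epsilon>. scaled_mass \<epsilon> i / sqrt \<epsilon>) \<longlongrightarrow> weight b wm wp i) (at_right 0)"
proof -
  define \<phi> where "\<phi> z = crest i - H b - S b z" for z
  have gm: "{x. em i \<le> x \<and> x \<le> ep i \<and> \<phi> x = 0} = global_minima b (wm i) (wp i)"
    unfolding well_properties(7)[OF assms] \<phi>_def by (intro Collect_cong) auto
  have laplace: "((\<lambda>\<epsilon>. lint (em i) (ep i) (\<lambda>y. exp (\<phi> y / \<epsilon>)) / sqrt \<epsilon>)
      \<longlongrightarrow> (\<Sum>z\<in>{x. em i \<le> x \<and> x \<le> ep i \<and> \<phi> x = 0}. sqrt (2 * pi / - deriv b z))) (at_right 0)"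
  proof (rule laplace_finitely_many_peaks)
    show "(\<phi> has_real_derivative b x) (at x)" for x
      unfolding \<phi>_def[abs_def] using S_deriv by (auto intro!: derivative_eq_intros)
    show "\<phi> x \<le> 0" if "em i \<le> x" "x \<le> ep i" for x
      using S_well_le(2)[OF assms that] by (simp add: \<phi>_def)
    show "\<phi> (em i) < 0" "\<phi> (ep i) < 0"
      using well_properties(5,8)[OF assms] by (auto simp: \<phi>_def)
    show "em i \<le> ep i" using well_properties(2)[OF assms] by simp
    show "finite {x. em i \<le> x \<and> x \<le> ep i \<and> \<phi> x = 0}"
      unfolding gm by (rule global_minima_eq(2)[OF assms])
    show "(b has_real_derivative deriv b z) (at z) \<and> deriv b z \<noteq> 0"
      if "em i \<le> z" "z \<le> ep i" "\<phi> z = 0" for z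
    proof -
      have "z \<in> {x. em i \<le> x \<and> x \<le> ep i \<and> \<phi> x = 0}" using that by simp
      then have "loc_max (\<lambda>y. - S b y) z"
        unfolding gm by (rule global_minima_eq(4)[OF assms])
      then show ?thesis using loc_min_S_curvature(1) b_nondegenerate b_deriv by blast
    qed
  qed
  show ?thesis
    using laplace[unfolded gm, unfolded \<phi>_def] unfolding scaled_mass_eq weight_def S_deriv2 .
qed

text \<open>
  Beyond the well the flux is constant, so the double integral in \<open>elem\<close> factorizes
  into an integral over the well and one over \<open>[ep i, x]\<close>. Each is of order
  \<open>sqrt \<epsilon>\<close>, and the prefactor \<open>1 / \<epsilon>\<close> is exactly
  what compensates for both.
\<close>

lemma elem_limit_right:
  assumes "i \<in> {1..N}" and "ep i \<le> x" and "x \<le> wm 1 + 1" and "S b x < crest i"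
  shows "((\<lambda>\<epsilon>. elem \<epsilon> i x) \<longlongrightarrow> weight b wm wp i * (\<Sum>y\<in>peaks i x. peak_weight y)) (at_right 0)"
proof -
  define \<phi> where "\<phi> z = S b z - crest i" for z
  note w = well_in_period[OF assms(1)]
  have le: "S b y \<le> crest i" if "ep i \<le> y" for y
    using S_valley(8)[OF assms(1), of y] well_properties(1,2)[OF assms(1)] that by simp
  have ends: "\<phi> (ep i) < 0" "\<phi> x < 0"
    using assms(4) well_properties(4,5)[OF assms(1)] by (auto simp: \<phi>_def)
  have pk: "{y. ep i \<le> y \<and> y \<le> x \<and> \<phi> y = 0} = peaks i x"
    using ends by (auto simp: \<phi>_def peaks_def order.order_iff_strict)
  have laplace: "((\<lambda>\<epsilon>. lint (ep i) x (\<lambda>y. exp (\<phi> y / \<epsilon>)) / sqrt \<epsilon>)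
      \<longlongrightarrow> (\<Sum>z\<in>{y. ep i \<le> y \<and> y \<le> x \<and> \<phi> y = 0}. sqrt (2 * pi / - (- deriv b z)))) (at_right 0)"
  proof (rule laplace_finitely_many_peaks)
    show "(\<phi> has_real_derivative - b x) (at x)" for x
      unfolding \<phi>_def[abs_def] using S_deriv by (auto intro!: derivative_eq_intros)
    show "finite {y. ep i \<le> y \<and> y \<le> x \<and> \<phi> y = 0}"
      unfolding pk by (rule finite_peaks[OF assms(1)])
    show "((\<lambda>x. - b x) has_real_derivative - deriv b z) (at z) \<and> - deriv b z \<noteq> 0"
      if "ep i \<le> z" "z \<le> x" "\<phi> z = 0" for z
      using that pk peak_properties(2)[OF assms(1), of z x] loc_max_S_curvature(1)[of z]
        b_nondegenerate[of z] S_deriv_minus by auto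
  qed (use le ends assms in \<open>auto simp: \<phi>_def\<close>)
  have peaks: "((\<lambda>\<epsilon>. lint (ep i) x (\<lambda>y. exp ((S b y - crest i) / \<epsilon>)) / sqrt \<epsilon>)
      \<longlongrightarrow> (\<Sum>y\<in>peaks i x. peak_weight y)) (at_right 0)"
    using laplace[unfolded pk, unfolded \<phi>_def] unfolding S_deriv2 .
  have eq: "elem \<epsilon> i x = elem \<epsilon> i (ep i) + scaled_mass \<epsilon> i / sqrt \<epsilon> *
      (lint (ep i) x (\<lambda>y. exp ((S b y - crest i) / \<epsilon>)) / sqrt \<epsilon>)" if "\<epsilon> > 0" for \<epsilon>
  proof -
    let ?g = "\<lambda>y. exp (S b y / \<epsilon>) * flux \<epsilon> i y"
    have "lint (ep i) x ?g = lint (ep i) x (\<lambda>y. well_mass \<epsilon> i * exp (crest i / \<epsilon>) * exp ((S b y - crest i) / \<epsilon>))"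
    proof (rule lint_cong[OF assms(2)])
      fix y assume y: "ep i < y" "y < x"
      have "flux \<epsilon> i y = well_mass \<epsilon> i"
        using flux_values(4)[OF assms(1) that, of y] y w assms(3) by simp
      then show "?g y = well_mass \<epsilon> i * exp (crest i / \<epsilon>) * exp ((S b y - crest i) / \<epsilon>)"
        by (simp add: exp_add[symmetric] diff_divide_distrib mult.assoc)
    qed
    then have "lint (ep i) x ?g
        = well_mass \<epsilon> i * exp (crest i / \<epsilon>) * lint (ep i) x (\<lambda>y. exp ((S b y - crest i) / \<epsilon>))"
      by (simp only: lint_cmult)
    moreover have "exp (- H b / \<epsilon>) * (well_mass \<epsilon> i * exp (crest i / \<epsilon>)) = scaled_mass \<epsilon> i"
      by (simp add: scaled_mass_def exp_diff diff_divide_distrib exp_minus field_simps)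
    ultimately have "exp (- H b / \<epsilon>) * lint (ep i) x ?g
        = scaled_mass \<epsilon> i * lint (ep i) x (\<lambda>y. exp ((S b y - crest i) / \<epsilon>))"
      by (simp only: mult.assoc[symmetric])
    moreover have "elem \<epsilon> i x = elem \<epsilon> i (ep i) + 1 / \<epsilon> * (exp (- H b / \<epsilon>) * lint (ep i) x ?g)"
      unfolding elem_def
      using lint_combine[OF exp_flux_locally_integrable, of "wm 1" "ep i" \<epsilon> i x, symmetric]
      by (simp add: algebra_simps)
    ultimately show ?thesis using that by (simp add: field_simps real_sqrt_mult_self)
  qed
  have "((\<lambda>\<epsilon>. elem \<epsilon> i (ep i) + scaled_mass \<epsilon> i / sqrt \<epsilon> *
      (lint (ep i) x (\<lambda>y. exp ((S b y - crest i) / \<epsilon>)) / sqrt \<epsilon>))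
      \<longlongrightarrow> 0 + weight b wm wp i * (\<Sum>y\<in>peaks i x. peak_weight y)) (at_right 0)"
    by (intro tendsto_add tendsto_mult elem_before_well scaled_mass_limit peaks assms(1))
  moreover have "\<forall>\<^sub>F \<epsilon> in at_right 0. elem \<epsilon> i x = elem \<epsilon> i (ep i) + scaled_mass \<epsilon> i / sqrt \<epsilon> *
      (lint (ep i) x (\<lambda>y. exp ((S b y - crest i) / \<epsilon>)) / sqrt \<epsilon>)"
    using eventually_at_right_less[of 0] by eventually_elim (rule eq)
  ultimately show ?thesis using tendsto_cong by fastforce
qed

text \<open>
  The limit of the \<open>i\<close>-th elementary solution on the \<open>j\<close>-th well. Only
  the saddles between the two wells that belong to the landscape of \<open>i\<close> count.
\<close>

definition level :: "int \<Rightarrow> int \<Rightarrow> real" where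
  "level i j = weight b wm wp i * (\<Sum>k\<in>{1..<j}. if i \<le> k \<and> lidx k = lidx i then saddle k else 0)"

lemma level_eq_peaks:
  assumes "i \<in> {1..N}" and "i < j" and "j \<le> N + 1"
  shows "level i j = weight b wm wp i * (\<Sum>y\<in>peaks i (em j). peak_weight y)"
proof -
  have "(\<Sum>k\<in>{1..<j}. if i \<le> k \<and> lidx k = lidx i then saddle k else 0)
      = (\<Sum>k\<in>{i..j-1}. if lidx k = lidx i then saddle k else 0)"
    using assms(1) by (intro sum.mono_neutral_cong_right) auto
  then show ?thesis
    unfolding level_def using sum_peaks[OF assms(1), of "j - 1"] assms by simp
qed

text \<open>
  Since \<open>elem\<close> is monotone, its limits at the two ends of a well determine it on
  the whole well; they agree because no peak lies between them.
\<close>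

lemma elem_limit_wells:
  assumes "i \<in> {1..N}" and "j \<in> {1..N}"
  shows "((\<lambda>\<epsilon>. elem \<epsilon> i (em j)) \<longlongrightarrow> level i j) (at_right 0)"
    and "((\<lambda>\<epsilon>. elem \<epsilon> i (ep j)) \<longlongrightarrow> level i j) (at_right 0)"
proof -
  note wi = well_in_period[OF assms(1)] and wj = well_in_period[OF assms(2)]
  have "((\<lambda>\<epsilon>. elem \<epsilon> i x) \<longlongrightarrow> level i j) (at_right 0)" if x: "x \<in> {em j, ep j}" for x
  proof (cases "i < j")
    case True
    have ej: "ep i < em j"
      using valleys_ordered[OF assms True] well_properties(3)[OF assms(1)] well_properties(1)[OF assms(2)] by simp
    have "S b y \<noteq> crest i" if "em j \<le> y" "y \<le> ep j" for y
      using S_valley_later(2)[OF assms True that] by simp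
    then have "y < em j" if "y < x" "S b y = crest i" for y
      using that x wj by (cases "y < em j") auto
    then have pk: "peaks i x = peaks i (em j)"
      using x wj by (auto simp: peaks_def)
    have "((\<lambda>\<epsilon>. elem \<epsilon> i x) \<longlongrightarrow> weight b wm wp i * (\<Sum>y\<in>peaks i x. peak_weight y)) (at_right 0)"
      using x ej wj S_valley_later(2)[OF assms True, of x] by (intro elem_limit_right assms(1)) auto
    then show ?thesis using level_eq_peaks[OF assms(1) True] assms(2) pk by simp
  next
    case False
    then have "level i j = 0" by (auto simp: level_def intro!: sum.neutral)
    moreover have "x \<le> ep i"
    proof (cases "i = j")
      case False
      then have "wp j \<le> wm i" using valleys_ordered[OF assms(2,1)] \<open>\<not> i < j\<close> by simp
      then show ?thesis
        using x wj wi well_properties(3)[OF assms(2)] well_properties(1)[OF assms(1)] by auto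
    qed (use x wj in auto)
    then have "\<forall>\<^sub>F \<epsilon> in at_right 0. 0 \<le> elem \<epsilon> i x" "\<forall>\<^sub>F \<epsilon> in at_right 0. elem \<epsilon> i x \<le> elem \<epsilon> i (ep i)"
      using x wj wi by (auto intro!: eventually_at_rightI[of 0 1] elem_nonneg elem_mono assms(1))
    then have "((\<lambda>\<epsilon>. elem \<epsilon> i x) \<longlongrightarrow> 0) (at_right 0)"
      by (rule tendsto_sandwich[OF _ _ tendsto_const elem_before_well[OF assms(1)]])
    ultimately show ?thesis by simp
  qed
  then show "((\<lambda>\<epsilon>. elem \<epsilon> i (em j)) \<longlongrightarrow> level i j) (at_right 0)"
    and "((\<lambda>\<epsilon>. elem \<epsilon> i (ep j)) \<longlongrightarrow> level i j) (at_right 0)"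
    by auto
qed

lemma elem_limit_period:
  assumes "i \<in> {1..N}"
  shows "((\<lambda>\<epsilon>. elem \<epsilon> i (wm 1 + 1)) \<longlongrightarrow> level i (N + 1)) (at_right 0)"
proof -
  have "S b (wm 1 + 1) < crest i"
    using S_valley(9)[OF assms] period_of_valleys(3)[OF assms] by simp
  then show ?thesis
    using elem_limit_right[OF assms, of "wm 1 + 1"] well_in_period[OF assms] peaks_of_period[OF assms]
      level_eq_peaks[OF assms, of "N + 1"] assms by simp
qed

end

section \<open>The stationary measure\<close>

context drift
begin

text \<open>
  \<open>exp (- S x / \<epsilon>) * window \<epsilon> x\<close> is the unnormalized stationary
  density.
\<close>

definition window :: "real \<Rightarrow> real \<Rightarrow> real" where
  "window \<epsilon> x = lint x (x + 1) (\<lambda>y. exp (S b y / \<epsilon>))"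

lemma window_deriv:
  "(window \<epsilon> has_real_derivative - (1 - exp (- B b / \<epsilon>)) * exp (S b x / \<epsilon>)) (at x)"
proof -
  let ?g = "\<lambda>y. exp (S b y / \<epsilon>)"
  have cont: "isCont ?g y" for y
    using exp_S_continuous(1)[of UNIV] by (simp add: continuous_on_eq_continuous_at)
  have "window \<epsilon> = (\<lambda>x. lint 0 (x + 1) ?g - lint 0 x ?g)"
    unfolding window_def[abs_def] fun_eq_iff
    using lint_combine[OF exp_S_locally_integrable] by (metis add_diff_cancel_left')
  moreover have "((\<lambda>x. lint 0 (x + 1) ?g) has_real_derivative ?g (x + 1)) (at x)"
    by (rule iffD1[OF DERIV_shift]) (rule lint_has_derivative[OF exp_S_locally_integrable cont])
  then have "((\<lambda>x. lint 0 (x + 1) ?g - lint 0 x ?g) has_real_derivative ?g (x + 1) - ?g x) (at x)"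
    by (rule DERIV_diff) (rule lint_has_derivative[OF exp_S_locally_integrable cont])
  ultimately show ?thesis
    unfolding exp_S_add_1 by (simp add: algebra_simps)
qed

lemma window_continuous: "continuous_on A (window \<epsilon>)"
  using window_deriv by (meson DERIV_isCont continuous_at_imp_continuous_on)

lemma window_pos: "window \<epsilon> x > 0"
  unfolding window_def using exp_S_continuous(1) by (intro lint_pos) auto

lemma window_add_1: "window \<epsilon> (x + 1) = exp (- B b / \<epsilon>) * window \<epsilon> x"
proof -
  have "window \<epsilon> (x + 1) = lint x (x + 1) (\<lambda>y. exp (S b (y + 1) / \<epsilon>))"
    unfolding window_def by (rule lint_shift[OF exp_S_locally_integrable])
  then show ?thesis by (simp only: exp_S_add_1 lint_cmult window_def)
qed

lemma pi_eps_eq: "pi_eps b \<epsilon> x = exp (- S b x / \<epsilon>) * window \<epsilon> x"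
proof -
  have "pi_eps b \<epsilon> x = lint x (x + 1) (\<lambda>y. exp (- S b x / \<epsilon>) * exp (S b y / \<epsilon>))"
    unfolding pi_eps_def by (simp add: exp_add[symmetric] diff_divide_distrib)
  then show ?thesis by (simp only: lint_cmult window_def)
qed

lemma pi_eps_periodic: "pi_eps b \<epsilon> (x + 1) = pi_eps b \<epsilon> x"
  unfolding pi_eps_eq exp_S_add_1 window_add_1 by (simp add: exp_minus)

lemma pi_eps_continuous: "continuous_on A (pi_eps b \<epsilon>)"
  unfolding pi_eps_eq[abs_def] by (intro continuous_intros exp_S_continuous window_continuous)

definition normalization :: "real \<Rightarrow> real" where
  "normalization \<epsilon> = lint 0 1 (pi_eps b \<epsilon>)"

lemma normalization_pos: "normalization \<epsilon> > 0"
  unfolding normalization_def using pi_eps_continuous window_pos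
  by (intro lint_pos) (auto simp: pi_eps_eq)

text \<open>
  The density of the stationary measure is \<open>pi_eps\<close> up to normalization, and by
  periodicity the period over which it is integrated may start anywhere.
\<close>

lemma integral_mu_eps:
  assumes "g \<in> borel_measurable borel" and "\<And>x. \<bar>g x\<bar> \<le> D" and "\<And>x. g (x + 1) = g x"
  shows "integral\<^sup>L (mu_eps b \<epsilon>) g = lint w (w + 1) (\<lambda>x. g x * pi_eps b \<epsilon> x) / normalization \<epsilon>"
proof -
  have m: "m_eps b \<epsilon> = (\<lambda>x. pi_eps b \<epsilon> x / normalization \<epsilon>)"
    by (simp add: m_eps_def normalization_def fun_eq_iff zero_ereal_def one_ereal_def)
  have mc: "continuous_on UNIV (m_eps b \<epsilon>)"
    unfolding m divide_inverse by (intro continuous_intros pi_eps_continuous)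
  have mm: "m_eps b \<epsilon> \<in> borel_measurable borel"
    using mc by (simp add: borel_measurable_continuous_onI)
  have mn: "m_eps b \<epsilon> x \<ge> 0" for x
    using normalization_pos[of \<epsilon>] window_pos[of \<epsilon> x] by (simp add: m pi_eps_eq less_imp_le)
  have "integral\<^sup>L (mu_eps b \<epsilon>) g
      = integral\<^sup>L (restrict_space lborel {0..<1}) (\<lambda>x. m_eps b \<epsilon> x *\<^sub>R g x)"
    unfolding mu_eps_def
    using mm mn assms(1) by (intro integral_density) (auto intro: measurable_restrict_space1)
  also have "\<dots> = (LINT x:{0..<1}|lborel. m_eps b \<epsilon> x * g x)"
    by (subst integral_restrict_space) (auto simp: set_lebesgue_integral_def)
  also have "\<dots> = lint 0 1 (\<lambda>x. g x * m_eps b \<epsilon> x)"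
    by (simp add: interval_integral_Ico mult.commute)
  also have "\<dots> = lint w (w + 1) (\<lambda>x. g x * m_eps b \<epsilon> x)"
  proof (rule lint_period[symmetric])
    show "locally_integrable (\<lambda>x. g x * m_eps b \<epsilon> x)"
      using assms(1,2) mc by (rule locally_integrable_bounded_mult)
    show "g (x + 1) * m_eps b \<epsilon> (x + 1) = g x * m_eps b \<epsilon> x" for x
      by (simp add: assms(3) m pi_eps_periodic)
  qed
  also have "\<dots> = lint w (w + 1) (\<lambda>x. inverse (normalization \<epsilon>) * (g x * pi_eps b \<epsilon> x))"
    by (simp add: m divide_inverse mult_ac)
  also have "\<dots> = inverse (normalization \<epsilon>) * lint w (w + 1) (\<lambda>x. g x * pi_eps b \<epsilon> x)"
    by (rule lint_cmult)
  finally show ?thesis by (simp add: divide_inverse mult.commute)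
qed

end

context metastable_drift
begin

lemma isCont_chi:
  assumes "i \<in> {1..N}" and "y \<in> {wm 1<..<wm 1 + 1} - {em i, ep i}"
  shows "isCont (chi i) y"
proof -
  define A c where "A = (if y < em i then {wm 1<..<em i} else if y < ep i then {em i<..<ep i}
    else {ep i<..<wm 1 + 1})" and "c = (if y < em i \<or> y > ep i then 0 else 1 :: real)"
  note w = well_in_period[OF assms(1)]
  have "\<forall>\<^sub>F z in nhds y. z \<in> A"
    using assms(2) by (intro eventually_nhds_in_open) (auto simp: A_def)
  then have "\<forall>\<^sub>F z in nhds y. chi i z = c"
    by eventually_elim
      (use assms w chi_eq[OF assms(1)] in \<open>auto simp: A_def c_def indicator_def split: if_splits\<close>)
  then show ?thesis using isCont_cong[of "chi i" "\<lambda>_. c"] by simp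
qed

text \<open>
  Integration by parts against \<open>window\<close>, a primitive of a multiple of \<open>exp (S / \<epsilon>)\<close>, turns the
  total increment of an elementary solution over one period into the mass that the stationary
  measure gives to the well, up to a factor that is the same for all wells.
\<close>

lemma lint_flux_eq:
  assumes "i \<in> {1..N}"
  shows "lint (wm 1) (wm 1 + 1) (\<lambda>y. exp (S b y / \<epsilon>) * flux \<epsilon> i y)
    = lint (wm 1) (wm 1 + 1) (\<lambda>y. chi i y * pi_eps b \<epsilon> y)"
proof -
  define e where "e = exp (- B b / \<epsilon>)"
  let ?w = "wm 1"
  let ?E = "\<lambda>y. exp (S b y / \<epsilon>)"
  let ?g = "\<lambda>y. - (1 - e) * (?E y * mass \<epsilon> i y) + 1 * (chi i y * pi_eps b \<epsilon> y)"
  have l1: "locally_integrable (\<lambda>y. ?E y * mass \<epsilon> i y)"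
    by (intro locally_integrable_continuous continuous_intros exp_S_continuous mass_continuous)
  have l2: "locally_integrable (\<lambda>y. chi i y * pi_eps b \<epsilon> y)"
    using chi_measurable chi_bound pi_eps_continuous by (rule locally_integrable_bounded_mult)
  have "(?g has_integral window \<epsilon> (?w + 1) * mass \<epsilon> i (?w + 1) - window \<epsilon> ?w * mass \<epsilon> i ?w) {?w..?w+1}"
  proof (rule fundamental_theorem_of_calculus_interior_strong)
    show "continuous_on {?w..?w+1} (\<lambda>y. window \<epsilon> y * mass \<epsilon> i y)"
      by (intro continuous_intros window_continuous mass_continuous)
    fix y assume y: "y \<in> {?w<..<?w+1} - {em i, ep i}"
    have "isCont (\<lambda>z. exp (- S b z / \<epsilon>)) y"
      using exp_S_continuous(2)[of UNIV] by (simp add: continuous_on_eq_continuous_at)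
    then have "(mass \<epsilon> i has_real_derivative chi i y * exp (- S b y / \<epsilon>)) (at y)"
      unfolding mass_def[abs_def] using isCont_chi[OF assms y]
      by (intro lint_has_derivative chi_weighted_locally_integrable isCont_mult)
    from DERIV_mult[OF window_deriv this]
    have "((\<lambda>y. window \<epsilon> y * mass \<epsilon> i y) has_real_derivative ?g y) (at y)"
      by (rule back_subst[of "\<lambda>d. (_ has_real_derivative d) (at y)"])
        (simp add: pi_eps_eq e_def algebra_simps)
    then show "((\<lambda>y. window \<epsilon> y * mass \<epsilon> i y) has_vector_derivative ?g y) (at y)"
      by (simp add: has_real_derivative_iff_has_vector_derivative)
  qed auto
  then have "lint ?w (?w + 1) ?g = e * window \<epsilon> ?w * mass \<epsilon> i (?w + 1)"
    using lint_eq_integral[OF lint_add(1)[OF l1 l2], of ?w "?w + 1" "- (1 - e)" 1]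
    by (simp add: integral_unique window_add_1 mass_def e_def)
  then have "lint ?w (?w + 1) (\<lambda>y. chi i y * pi_eps b \<epsilon> y)
      = (1 - e) * lint ?w (?w + 1) (\<lambda>y. ?E y * mass \<epsilon> i y) + e * mass \<epsilon> i (?w + 1) * window \<epsilon> ?w"
    unfolding lint_add(2)[OF l1 l2] by (simp add: algebra_simps)
  also have "\<dots> = lint ?w (?w + 1) (\<lambda>y. (1 - e) * (?E y * mass \<epsilon> i y) + e * mass \<epsilon> i (?w + 1) * ?E y)"
    unfolding lint_add(2)[OF l1 exp_S_locally_integrable] window_def ..
  also have "(\<lambda>y. (1 - e) * (?E y * mass \<epsilon> i y) + e * mass \<epsilon> i (?w + 1) * ?E y)
      = (\<lambda>y. ?E y * flux \<epsilon> i y)"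
    by (simp add: flux_def e_def fun_eq_iff algebra_simps)
  finally show ?thesis ..
qed

lemma integral_mu_eps_chi:
  assumes "i \<in> {1..N}" and "\<epsilon> > 0"
  shows "integral\<^sup>L (mu_eps b \<epsilon>) (chi i)
    = \<epsilon> * exp (H b / \<epsilon>) / normalization \<epsilon> * elem \<epsilon> i (wm 1 + 1)"
proof -
  have "integral\<^sup>L (mu_eps b \<epsilon>) (chi i)
      = lint (wm 1) (wm 1 + 1) (\<lambda>x. chi i x * pi_eps b \<epsilon> x) / normalization \<epsilon>"
    by (rule integral_mu_eps[OF chi_measurable chi_bound chi_periodic])
  then show ?thesis
    using assms(2) unfolding lint_flux_eq[OF assms(1), symmetric]
    by (simp add: elem_def exp_minus)
qed

section \<open>The explicit solution as a combination of elementary solutions\<close>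

definition comb :: "(int \<Rightarrow> real) \<Rightarrow> real \<Rightarrow> real" where
  "comb \<gamma> z = (\<Sum>i\<in>{1..N}. \<gamma> i * chi i z)"

lemma comb_measurable: "comb \<gamma> \<in> borel_measurable borel"
  unfolding comb_def[abs_def] using chi_measurable by measurable

lemma comb_bound: "\<bar>comb \<gamma> z\<bar> \<le> (\<Sum>i\<in>{1..N}. \<bar>\<gamma> i\<bar>)"
  unfolding comb_def
proof (rule order_trans[OF sum_abs sum_mono])
  show "\<bar>\<gamma> i * chi i z\<bar> \<le> \<bar>\<gamma> i\<bar>" for i
    using chi_bound[of i z] by (simp add: abs_mult mult_left_le)
qed

lemma comb_periodic: "comb \<gamma> (z + 1) = comb \<gamma> z"
  by (simp add: comb_def chi_periodic)

lemma integral_mu_eps_comb: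
  assumes "\<epsilon> > 0"
  shows "integral\<^sup>L (mu_eps b \<epsilon>) (comb \<gamma>) = (\<Sum>i\<in>{1..N}. \<gamma> i * integral\<^sup>L (mu_eps b \<epsilon>) (chi i))"
proof -
  have l: "locally_integrable (\<lambda>y. chi i y * pi_eps b \<epsilon> y)" for i
    using chi_measurable chi_bound pi_eps_continuous by (rule locally_integrable_bounded_mult)
  have "integral\<^sup>L (mu_eps b \<epsilon>) (comb \<gamma>) = lint 0 (0 + 1) (\<lambda>x. comb \<gamma> x * pi_eps b \<epsilon> x) / normalization \<epsilon>"
    by (rule integral_mu_eps[OF comb_measurable comb_bound comb_periodic])
  also have "(\<lambda>x. comb \<gamma> x * pi_eps b \<epsilon> x) = (\<lambda>x. \<Sum>i\<in>{1..N}. \<gamma> i * (chi i x * pi_eps b \<epsilon> x))"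
    by (simp add: comb_def sum_distrib_right mult.assoc fun_eq_iff)
  also have "lint 0 (0 + 1) \<dots> / normalization \<epsilon>
      = (\<Sum>i\<in>{1..N}. \<gamma> i * (lint 0 (0 + 1) (\<lambda>x. chi i x * pi_eps b \<epsilon> x) / normalization \<epsilon>))"
    by (subst lint_sum(2)[OF _ l]) (simp_all add: sum_divide_distrib)
  also have "\<dots> = (\<Sum>i\<in>{1..N}. \<gamma> i * integral\<^sup>L (mu_eps b \<epsilon>) (chi i))"
    by (simp only: integral_mu_eps[OF chi_measurable chi_bound chi_periodic, of \<epsilon> _ 0])
  finally show ?thesis .
qed

text \<open>
  The formula is linear in the right-hand side, and for a single well its constant
  \<open>a(\<epsilon>)\<close> combines with the inner integral to the flux.
\<close>

lemma f_formula_comb: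
  assumes "\<epsilon> > 0"
  shows "f_formula b \<epsilon> (wm 1) c (comb \<gamma>) x
    = c + 1 / (1 - exp (- B b / \<epsilon>)) * (\<Sum>i\<in>{1..N}. \<gamma> i * elem \<epsilon> i x)"
proof -
  define e where "e = exp (- B b / \<epsilon>)"
  have e: "0 < e" "e < 1" using B_pos assms by (auto simp: e_def)
  have e': "exp (B b / \<epsilon>) = 1 / e"
    by (simp add: e_def exp_minus inverse_eq_divide)
  define h where "h = 1 / \<epsilon> * exp (- H b / \<epsilon>)"
  let ?E = "\<lambda>y. exp (S b y / \<epsilon>)"
  define P where "P = lint (wm 1) x ?E"
  define A where "A i = lint (wm 1) x (\<lambda>y. ?E y * mass \<epsilon> i y)" for i
  define m1 where "m1 i = mass \<epsilon> i (wm 1 + 1)" for i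
  have l: "locally_integrable (\<lambda>y. ?E y * mass \<epsilon> i y)" for i
    by (intro locally_integrable_continuous continuous_intros exp_S_continuous mass_continuous)
  have prim: "lint (wm 1) y (\<lambda>z. comb \<gamma> z * exp (- S b z / \<epsilon>)) = (\<Sum>i\<in>{1..N}. \<gamma> i * mass \<epsilon> i y)" for y
  proof -
    have "(\<lambda>z. comb \<gamma> z * exp (- S b z / \<epsilon>)) = (\<lambda>z. \<Sum>i\<in>{1..N}. \<gamma> i * (chi i z * exp (- S b z / \<epsilon>)))"
      by (simp add: comb_def sum_distrib_right mult.assoc fun_eq_iff)
    then show ?thesis
      using lint_sum(2)[OF _ chi_weighted_locally_integrable, of "{1..N}"] by (simp add: mass_def)
  qed
  have outer: "lint (wm 1) x (\<lambda>y. ?E y * (\<Sum>i\<in>{1..N}. \<gamma> i * mass \<epsilon> i y)) = (\<Sum>i\<in>{1..N}. \<gamma> i * A i)"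
  proof -
    have "(\<lambda>y. ?E y * (\<Sum>i\<in>{1..N}. \<gamma> i * mass \<epsilon> i y)) = (\<lambda>y. \<Sum>i\<in>{1..N}. \<gamma> i * (?E y * mass \<epsilon> i y))"
      by (simp add: sum_distrib_left mult.left_commute fun_eq_iff)
    then show ?thesis using lint_sum(2)[OF _ l, of "{1..N}"] by (simp add: A_def)
  qed
  have a: "a_eps b \<epsilon> (wm 1) (comb \<gamma>) = e / (1 - e) * h * (\<Sum>i\<in>{1..N}. \<gamma> i * m1 i)"
  proof -
    have "1 / (1 / e - 1) = e / (1 - e)" using e by (simp add: field_simps)
    then show ?thesis
      unfolding a_eps_def add.commute[of 1] prim e' h_def m1_def by simp
  qed
  have el: "elem \<epsilon> i x = h * ((1 - e) * A i + e * m1 i * P)" for i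
  proof -
    have "(\<lambda>y. ?E y * flux \<epsilon> i y) = (\<lambda>y. (1 - e) * (?E y * mass \<epsilon> i y) + e * m1 i * ?E y)"
      by (simp add: flux_def e_def m1_def fun_eq_iff algebra_simps)
    then show ?thesis
      unfolding elem_def by (simp only: lint_add(2)[OF l exp_S_locally_integrable] A_def P_def h_def)
  qed
  have "(\<Sum>i\<in>{1..N}. \<gamma> i * elem \<epsilon> i x)
      = h * ((1 - e) * (\<Sum>i\<in>{1..N}. \<gamma> i * A i) + e * P * (\<Sum>i\<in>{1..N}. \<gamma> i * m1 i))"
    unfolding el by (simp add: sum_distrib_left sum.distrib[symmetric] algebra_simps)
  then have "1 / (1 - e) * (\<Sum>i\<in>{1..N}. \<gamma> i * elem \<epsilon> i x)
      = h * (\<Sum>i\<in>{1..N}. \<gamma> i * A i) + e / (1 - e) * h * (\<Sum>i\<in>{1..N}. \<gamma> i * m1 i) * P"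
    using e by (simp add: field_simps)
  then show ?thesis
    unfolding f_formula_def prim outer a e_def[symmetric] h_def[symmetric] P_def[symmetric] by simp
qed

section \<open>The reduced generator\<close>

abbreviation gen :: "(int \<Rightarrow> real) \<Rightarrow> int \<Rightarrow> real" where
  "gen \<equiv> reduced_gen b L N wm wp em ep"

abbreviation wt :: "int \<Rightarrow> real" where
  "wt \<equiv> weight b wm wp"

lemma wrap_id: "j \<in> {1..N} \<Longrightarrow> wrap N j = j"
  by (simp add: wrap_def)

lemma wrap_end: "wrap N (N + 1) = 1"
  by (simp add: wrap_def)

lemma weight_gen:
  assumes "j \<in> {1..N}"
  shows "wt j * gen F j = (F (wrap N (j + 1)) - F j) / saddle j
    - (if is_leftmost_deepest b L (wm j) (wp j) then 0 else (F j - F (wrap N (j - 1))) / saddle (j - 1))"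
proof -
  have "gen F j = rate b L wm wp em ep j (j + 1) * (F (wrap N (j + 1)) - F j)
      + rate b L wm wp em ep j (j - 1) * (F (wrap N (j - 1)) - F j)"
    by (simp add: reduced_gen_def wrap_id[OF assms])
  moreover have "wt j \<noteq> 0"
    using weight_pos[OF assms] by simp
  ultimately show ?thesis
    by (simp add: rate_def distrib_left right_diff_distrib diff_divide_distrib)
qed

text \<open>
  Summation by parts: the contributions of the wells up to \<open>k\<close> in the landscape of \<open>k\<close> telescope,
  because the left-most of them has no rate to the left.
\<close>

lemma sum_weight_gen:
  assumes "1 \<le> k" and "k \<le> N"
  shows "(\<Sum>i\<in>{1..k}. if lidx i = lidx k then wt i * gen F i else 0)
    = (F (wrap N (k + 1)) - F k) / saddle k"
  using assms
proof (induction k rule: int_ge_induct)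
  case base
  then show ?case using weight_gen[OF one_in_range] first_leftmost by simp
next
  case (step k)
  have k: "k \<in> {1..N}" "k + 1 \<in> {1..N}" "k + 1 \<noteq> 1" using step by auto
  have split: "{1..k+1} = insert (k + 1) {1..k}" using step by auto
  have eq: "(\<Sum>i\<in>{1..k+1}. if lidx i = lidx (k + 1) then wt i * gen F i else 0)
      = wt (k + 1) * gen F (k + 1) + (\<Sum>i\<in>{1..k}. if lidx i = lidx (k + 1) then wt i * gen F i else 0)"
    unfolding split by simp
  show ?case
  proof (cases "lidx k = lidx (k + 1)")
    case True
    then have "\<not> is_leftmost_deepest b L (wm (k + 1)) (wp (k + 1))"
      using leftmost_iff[OF k(2,3)] by simp
    moreover have "(\<Sum>i\<in>{1..k}. if lidx i = lidx (k + 1) then wt i * gen F i else 0)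
        = (F (k + 1) - F k) / saddle k"
      using step True wrap_id[OF k(2)] by simp
    ultimately show ?thesis
      unfolding eq using weight_gen[OF k(2), of F] wrap_id[OF k(1)] by simp
  next
    case False
    then have left: "is_leftmost_deepest b L (wm (k + 1)) (wp (k + 1))"
      using leftmost_iff[OF k(2,3)] by simp
    have "lidx i \<noteq> lidx (k + 1)" if "i \<in> {1..k}" for i
      using lidx_mono[of i k] lidx_mono[OF k(1,2)] that k False by force
    then have "(\<Sum>i\<in>{1..k}. if lidx i = lidx (k + 1) then wt i * gen F i else 0) = 0"
      by (intro sum.neutral) auto
    then show ?thesis unfolding eq using weight_gen[OF k(2), of F] left by simp
  qed
qed

text \<open>
  Interchange the two summations: the inner sum is the one of the preceding lemma and cancels
  the factor \<open>saddle k\<close>, and the outer one telescopes along \<open>F\<close>. For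
  \<open>j = N + 1\<close> the result is 0, which is the fact that \<open>gen F\<close> has mean
  zero for the stationary state of the reduced chain.
\<close>

lemma sum_gen_level:
  assumes "1 \<le> j" and "j \<le> N + 1"
  shows "(\<Sum>i\<in>{1..N}. gen F i * level i j) = F (wrap N j) - F 1"
proof -
  have "(\<Sum>i\<in>{1..N}. gen F i * level i j)
      = (\<Sum>i\<in>{1..N}. \<Sum>k\<in>{1..<j}. if i \<le> k \<and> lidx k = lidx i then saddle k * (wt i * gen F i) else 0)"
    unfolding level_def sum_distrib_left by (intro sum.cong refl) (simp add: mult_ac)
  also have "\<dots> = (\<Sum>k\<in>{1..<j}. \<Sum>i\<in>{1..N}. if i \<le> k \<and> lidx k = lidx i then saddle k * (wt i * gen F i) else 0)"
    by (rule sum.swap)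
  also have "\<dots> = (\<Sum>k\<in>{1..<j}. F (wrap N (k + 1)) - F (wrap N k))"
  proof (rule sum.cong[OF refl])
    fix k assume "k \<in> {1..<j}"
    then have k: "k \<in> {1..N}" using assms by auto
    have "(\<Sum>i\<in>{1..N}. if i \<le> k \<and> lidx k = lidx i then saddle k * (wt i * gen F i) else 0)
        = (\<Sum>i\<in>{1..k}. saddle k * (if lidx i = lidx k then wt i * gen F i else 0))"
      using k by (intro sum.mono_neutral_cong_right) auto
    also have "\<dots> = F (wrap N (k + 1)) - F k"
      unfolding sum_distrib_left[symmetric] using sum_weight_gen[of k F] k saddle_eq(2)[OF k] by simp
    finally show "(\<Sum>i\<in>{1..N}. if i \<le> k \<and> lidx k = lidx i then saddle k * (wt i * gen F i) else 0)
        = F (wrap N (k + 1)) - F (wrap N k)"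
      by (simp add: wrap_id[OF k])
  qed
  also have "\<dots> = F (wrap N j) - F (wrap N 1)"
    using assms(1)
  proof (induction j rule: int_ge_induct)
    case (step j)
    have "{1..<j+1} = insert j {1..<j}" using step by auto
    then show ?case using step by simp
  qed simp
  finally show ?thesis by (simp add: wrap_id[OF one_in_range])
qed

section \<open>Uniform bound and convergence\<close>

definition prefactor :: "real \<Rightarrow> real" where
  "prefactor \<epsilon> = 1 / (1 - exp (- B b / \<epsilon>))"

text \<open>
  Up to the factor \<open>prefactor \<epsilon>\<close>, the amount by which the formula with the
  uncorrected right-hand side fails to be periodic.
\<close>

definition defect :: "(int \<Rightarrow> real) \<Rightarrow> real \<Rightarrow> real" where
  "defect F \<epsilon> = (\<Sum>i\<in>{1..N}. gen F i * elem \<epsilon> i (wm 1 + 1))"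

definition spread :: "(int \<Rightarrow> real) \<Rightarrow> real \<Rightarrow> real" where
  "spread F \<epsilon> = (\<Sum>i\<in>{1..N}. \<bar>gen F i\<bar> * elem \<epsilon> i (wm 1 + 1))"

abbreviation r_of :: "(int \<Rightarrow> real) \<Rightarrow> real \<Rightarrow> real" where
  "r_of \<equiv> r_eps b L N wm wp em ep"

abbreviation f_of :: "(int \<Rightarrow> real) \<Rightarrow> real \<Rightarrow> real \<Rightarrow> real" where
  "f_of \<equiv> f_eps b L N wm wp em ep"

lemma prefactor_bounds:
  assumes "0 < \<epsilon>" and "\<epsilon> < 1"
  shows "0 < prefactor \<epsilon>" "prefactor \<epsilon> \<le> prefactor 1"
proof -
  have "B b \<le> B b / \<epsilon>"
    using assms B_pos by (simp add: le_divide_eq mult_left_le)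
  then have "exp (- B b / \<epsilon>) \<le> exp (- B b / 1)" by simp
  moreover have "exp (- B b / 1) < 1" using B_pos by simp
  ultimately show "0 < prefactor \<epsilon>" "prefactor \<epsilon> \<le> prefactor 1"
    by (auto simp: prefactor_def intro!: divide_left_mono mult_pos_pos)
qed

lemma prefactor_limit: "(prefactor \<longlongrightarrow> 1) (at_right 0)"
proof -
  have "((\<lambda>\<epsilon>. 1 / (1 - exp (- c / \<epsilon>))) \<longlongrightarrow> 1) (at_right 0)" if "c > 0" for c :: real
    using that by real_asymp
  then show ?thesis unfolding prefactor_def[abs_def] using B_pos by blast
qed

lemma g_rhs_eq_comb: "g_rhs b L N wm wp em ep F = comb (gen F)"
  by (simp add: g_rhs_def well_step_def comb_def chi_def fun_eq_iff)

text \<open>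
  By its definition \<open>r(\<epsilon>)\<close> is a quotient of stationary means, which are
  proportional to the total increments of the elementary solutions. Since these are
  nondecreasing, the product form bounds the correction
  \<open>r(\<epsilon>) * elem \<epsilon> 1 x\<close> by the defect, uniformly in
  \<open>x\<close>.
\<close>

lemma r_of_eq:
  assumes "\<epsilon> > 0"
  shows "r_of F \<epsilon> * elem \<epsilon> 1 (wm 1 + 1) = defect F \<epsilon>"
proof -
  define c where "c = \<epsilon> * exp (H b / \<epsilon>) / normalization \<epsilon>"
  have c: "c > 0" using assms normalization_pos[of \<epsilon>] by (simp add: c_def)
  have "measure (mu_eps b \<epsilon>) (torus_well em ep 1 \<inter> {0..<1}) = integral\<^sup>L (mu_eps b \<epsilon>) (chi 1)"
    by (simp add: chi_def mu_eps_def space_restrict_space)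
  then have d: "measure (mu_eps b \<epsilon>) (torus_well em ep 1 \<inter> {0..<1}) = c * elem \<epsilon> 1 (wm 1 + 1)"
    using integral_mu_eps_chi[OF one_in_range assms] by (simp add: c_def)
  have "integral\<^sup>L (mu_eps b \<epsilon>) (comb (gen F)) = (\<Sum>i\<in>{1..N}. gen F i * (c * elem \<epsilon> i (wm 1 + 1)))"
    unfolding integral_mu_eps_comb[OF assms]
    by (intro sum.cong refl) (simp add: integral_mu_eps_chi assms c_def)
  also have "\<dots> = c * defect F \<epsilon>"
    by (simp add: defect_def sum_distrib_left mult_ac)
  finally show ?thesis
    unfolding r_eps_def g_rhs_eq_comb d using c elem_pos[OF one_in_range assms] by simp
qed

text \<open>
  The values on the wells of the right-hand side after its mean has been removed by a correction
  on the first well.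
\<close>

definition corrected :: "(int \<Rightarrow> real) \<Rightarrow> real \<Rightarrow> int \<Rightarrow> real" where
  "corrected F \<epsilon> i = gen F i - (if i = 1 then r_of F \<epsilon> else 0)"

lemma sum_corrected:
  "(\<Sum>i\<in>{1..N}. corrected F \<epsilon> i * h i) = (\<Sum>i\<in>{1..N}. gen F i * h i) - r_of F \<epsilon> * h 1"
proof -
  have "(\<Sum>i\<in>{1..N}. (if i = 1 then r_of F \<epsilon> else 0) * h i) = (\<Sum>i\<in>{1..N}. if i = 1 then r_of F \<epsilon> * h 1 else 0)"
    by (intro sum.cong) auto
  also have "\<dots> = r_of F \<epsilon> * h 1"
    using one_in_range by (simp only: sum.delta finite_atLeastAtMost_int if_True)
  finally show ?thesis
    by (simp add: corrected_def left_diff_distrib sum_subtractf)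
qed

lemma gbar_eq_comb: "gbar b L N wm wp em ep F \<epsilon> = comb (corrected F \<epsilon>)"
  by (simp add: gbar_def g_rhs_eq_comb comb_def sum_corrected fun_eq_iff) (simp add: chi_def)

lemma f_of_eq:
  assumes "\<epsilon> > 0"
  shows "f_of F \<epsilon> x = F 1 + prefactor \<epsilon> * ((\<Sum>i\<in>{1..N}. gen F i * elem \<epsilon> i x) - r_of F \<epsilon> * elem \<epsilon> 1 x)"
  unfolding f_eps_def gbar_eq_comb f_formula_comb[OF assms] sum_corrected prefactor_def ..

lemma f_of_period:
  assumes "\<epsilon> > 0"
  shows "f_of F \<epsilon> (wm 1 + 1) = f_of F \<epsilon> (wm 1)"
  using r_of_eq[OF assms, of F] by (simp add: f_of_eq[OF assms] elem_start defect_def)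

lemma f_of_solves:
  assumes "\<epsilon> > 0"
  shows "periodic_ext (wm 1) (f_of F \<epsilon>) = f_of F \<epsilon>"
    and "solves_elliptic b \<epsilon> (f_of F \<epsilon>) (gbar b L N wm wp em ep F \<epsilon>)"
  using solves_elliptic_f_formula[OF assms comb_measurable comb_bound comb_periodic] f_of_period[OF assms]
  unfolding f_eps_def gbar_eq_comb by blast+

lemma f_of_bound:
  assumes "\<epsilon> > 0" and "\<epsilon> < 1" and "wm 1 \<le> x" and "x \<le> wm 1 + 1"
  shows "\<bar>f_of F \<epsilon> x\<bar> \<le> \<bar>F 1\<bar> + prefactor 1 * (2 * spread F \<epsilon>)"
proof -
  have el: "0 \<le> elem \<epsilon> i x" "elem \<epsilon> i x \<le> elem \<epsilon> i (wm 1 + 1)" if "i \<in> {1..N}" for i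
    using elem_nonneg[OF that assms(1,3,4)] elem_mono[OF that assms(1,3,4)] by auto
  have "\<bar>\<Sum>i\<in>{1..N}. gen F i * elem \<epsilon> i x\<bar> \<le> spread F \<epsilon>"
    unfolding spread_def
    by (rule order_trans[OF sum_abs sum_mono]) (use el in \<open>auto simp: abs_mult intro!: mult_left_mono\<close>)
  moreover have "\<bar>r_of F \<epsilon> * elem \<epsilon> 1 x\<bar> \<le> spread F \<epsilon>"
  proof -
    have "\<bar>r_of F \<epsilon> * elem \<epsilon> 1 x\<bar> \<le> \<bar>r_of F \<epsilon> * elem \<epsilon> 1 (wm 1 + 1)\<bar>"
      using el[OF one_in_range] by (auto simp: abs_mult intro!: mult_left_mono)
    also have "\<dots> \<le> spread F \<epsilon>"
      unfolding r_of_eq[OF assms(1)] defect_def spread_def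
      by (rule order_trans[OF sum_abs sum_mono])
        (use elem_pos[OF _ assms(1)] in \<open>auto simp: abs_mult less_imp_le\<close>)
    finally show ?thesis .
  qed
  ultimately have "\<bar>(\<Sum>i\<in>{1..N}. gen F i * elem \<epsilon> i x) - r_of F \<epsilon> * elem \<epsilon> 1 x\<bar> \<le> 2 * spread F \<epsilon>"
    by linarith
  then have "\<bar>prefactor \<epsilon> * ((\<Sum>i\<in>{1..N}. gen F i * elem \<epsilon> i x) - r_of F \<epsilon> * elem \<epsilon> 1 x)\<bar>
      \<le> prefactor 1 * (2 * spread F \<epsilon>)"
    unfolding abs_mult using prefactor_bounds[OF assms(1,2)] by (intro mult_mono) auto
  then show ?thesis unfolding f_of_eq[OF assms(1)] by linarith
qed

text \<open>
  Near 0 the function converges; away from 0 the bound \<open>1 / \<epsilon>\<close> on each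
  elementary solution suffices.
\<close>

lemma spread_bounded: "\<exists>C. \<forall>\<epsilon>\<in>{0<..<1}. spread F \<epsilon> \<le> C"
proof -
  define l where "l = (\<Sum>i\<in>{1..N}. \<bar>gen F i\<bar> * level i (N + 1))"
  have "(spread F \<longlongrightarrow> l) (at_right 0)"
    unfolding spread_def[abs_def] l_def by (intro tendsto_intros elem_limit_period)
  then have "\<forall>\<^sub>F \<epsilon> in at_right 0. spread F \<epsilon> < l + 1"
    by (rule order_tendstoD) simp
  then obtain \<epsilon>0 where \<epsilon>0: "\<epsilon>0 > 0" "\<And>\<epsilon>. 0 < \<epsilon> \<Longrightarrow> \<epsilon> < \<epsilon>0 \<Longrightarrow> spread F \<epsilon> < l + 1"
    by (auto simp: eventually_at_right_field)
  define C where "C = (\<Sum>i\<in>{1..N}. \<bar>gen F i\<bar> * (1 / \<epsilon>0))"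
  have "spread F \<epsilon> \<le> max (l + 1) C" if "\<epsilon> \<in> {0<..<1}" for \<epsilon>
  proof (cases "\<epsilon> < \<epsilon>0")
    case True
    then show ?thesis using \<epsilon>0(2)[of \<epsilon>] that by simp
  next
    case False
    have "spread F \<epsilon> \<le> C"
      unfolding spread_def C_def
    proof (intro sum_mono mult_left_mono)
      fix i assume "i \<in> {1..N}"
      then have "elem \<epsilon> i (wm 1 + 1) \<le> 1 / \<epsilon>" using that by (intro elem_le_inverse) auto
      also have "\<dots> \<le> 1 / \<epsilon>0" using False \<epsilon>0(1) by (intro divide_left_mono) auto
      finally show "elem \<epsilon> i (wm 1 + 1) \<le> 1 / \<epsilon>0" .
    qed auto
    then show ?thesis by simp
  qed
  then show ?thesis by blast
qed

text \<open>
  The first summand bounds the oscillation of the solution on the well and the correction, the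
  second one is the error of the uncorrected part at the left end of the well.
\<close>

definition well_error :: "(int \<Rightarrow> real) \<Rightarrow> real \<Rightarrow> int \<Rightarrow> real" where
  "well_error F \<epsilon> j =
     prefactor \<epsilon> * ((\<Sum>i\<in>{1..N}. \<bar>gen F i\<bar> * (elem \<epsilon> i (ep j) - elem \<epsilon> i (em j))) + \<bar>defect F \<epsilon>\<bar>)
     + \<bar>prefactor \<epsilon> * (\<Sum>i\<in>{1..N}. gen F i * elem \<epsilon> i (em j)) - (F j - F 1)\<bar>"

lemma well_error_limit:
  assumes "j \<in> {1..N}"
  shows "((\<lambda>\<epsilon>. well_error F \<epsilon> j) \<longlongrightarrow> 0) (at_right 0)"
proof -
  have "(defect F \<longlongrightarrow> (\<Sum>i\<in>{1..N}. gen F i * level i (N + 1))) (at_right 0)"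
    unfolding defect_def[abs_def] by (intro tendsto_intros elem_limit_period)
  then have d: "(defect F \<longlongrightarrow> 0) (at_right 0)"
    using sum_gen_level[of "N + 1" F] N_pos by (simp add: wrap_end)
  have s: "((\<lambda>\<epsilon>. \<Sum>i\<in>{1..N}. gen F i * elem \<epsilon> i (em j)) \<longlongrightarrow> F j - F 1) (at_right 0)"
  proof -
    have "((\<lambda>\<epsilon>. \<Sum>i\<in>{1..N}. gen F i * elem \<epsilon> i (em j)) \<longlongrightarrow> (\<Sum>i\<in>{1..N}. gen F i * level i j)) (at_right 0)"
      by (intro tendsto_intros elem_limit_wells(1) assms)
    then show ?thesis using sum_gen_level[of j F] assms wrap_id[OF assms] by simp
  qed
  have "((\<lambda>\<epsilon>. well_error F \<epsilon> j) \<longlongrightarrow>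
      1 * ((\<Sum>i\<in>{1..N}. \<bar>gen F i\<bar> * (level i j - level i j)) + \<bar>0\<bar>) + \<bar>1 * (F j - F 1) - (F j - F 1)\<bar>) (at_right 0)"
    unfolding well_error_def
    by (intro tendsto_add tendsto_mult tendsto_sum tendsto_diff tendsto_rabs tendsto_const
        elem_limit_wells assms prefactor_limit d s)
  then show ?thesis by simp
qed

text \<open>
  On a well the elementary solutions differ from their values at \<open>em j\<close> by at most
  their increments over the well, which makes the estimate uniform in \<open>x\<close>.
\<close>

lemma well_error_bound:
  assumes "j \<in> {1..N}" and "\<epsilon> > 0" and "\<epsilon> < 1" and "em j \<le> x" and "x \<le> ep j"
  shows "\<bar>f_of F \<epsilon> x - F j\<bar> \<le> well_error F \<epsilon> j"
proof -
  note w = well_in_period[OF assms(1)]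
  have mono: "elem \<epsilon> i (em j) \<le> elem \<epsilon> i x" "elem \<epsilon> i x \<le> elem \<epsilon> i (ep j)" if "i \<in> {1..N}" for i
    using w assms by (auto intro!: elem_mono that)
  define u where "u = (\<Sum>i\<in>{1..N}. gen F i * (elem \<epsilon> i x - elem \<epsilon> i (em j)))"
  have "\<bar>u\<bar> \<le> (\<Sum>i\<in>{1..N}. \<bar>gen F i\<bar> * (elem \<epsilon> i (ep j) - elem \<epsilon> i (em j)))"
    unfolding u_def
    by (rule order_trans[OF sum_abs sum_mono]) (use mono in \<open>auto simp: abs_mult intro!: mult_left_mono\<close>)
  moreover have "\<bar>r_of F \<epsilon> * elem \<epsilon> 1 x\<bar> \<le> \<bar>defect F \<epsilon>\<bar>"
  proof -
    have "0 \<le> elem \<epsilon> 1 x" "elem \<epsilon> 1 x \<le> elem \<epsilon> 1 (wm 1 + 1)"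
      using w assms by (auto intro!: elem_nonneg elem_mono one_in_range)
    then have "\<bar>r_of F \<epsilon> * elem \<epsilon> 1 x\<bar> \<le> \<bar>r_of F \<epsilon> * elem \<epsilon> 1 (wm 1 + 1)\<bar>"
      by (auto simp: abs_mult intro!: mult_left_mono)
    then show ?thesis unfolding r_of_eq[OF assms(2)] .
  qed
  ultimately have "\<bar>u - r_of F \<epsilon> * elem \<epsilon> 1 x\<bar>
      \<le> (\<Sum>i\<in>{1..N}. \<bar>gen F i\<bar> * (elem \<epsilon> i (ep j) - elem \<epsilon> i (em j))) + \<bar>defect F \<epsilon>\<bar>"
    by linarith
  then have "\<bar>prefactor \<epsilon> * (u - r_of F \<epsilon> * elem \<epsilon> 1 x)\<bar>
      \<le> prefactor \<epsilon> * ((\<Sum>i\<in>{1..N}. \<bar>gen F i\<bar> * (elem \<epsilon> i (ep j) - elem \<epsilon> i (em j))) + \<bar>defect F \<epsilon>\<bar>)"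
    unfolding abs_mult using prefactor_bounds[OF assms(2,3)] by (auto intro: mult_left_mono)
  moreover have "f_of F \<epsilon> x - F j = prefactor \<epsilon> * (u - r_of F \<epsilon> * elem \<epsilon> 1 x)
      + (prefactor \<epsilon> * (\<Sum>i\<in>{1..N}. gen F i * elem \<epsilon> i (em j)) - (F j - F 1))"
    unfolding f_of_eq[OF assms(2)] u_def by (simp add: right_diff_distrib sum_subtractf algebra_simps)
  ultimately show ?thesis unfolding well_error_def by linarith
qed

lemma torus_well_cases:
  assumes "\<theta> \<in> torus_wells N em ep"
  obtains j x where "j \<in> {1..N}" "em j \<le> x" "x \<le> ep j"
    "\<And>h. periodic_ext (wm 1) h \<theta> = h x" "\<And>A. well_step N em ep A \<theta> = A j"
proof -
  obtain j r where j: "j \<in> {1..N}" "\<theta> + of_int r \<in> {em j<..<ep j}"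
    using assms by (auto simp: torus_wells_def torus_well_def)
  define x where "x = \<theta> + of_int r"
  have x: "em j < x" "x < ep j" using j by (auto simp: x_def)
  note w = well_in_period[OF j(1)]
  have "\<lfloor>\<theta> - wm 1\<rfloor> = - r"
    by (rule floor_unique) (use x w in \<open>auto simp: x_def\<close>)
  then have per: "periodic_ext (wm 1) h \<theta> = h x" for h
    by (simp add: periodic_ext_def x_def)
  have chi: "chi i \<theta> = (if i = j then 1 else 0)" if "i \<in> {1..N}" for i
  proof -
    have "chi i (\<theta> + of_int r) = chi i \<theta>" for r
    proof (induction r rule: int_induct[where k = 0])
      case (step1 r)
      then show ?case using chi_periodic[of i "\<theta> + of_int r"] by (simp add: add.assoc)
    next
      case (step2 r)
      then show ?case using chi_periodic[of i "\<theta> + of_int (r - 1)"] by simp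
    qed simp
    then have "chi i \<theta> = indicator {em i<..<ep i} x"
      using chi_eq[OF that, of x] x w by (simp add: x_def)
    also have "\<dots> = (if i = j then 1 else 0)"
    proof (cases i j rule: linorder_cases)
      case less
      then show ?thesis
        using valleys_ordered[OF that j(1)] well_properties(3)[OF that] well_properties(1)[OF j(1)] x by simp
    next
      case greater
      then show ?thesis
        using valleys_ordered[OF j(1) that] well_properties(3)[OF j(1)] well_properties(1)[OF that] x by simp
    qed (use x in simp)
    finally show ?thesis .
  qed
  have "well_step N em ep A \<theta> = A j" for A
  proof -
    have "well_step N em ep A \<theta> = (\<Sum>i\<in>{1..N}. A i * chi i \<theta>)"
      by (simp add: well_step_def chi_def)
    also have "\<dots> = (\<Sum>i\<in>{1..N}. if i = j then A j else 0)"
      by (intro sum.cong refl) (simp add: chi)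
    also have "\<dots> = A j" using j(1) by (simp only: sum.delta finite_atLeastAtMost_int if_True)
    finally show ?thesis .
  qed
  with that[of j x] j(1) x per show thesis by auto
qed

lemma torus_wells_nonempty: "torus_wells N em ep \<noteq> {}"
proof -
  have "(em 1 + ep 1) / 2 + of_int 0 \<in> {em 1<..<ep 1}"
    using well_in_period[OF one_in_range] by simp
  then show ?thesis using one_in_range unfolding torus_wells_def torus_well_def by blast
qed

lemma solution_bounded:
  "\<exists>C::real. (SUP \<epsilon>\<in>{0<..<1}. SUP \<theta>. ereal \<bar>periodic_ext (wm 1) (f_of F \<epsilon>) \<theta>\<bar>) \<le> ereal C"
proof -
  obtain C where C: "\<And>\<epsilon>. \<epsilon> \<in> {0<..<1} \<Longrightarrow> spread F \<epsilon> \<le> C"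
    using spread_bounded by blast
  have "\<bar>periodic_ext (wm 1) (f_of F \<epsilon>) \<theta>\<bar> \<le> \<bar>F 1\<bar> + prefactor 1 * (2 * C)"
    if "\<epsilon> \<in> {0<..<1}" for \<epsilon> \<theta>
  proof -
    define x where "x = \<theta> - of_int \<lfloor>\<theta> - wm 1\<rfloor>"
    have x: "wm 1 \<le> x" "x \<le> wm 1 + 1" unfolding x_def by linarith+
    have "\<bar>f_of F \<epsilon> x\<bar> \<le> \<bar>F 1\<bar> + prefactor 1 * (2 * spread F \<epsilon>)"
      using that x by (intro f_of_bound) auto
    also have "\<dots> \<le> \<bar>F 1\<bar> + prefactor 1 * (2 * C)"
    proof -
      have "0 \<le> prefactor 1" using B_pos by (simp add: prefactor_def)
      then show ?thesis using C[OF that] by (intro add_left_mono mult_left_mono) auto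
    qed
    finally show ?thesis by (simp add: periodic_ext_def x_def)
  qed
  then show ?thesis
    by (intro exI[of _ "\<bar>F 1\<bar> + prefactor 1 * (2 * C)"] SUP_least) auto
qed

lemma solution_converges:
  "((\<lambda>\<epsilon>. SUP \<theta>\<in>torus_wells N em ep.
      ereal \<bar>periodic_ext (wm 1) (f_of F \<epsilon>) \<theta> - well_step N em ep F \<theta>\<bar>) \<longlongrightarrow> 0) (at_right 0)"
proof -
  define E where "E \<epsilon> = (\<Sum>j\<in>{1..N}. \<bar>well_error F \<epsilon> j\<bar>)" for \<epsilon>
  have "(E \<longlongrightarrow> (\<Sum>j\<in>{1..N}. \<bar>0\<bar>)) (at_right 0)"
    unfolding E_def[abs_def] by (intro tendsto_sum tendsto_rabs well_error_limit)
  then have lim: "((\<lambda>\<epsilon>. ereal (E \<epsilon>)) \<longlongrightarrow> 0) (at_right 0)"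
    by (simp add: zero_ereal_def)
  have "(SUP \<theta>\<in>torus_wells N em ep.
      ereal \<bar>periodic_ext (wm 1) (f_of F \<epsilon>) \<theta> - well_step N em ep F \<theta>\<bar>) \<le> ereal (E \<epsilon>)"
    if "\<epsilon> \<in> {0<..<1}" for \<epsilon>
  proof (rule SUP_least)
    fix \<theta> assume "\<theta> \<in> torus_wells N em ep"
    then obtain j x where j: "j \<in> {1..N}" "em j \<le> x" "x \<le> ep j"
      "\<And>h. periodic_ext (wm 1) h \<theta> = h x" "\<And>A. well_step N em ep A \<theta> = A j"
      by (rule torus_well_cases) (rule that)
    have "\<bar>f_of F \<epsilon> x - F j\<bar> \<le> \<bar>well_error F \<epsilon> j\<bar>"
      using well_error_bound[OF j(1) _ _ j(2,3), of \<epsilon> F] that by auto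
    also have "\<dots> \<le> E \<epsilon>"
      unfolding E_def using j(1) by (intro member_le_sum) auto
    finally show "ereal \<bar>periodic_ext (wm 1) (f_of F \<epsilon>) \<theta> - well_step N em ep F \<theta>\<bar> \<le> ereal (E \<epsilon>)"
      by (simp add: j(4,5))
  qed
  then have upper: "\<forall>\<^sub>F \<epsilon> in at_right 0. (SUP \<theta>\<in>torus_wells N em ep.
      ereal \<bar>periodic_ext (wm 1) (f_of F \<epsilon>) \<theta> - well_step N em ep F \<theta>\<bar>) \<le> ereal (E \<epsilon>)"
    by (intro eventually_at_rightI[of 0 1]) auto
  have lower: "0 \<le> (SUP \<theta>\<in>torus_wells N em ep.
      ereal \<bar>periodic_ext (wm 1) (f_of F \<epsilon>) \<theta> - well_step N em ep F \<theta>\<bar>)" for \<epsilon>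
  proof -
    obtain \<theta> where "\<theta> \<in> torus_wells N em ep" using torus_wells_nonempty by blast
    then show ?thesis by (rule SUP_upper2) simp
  qed
  show ?thesis
    by (rule tendsto_sandwich[OF always_eventually[OF allI[OF lower]] upper tendsto_const lim])
qed

end

theorem proposition9p1:
  fixes b :: "real \<Rightarrow> real"
    and q p N :: int
    and M m L wm wp em ep :: "int \<Rightarrow> real"
    and F :: "int \<Rightarrow> real"
  assumes "admissible_drift b"
    and "critical_points b q M m"
    and "landscape_maxima b q M p L"
    and "deepest_valleys b L N wm wp"
    and "wells b N wm wp em ep"
  shows "(\<forall>\<epsilon>>0.
            f_eps b L N wm wp em ep F \<epsilon> (1 + wm 1) = f_eps b L N wm wp em ep F \<epsilon> (wm 1) \<and>
            solves_elliptic b \<epsilon> (periodic_ext (wm 1) (f_eps b L N wm wp em ep F \<epsilon>))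
              (gbar b L N wm wp em ep F \<epsilon>)) \<and>
         (\<exists>C\<^sub>0::real.
            (SUP \<epsilon>\<in>{0<..<1}. SUP \<theta>. 
               ereal \<bar>periodic_ext (wm 1) (f_eps b L N wm wp em ep F \<epsilon>) \<theta>\<bar>) \<le> ereal C\<^sub>0) \<and>
         ((\<lambda>\<epsilon>. SUP \<theta>\<in>torus_wells N em ep.
               ereal \<bar>periodic_ext (wm 1) (f_eps b L N wm wp em ep F \<epsilon>) \<theta>
                      - well_step N em ep F \<theta>\<bar>) \<longlongrightarrow> 0) (at_right 0)"
proof -
  interpret metastable_drift b q p N M m L wm wp em ep
    by unfold_locales (rule assms)+
  show ?thesis
  proof (intro conjI allI impI)
    fix \<epsilon> :: real assume \<epsilon>: "\<epsilon> > 0"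
    show "f_of F \<epsilon> (1 + wm 1) = f_of F \<epsilon> (wm 1)"
      using f_of_period[OF \<epsilon>, of F] by (simp only: add.commute)
    show "solves_elliptic b \<epsilon> (periodic_ext (wm 1) (f_of F \<epsilon>)) (gbar b L N wm wp em ep F \<epsilon>)"
      unfolding f_of_solves(1)[OF \<epsilon>] by (rule f_of_solves(2)[OF \<epsilon>])
  qed (rule solution_bounded solution_converges)+
qed

end
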